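(* Let $n\geq2$ and $k\geq2$ be integers. Suppose either that $n\geq3$ or that $k$ is even. Then there exists an immersed closed $H^2$-curve $\gamma:\mathbf{T}^1\to\mathbf{R}^n$ with a point of multiplicity $k$ such that $$\bar{B}[\gamma]= \varpi^*k^2.$$ In addition, for an immersed closed $H^2$-curve $\gamma:\mathbf{T}^1\to\mathbf{R}^n$ with a point of multiplicity $k$, this equality is attained if and only if $\gamma$ is a closed $k$-leafed elastica.
   Context: $\mathbf{T}^1:=\mathbf{R}/\mathbf{Z}$; $H^2=W^{2,2}$, and $H^2\hookrightarrow C^1$, so a curve is immersed if $\gamma'\neq0$ everywhere. For an immersed $H^2$-curve $\gamma$ let $\partial_s:=\frac{1}{|\gamma'|}\partial_x$, $ds=|\gamma'|dx$, $\kappa:=\partial_s^2\gamma$, $L[\gamma]:=\int_\gamma ds$, $B[\gamma]:=\int_\gamma|\kappa|^2ds$, $\bar{B}[\gamma]:=L[\gamma]B[\gamma]$. A curve $\gamma$ has a point $p$ of multiplicity $k$ if $\gamma^{-1}(p)$ contains at least $k$ distinct points. For $m\in(0,1)$ let $F(x,m)=\int_0^x\frac{d\theta}{\sqrt{1-m\sin^2\theta}}$, $K(m)=F(\pi/2,m)$, $E(m)=\int_0^{\pi/2}\sqrt{1-m\sin^2\theta}\,d\theta$, $\operatorname{am}(\cdot,m):=F^{-1}(\cdot,m)$ on $\mathbf{R}$, $\operatorname{cn}(x,m):=\cos(\operatorname{am}(x,m))$. Let $m^*\in(0,1)$ be the unique parameter with $K(m^* )=2E(m^* )$, and $\varpi^*:=32(2m^*-1)E(m^*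 )^2$. A half-fold figure-eight elastica is an immersed curve $\gamma:[a,b]\to\mathbf{R}^n$ that is contained in a plane and whose signed curvature in that plane, as a function of arclength $s\in[0,L]$ ($L$ its length), is up to the choice of sign $\mathrm{k}(s)=2\sqrt{m^*}\Lambda\operatorname{cn}(\Lambda s-K(m^* ),m^* )$ with $\Lambda=2K(m^* )/L$. An immersed $H^2$-curve $\gamma:[a,b]\to\mathbf{R}^n$ is a $k$-leafed elastica if there are $a=a_0<a_1<\dots<a_k=b$ such that each $\gamma|_{[a_{i-1},a_i]}$, $i=1,\dots,k$, is a half-fold figure-eight elastica and all these $k$ pieces have the same length. A closed $H^2$-curve $\gamma:\mathbf{T}^1\to\mathbf{R}^n$ is a closed $k$-leafed elastica if there is $t_0\in\mathbf{T}^1$ such that $\tilde\gamma:[0,1]\to\mathbf{R}^n$, $\tilde\gamma(t):=\gamma(t+t_0)$, is a $k$-leafed elastica. *)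

theory Defs
  imports "HOL-Analysis.Analysis"
begin

section \<open>Sobolev curves\<close>

definition test_function :: "real \<Rightarrow> real \<Rightarrow> (real \<Rightarrow> real) \<Rightarrow> bool" where
  "test_function a b \<phi> \<longleftrightarrow>
     (\<forall>j x. (deriv ^^ j) \<phi> differentiable (at x)) \<and>
     (\<exists>c d. a < c \<and> d < b \<and> (\<forall>x. x \<notin> {c..d} \<longrightarrow> \<phi> x = 0))"

definition locally_L1 :: "real \<Rightarrow> real \<Rightarrow> (real \<Rightarrow> 'a::euclidean_space) \<Rightarrow> bool" where
  "locally_L1 a b f \<longleftrightarrow> (\<forall>c d. a < c \<and> d < b \<longrightarrow> set_integrable lebesgue {c..d} f)"

definition L2 :: "real \<Rightarrow> real \<Rightarrow> (real \<Rightarrow> 'a::euclidean_space) \<Rightarrow> bool" where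
  "L2 a b f \<longleftrightarrow> set_borel_measurable lebesgue {a<..<b} f \<and>
     set_integrable lebesgue {a<..<b} (\<lambda>x. (norm (f x))\<^sup>2)"

definition has_weak_deriv ::
  "real \<Rightarrow> real \<Rightarrow> (real \<Rightarrow> 'a::euclidean_space) \<Rightarrow> (real \<Rightarrow> 'a) \<Rightarrow> bool" where
  "has_weak_deriv a b f g \<longleftrightarrow> locally_L1 a b f \<and> locally_L1 a b g \<and>
     (\<forall>\<phi>. test_function a b \<phi> \<longrightarrow>
        (LINT x:{a<..<b}|lebesgue. deriv \<phi> x *\<^sub>R f x)
          = - (LINT x:{a<..<b}|lebesgue. \<phi> x *\<^sub>R g x))"

text \<open>Weak derivatives are unique only up to null sets, so \<open>weak_deriv a b f\<close> may only be used
  under an integral or an almost-everywhere quantifier.\<close>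

definition weak_deriv ::
  "real \<Rightarrow> real \<Rightarrow> (real \<Rightarrow> 'a::euclidean_space) \<Rightarrow> real \<Rightarrow> 'a" where
  "weak_deriv a b f = (SOME g. has_weak_deriv a b f g)"

definition W22 :: "real \<Rightarrow> real \<Rightarrow> (real \<Rightarrow> 'a::euclidean_space) \<Rightarrow> bool" where
  "W22 a b f \<longleftrightarrow> L2 a b f \<and>
     (\<exists>g h. L2 a b g \<and> L2 a b h \<and> has_weak_deriv a b f g \<and> has_weak_deriv a b g h)"

text \<open>A curve \<open>[a,b] \<rightarrow> \<real>\<^sup>n\<close> is a function on \<open>real\<close> of which only the values on \<open>{a..b}\<close> matter.
  Continuity selects the continuous representative of the \<open>W\<^sup>2\<^sup>,\<^sup>2\<close> class, which is continuously
  differentiable on \<open>{a..b}\<close> by the Sobolev embedding; \<open>velocity\<close> is its classical derivative,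
  one-sided at the end points.\<close>

definition H2_curve :: "real \<Rightarrow> real \<Rightarrow> (real \<Rightarrow> 'a::euclidean_space) \<Rightarrow> bool" where
  "H2_curve a b \<gamma> \<longleftrightarrow> a < b \<and> continuous_on {a..b} \<gamma> \<and> W22 a b \<gamma>"

definition velocity :: "real \<Rightarrow> real \<Rightarrow> (real \<Rightarrow> 'a::euclidean_space) \<Rightarrow> real \<Rightarrow> 'a" where
  "velocity a b \<gamma> x = vector_derivative \<gamma> (at x within {a..b})"

definition immersed_H2_curve :: "real \<Rightarrow> real \<Rightarrow> (real \<Rightarrow> 'a::euclidean_space) \<Rightarrow> bool" where
  "immersed_H2_curve a b \<gamma> \<longleftrightarrow> H2_curve a b \<gamma> \<and> (\<forall>x\<in>{a..b}. velocity a b \<gamma> x \<noteq> 0)"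

text \<open>A curve on the circle \<open>\<real>/\<int>\<close> is a 1-periodic function on \<open>real\<close>.
  Since the circle is compact, being \<open>H\<^sup>2\<close> on it is the same as being \<open>H\<^sup>2\<close> on every bounded
  interval of the universal cover (this includes intervals across the seam).\<close>

definition closed_H2_curve :: "(real \<Rightarrow> 'a::euclidean_space) \<Rightarrow> bool" where
  "closed_H2_curve \<gamma> \<longleftrightarrow> (\<forall>t. \<gamma> (t + 1) = \<gamma> t) \<and> (\<forall>a b. a < b \<longrightarrow> H2_curve a b \<gamma>)"

definition immersed_closed_H2_curve :: "(real \<Rightarrow> 'a::euclidean_space) \<Rightarrow> bool" where
  "immersed_closed_H2_curve \<gamma> \<longleftrightarrow>
     closed_H2_curve \<gamma> \<and> (\<forall>x. vector_derivative \<gamma> (at x) \<noteq> 0)"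

text \<open>The points of the circle are represented by \<open>{0..<1}\<close>.\<close>

definition has_multiplicity :: "(real \<Rightarrow> 'a::euclidean_space) \<Rightarrow> 'a \<Rightarrow> nat \<Rightarrow> bool" where
  "has_multiplicity \<gamma> p k \<longleftrightarrow>
     (\<exists>S \<subseteq> {0..<1}. finite S \<and> card S = k \<and> (\<forall>x\<in>S. \<gamma> x = p))"

section \<open>Length, curvature and bending energy\<close>

definition arc_deriv ::
  "real \<Rightarrow> real \<Rightarrow> (real \<Rightarrow> 'a::euclidean_space) \<Rightarrow> (real \<Rightarrow> 'a) \<Rightarrow> real \<Rightarrow> 'a" where
  "arc_deriv a b \<gamma> f x = (1 / norm (velocity a b \<gamma> x)) *\<^sub>R weak_deriv a b f x"

definition curvature :: "real \<Rightarrow> real \<Rightarrow> (real \<Rightarrow> 'a::euclidean_space) \<Rightarrow> real \<Rightarrow> 'a" where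
  "curvature a b \<gamma> = arc_deriv a b \<gamma> (arc_deriv a b \<gamma> \<gamma>)"

definition curve_length :: "real \<Rightarrow> real \<Rightarrow> (real \<Rightarrow> 'a::euclidean_space) \<Rightarrow> real" where
  "curve_length a b \<gamma> = (LINT x:{a..b}|lebesgue. norm (velocity a b \<gamma> x))"

definition bending_energy :: "real \<Rightarrow> real \<Rightarrow> (real \<Rightarrow> 'a::euclidean_space) \<Rightarrow> real" where
  "bending_energy a b \<gamma> =
     (LINT x:{a..b}|lebesgue. (norm (curvature a b \<gamma> x))\<^sup>2 * norm (velocity a b \<gamma> x))"

definition normalized_bending_energy :: "(real \<Rightarrow> 'a::euclidean_space) \<Rightarrow> real" where
  "normalized_bending_energy \<gamma> = curve_length 0 1 \<gamma> * bending_energy 0 1 \<gamma>"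

definition arclength_param ::
  "real \<Rightarrow> real \<Rightarrow> (real \<Rightarrow> 'a::euclidean_space) \<Rightarrow> real \<Rightarrow> real" where
  "arclength_param a b \<gamma> x = (LINT t:{a..x}|lebesgue. norm (velocity a b \<gamma> t))"

text \<open>\<open>(u, v)\<close> is a positively oriented orthonormal basis of the direction space of the plane;
  the unit normal is the unit tangent rotated by \<open>\<pi>/2\<close> in that orientation.\<close>

definition signed_curvature ::
  "real \<Rightarrow> real \<Rightarrow> 'a::euclidean_space \<Rightarrow> 'a \<Rightarrow> (real \<Rightarrow> 'a) \<Rightarrow> real \<Rightarrow> real" where
  "signed_curvature a b u v \<gamma> x =
     (let T = arc_deriv a b \<gamma> \<gamma> x;
          N = (T \<bullet> u) *\<^sub>R v - (T \<bullet> v) *\<^sub>R u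
      in curvature a b \<gamma> x \<bullet> N)"

section \<open>Elliptic integrals and functions\<close>

text \<open>The second argument is the parameter \<open>m\<close> (not the modulus).  The interval integral is
  signed, so \<open>ellF x m\<close> is odd in \<open>x\<close>.\<close>

definition ellF :: "real \<Rightarrow> real \<Rightarrow> real" where
  "ellF x m = (LBINT \<theta>=0..ereal x. 1 / sqrt (1 - m * (sin \<theta>)\<^sup>2))"

definition ellK :: "real \<Rightarrow> real" where
  "ellK m = ellF (pi / 2) m"

definition ellE :: "real \<Rightarrow> real" where
  "ellE m = (LBINT \<theta>=0..ereal (pi / 2). sqrt (1 - m * (sin \<theta>)\<^sup>2))"

definition jacobi_am :: "real \<Rightarrow> real \<Rightarrow> real" where
  "jacobi_am x m = inv (\<lambda>y. ellF y m) x"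

definition jacobi_cn :: "real \<Rightarrow> real \<Rightarrow> real" where
  "jacobi_cn x m = cos (jacobi_am x m)"

definition m_star :: real where
  "m_star = (THE m. 0 < m \<and> m < 1 \<and> ellK m = 2 * ellE m)"

definition varpi_star :: real where
  "varpi_star = 32 * (2 * m_star - 1) * (ellE m_star)\<^sup>2"

section \<open>Leafed elasticae\<close>

text \<open>Curvature is compared almost everywhere in the given parametrization, with arclength
  measured from \<open>a\<close>; the sign \<open>\<sigma>\<close> is the same along the whole curve.\<close>

definition half_fold_figure_eight_elastica ::
  "real \<Rightarrow> real \<Rightarrow> (real \<Rightarrow> 'a::euclidean_space) \<Rightarrow> bool" where
  "half_fold_figure_eight_elastica a b \<gamma> \<longleftrightarrow>
     immersed_H2_curve a b \<gamma> \<and>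
     (\<exists>c u v. norm u = 1 \<and> norm v = 1 \<and> u \<bullet> v = 0 \<and>
        (\<forall>x\<in>{a..b}. \<gamma> x - c \<in> span {u, v}) \<and>
        (\<exists>\<sigma>\<in>{1, -1}. AE x in lebesgue. x \<in> {a<..<b} \<longrightarrow>
           (let \<Lambda> = 2 * ellK m_star / curve_length a b \<gamma> in
            signed_curvature a b u v \<gamma> x =
              \<sigma> * (2 * sqrt m_star * \<Lambda> *
                jacobi_cn (\<Lambda> * arclength_param a b \<gamma> x - ellK m_star) m_star))))"

definition leafed_elastica ::
  "nat \<Rightarrow> real \<Rightarrow> real \<Rightarrow> (real \<Rightarrow> 'a::euclidean_space) \<Rightarrow> bool" where
  "leafed_elastica k a b \<gamma> \<longleftrightarrow>
     immersed_H2_curve a b \<gamma> \<and>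
     (\<exists>p :: nat \<Rightarrow> real. p 0 = a \<and> p k = b \<and> (\<forall>i<k. p i < p (Suc i)) \<and>
        (\<forall>i<k. half_fold_figure_eight_elastica (p i) (p (Suc i)) \<gamma>) \<and>
        (\<forall>i<k. \<forall>j<k. curve_length (p i) (p (Suc i)) \<gamma> = curve_length (p j) (p (Suc j)) \<gamma>))"

definition closed_leafed_elastica :: "nat \<Rightarrow> (real \<Rightarrow> 'a::euclidean_space) \<Rightarrow> bool" where
  "closed_leafed_elastica k \<gamma> \<longleftrightarrow>
     closed_H2_curve \<gamma> \<and> (\<exists>t\<^sub>0. leafed_elastica k 0 1 (\<lambda>t. \<gamma> (t + t\<^sub>0)))"

end

theory Submission
  imports Defs
begin

text \<open>Cutting a closed curve at the \<open>k\<close> preimages of the multiple point gives \<open>k\<close> arcs with coinciding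
  end points, so everything rests on the bound \<open>L B \<ge> \<varpi>\<^sup>*\<close> for one such arc and on its equality case.
  Let \<open>T\<close> be the unit tangent, \<open>e\<close> its value at the midpoint, and \<open>z = T \<bullet> e\<close>. Then
  \<open>|T'|\<^sup>2 \<ge> z'\<^sup>2 / (1 - z\<^sup>2)\<close>, which is jointly convex in \<open>(z, z')\<close>, while closing up is the linear
  constraint \<open>\<integral>z = 0\<close>. The figure-eight leaf is a critical point, hence a global minimizer, of this convex
  problem. Written out, with \<open>z\<^sub>0\<close> the profile of the leaf and \<open>A = z\<^sub>0' / (1 - z\<^sub>0\<^sup>2)\<close>, the difference of the energy
  densities is \<open>|T' - A (e - z T)|\<^sup>2 + A\<^sup>2 (z - z\<^sub>0)\<^sup>2 + 2 (A (z - z\<^sub>0))'\<close> plus a multiple of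
  \<open>z - z\<^sub>0\<close>. In the equality case \<open>z = z\<^sub>0\<close> and \<open>T' = A (e - z T)\<close>, which forces the arc to be planar.

  For existence, consecutive leaves are glued along a cyclic sequence of \<open>k\<close> unit vectors in which neighbours have
  inner product \<open>1 - 8 m\<^sup>* + 8 (m\<^sup>*)\<^sup>2\<close>; for odd \<open>k\<close> this needs three vectors with this
  mutual inner product, which exist in \<open>\<real>\<^sup>3\<close> because \<open>m\<^sup>* \<ge> 3/4\<close>.\<close>

section \<open>Indefinite integrals\<close>

text \<open>The obstacle is that the calibrating field A is singular: z_0 equals 1 at the midpoint
  of the leaf, so A has a simple pole there. Taking e to be the competitor's own midpoint tangent
  gives z - 1 = -|T - e|^2 / 2, which is small compared with the distance to the midpoint, so A (z -
  z_0) tends to 0 and the total derivative contributes nothing there. At the two ends A vanishes, so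
  the end tangents stay free. In the equality case the pole decouples the two halves of the arc,
  since any normal direction is compatible with T = e; the component of the closing condition
  orthogonal to e couples them again. The relation K = 2 E says exactly that z_0 has mean zero. The
  number 1 - 8 m + 8 m^2 is the inner product of the two end tangents of a leaf, and m >= 3/4 keeps
  it at or above -1/2, the least common inner product of three unit vectors. As competitors are
  merely H^2, the calculus is done with indefinite integrals: a function is paired with an
  integrable density and pointwise identities hold almost everywhere.\<close>

lemma absolutely_integrable_subinterval:
  fixes g :: "real \<Rightarrow> 'a::euclidean_space"
  assumes "g absolutely_integrable_on {a..b}" "a \<le> c" "d \<le> b"
  shows "g absolutely_integrable_on {c..d}"
  using absolutely_integrable_on_subinterval[OF assms(1), of c d] assms by auto

text \<open>A Dynkin argument: the Borel sets over which the integral vanishes are closed under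
  complements and disjoint unions and contain the intersection-stable generator of closed intervals,
  so they are all Borel sets.\<close>

lemma AE_zero_if_interval_integrals_zero_real:
  fixes g :: "real \<Rightarrow> real"
  assumes g: "g absolutely_integrable_on {a..b}"
    and zero: "\<And>u v. a \<le> u \<Longrightarrow> u \<le> v \<Longrightarrow> v \<le> b \<Longrightarrow> integral {u..v} g = 0"
  shows "AE x in lebesgue. x \<in> {a..b} \<longrightarrow> g x = 0"
proof -
  define G where "G x = indicator {a..b} x *\<^sub>R g x" for x
  have G: "integrable lebesgue G"
    using g by (simp add: set_integrable_def G_def[abs_def])
  \<comment> \<open>The induction over sets runs on the Borel sigma-algebra, so the Lebesgue
    measurable function is first replaced by a Borel representative.\<close>
  then obtain G' where G': "G' \<in> borel_measurable lborel" and eq: "AE x in lborel. G x = G' x"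
    using completion_ex_borel_measurable_real[of G lborel] by (auto simp: integrable_iff_bounded)
  have eqL: "AE x in lebesgue. G x = G' x"
    using eq by (rule AE_completion)
  have G'L: "integrable lebesgue G'"
    by (rule integrable_cong_AE_imp[OF G _ eqL]) (rule measurable_completion[OF G'])
  have G'i: "integrable lborel G'"
    using G'L integrable_completion[of G' lborel] G' by simp
  have intv: "(LINT x:{u..v}|lborel. G' x) = 0" for u v
  proof -
    have "(LINT x:{u..v}|lborel. G' x) = (LINT x:{u..v}|lebesgue. G' x)"
      unfolding set_lebesgue_integral_def using G' by (intro integral_completion[symmetric]) auto
    also have "\<dots> = (LINT x:{u..v}|lebesgue. G x)"
      unfolding set_lebesgue_integral_def
      apply (rule integral_cong_AE)
      subgoal using G' by (intro borel_measurable_scaleR borel_measurable_indicator measurable_completion) auto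
      subgoal using G by (intro borel_measurable_scaleR borel_measurable_indicator) auto
      subgoal using eqL by eventually_elim auto
      done
    also have "\<dots> = (LINT x:{max a u..min b v}|lebesgue. g x)"
      unfolding set_lebesgue_integral_def G_def
      by (intro Bochner_Integration.integral_cong) (auto simp: indicator_def)
    also have "\<dots> = integral {max a u..min b v} g"
      by (rule set_lebesgue_integral_eq_integral(2)) (rule absolutely_integrable_subinterval[OF g], auto)
    also have "\<dots> = 0"
      by (cases "max a u \<le> min b v") (auto intro!: zero)
    finally show ?thesis .
  qed
  have meas: "(LINT x:A|lborel. G' x) = 0" if A: "A \<in> sets borel" for A
  proof -
    have 1: "Int_stable (range (\<lambda>(a, b). {a..b::real}))"
      by (auto simp: Int_stable_def)
    have 2: "range (\<lambda>(a, b). {a..b::real}) \<subseteq> Pow UNIV"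
      by auto
    have 3: "A \<in> sigma_sets UNIV (range (\<lambda>(a, b). {a..b::real}))"
      using A unfolding borel_eq_atLeastAtMost by simp
    \<comment> \<open>Needed for the complement case below: the integral over the whole line
      vanishes because the extension by zero reduces it to \<open>{a..b}\<close>.\<close>
    have UN: "(LINT x:UNIV|lborel. G' x) = 0"
    proof -
      have "(LINT x:UNIV|lborel. G' x) = (LINT x:{a..b}|lborel. G' x)"
        unfolding set_lebesgue_integral_def
        apply (rule integral_cong_AE)
        subgoal using G' by (intro borel_measurable_scaleR borel_measurable_indicator) auto
        subgoal using G' by (intro borel_measurable_scaleR borel_measurable_indicator) auto
        subgoal using eq
        proof eventually_elim
          case (elim x)
          then show ?case by (cases "x \<in> {a..b}") (auto simp: G_def)
        qed
        done
      then show ?thesis using intv by simp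
    qed
    from 1 2 3 show ?thesis
    proof (induction rule: sigma_sets_induct_disjoint)
      case (basic A) then show ?case using intv by auto
    next
      case empty then show ?case by (simp add: set_lebesgue_integral_def)
    next
      case (compl A)
      then have A: "A \<in> sets borel"
        by (simp add: borel_eq_atLeastAtMost)
      have "(LINT x:UNIV|lborel. G' x) = (LINT x:(UNIV - A) \<union> A|lborel. G' x)"
        by simp
      also have "\<dots> = (LINT x:UNIV - A|lborel. G' x) + (LINT x:A|lborel. G' x)"
        by (intro set_integral_Un) (use A G'i integrable_mult_indicator[of _ lborel G'] in \<open>auto simp: set_integrable_def\<close>)
      finally show ?case using UN compl by simp
    next
      case (union F)
      then have F: "\<And>i. F i \<in> sets borel"
        by (simp add: borel_eq_atLeastAtMost subset_eq)
      have "(LINT x:(\<Union>i. F i)|lborel. G' x) = (\<Sum>i. (LINT x:(F i)|lborel. G' x))"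
        apply (rule lebesgue_integral_countable_add)
        using F union(1) G'i integrable_mult_indicator[of _ lborel G'] by (auto simp: set_integrable_def disjoint_family_on_def)
      then show ?case using union by simp
    qed
  qed
  have "AE x in lborel. G' x = 0"
    by (rule sigma_finite_measure.density_zero[OF sigma_finite_lborel G'i]) (use meas in auto)
  then have "AE x in lebesgue. G' x = 0"
    by (rule AE_completion)
  with eqL show ?thesis
    by eventually_elim (auto simp: G_def indicator_def)
qed

lemma AE_zero_if_interval_integrals_zero:
  fixes g :: "real \<Rightarrow> 'a::euclidean_space"
  assumes g: "g absolutely_integrable_on {a..b}"
    and zero: "\<And>u v. a \<le> u \<Longrightarrow> u \<le> v \<Longrightarrow> v \<le> b \<Longrightarrow> integral {u..v} g = 0"
  shows "AE x in lebesgue. x \<in> {a..b} \<longrightarrow> g x = 0"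
proof -
  have "AE x in lebesgue. x \<in> {a..b} \<longrightarrow> g x \<bullet> i = 0" if "i \<in> Basis" for i
  proof (rule AE_zero_if_interval_integrals_zero_real)
    show "(\<lambda>x. g x \<bullet> i) absolutely_integrable_on {a..b}"
      using absolutely_integrable_component[OF g] .
    fix u v assume uv: "a \<le> u" "u \<le> v" "v \<le> b"
    have "g integrable_on {u..v}"
      using absolutely_integrable_subinterval[OF g, of u v] uv set_lebesgue_integral_eq_integral(1) by blast
    then show "integral {u..v} (\<lambda>x. g x \<bullet> i) = 0"
      using zero[OF uv] by (simp add: integral_component_eq)
  qed
  then have "AE x in lebesgue. \<forall>i\<in>Basis. x \<in> {a..b} \<longrightarrow> g x \<bullet> i = 0"
    by (intro AE_finite_allI) auto
  then show ?thesis
    by eventually_elim (auto intro: euclidean_eqI)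
qed

lemma AE_lebesgue_negligible:
  "(AE x in lebesgue. P x) \<longleftrightarrow> negligible {x. \<not> P x}"
  by (auto simp: completion.AE_iff_null_sets negligible_iff_null_sets)

text \<open>Absolute continuity on \<open>{a..b}\<close> together with a chosen density. The
  fundamental theorem of calculus is built into the definition, so almost-everywhere
  differentiability never has to be discussed; the density is determined up to a null set
  (\<open>AC_unique\<close>).\<close>

definition AC :: "real \<Rightarrow> real \<Rightarrow> (real \<Rightarrow> 'a::euclidean_space) \<Rightarrow> (real \<Rightarrow> 'a) \<Rightarrow> bool" where
  "AC a b f g \<longleftrightarrow> g absolutely_integrable_on {a..b} \<and> (\<forall>x\<in>{a..b}. f x = f a + integral {a..x} g)"

lemma AC_integrable: "AC a b f g \<Longrightarrow> g absolutely_integrable_on {a..b}"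
  by (simp add: AC_def)

lemma AC_integrable_on: "AC a b f g \<Longrightarrow> a \<le> u \<Longrightarrow> v \<le> b \<Longrightarrow> g integrable_on {u..v}"
  unfolding AC_def by (meson absolutely_integrable_subinterval set_lebesgue_integral_eq_integral(1))

lemma AC_integral:
  assumes "AC a b f g" "a \<le> u" "u \<le> v" "v \<le> b"
  shows "integral {u..v} g = f v - f u"
proof -
  have "integral {a..u} g + integral {u..v} g = integral {a..v} g"
    using assms by (intro Henstock_Kurzweil_Integration.integral_combine AC_integrable_on) auto
  moreover have "f u = f a + integral {a..u} g" "f v = f a + integral {a..v} g"
    using assms unfolding AC_def by (meson atLeastAtMost_iff order_trans)+
  ultimately show ?thesis by (simp add: algebra_simps)
qed

lemma AC_I:
  assumes "g absolutely_integrable_on {a..b}"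
    "\<And>u v. a \<le> u \<Longrightarrow> u \<le> v \<Longrightarrow> v \<le> b \<Longrightarrow> integral {u..v} g = f v - f u"
  shows "AC a b f g"
  using assms(1) assms(2)[of a] by (auto simp: AC_def)

lemma AC_subinterval: "AC a b f g \<Longrightarrow> a \<le> c \<Longrightarrow> d \<le> b \<Longrightarrow> AC c d f g"
  by (rule AC_I) (auto intro: absolutely_integrable_subinterval AC_integrable intro!: AC_integral)

lemma AC_continuous: "AC a b f g \<Longrightarrow> continuous_on {a..b} f"
proof -
  assume A: "AC a b f g"
  then have "continuous_on {a..b} (\<lambda>x. f a + integral {a..x} g)"
    by (intro continuous_intros indefinite_integral_continuous_1 AC_integrable_on) auto
  then show ?thesis
    by (rule continuous_on_eq) (use A in \<open>unfold AC_def, metis\<close>)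
qed

lemma AC_cong:
  assumes "AC a b f g" "\<And>x. x \<in> {a..b} \<Longrightarrow> f' x = f x"
    "negligible N" "\<And>x. x \<in> {a..b} - N \<Longrightarrow> g' x = g x"
  shows "AC a b f' g'"
proof (rule AC_I)
  show "g' absolutely_integrable_on {a..b}"
    by (rule absolutely_integrable_spike[OF AC_integrable[OF assms(1)] assms(3)]) (use assms in auto)
  fix u v assume uv: "a \<le> u" "u \<le> v" "v \<le> b"
  have "integral {u..v} g' = integral {u..v} g"
    by (rule integral_spike[OF assms(3)]) (use assms uv in auto)
  then show "integral {u..v} g' = f' v - f' u"
    using AC_integral[OF assms(1) uv] assms(2)[of u] assms(2)[of v] uv by simp
qed

lemma AC_of_deriv:
  assumes "\<And>x. x \<in> {a..b} \<Longrightarrow> (f has_vector_derivative g x) (at x within {a..b})"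
    "continuous_on {a..b} g"
  shows "AC a b f g"
proof (rule AC_I)
  show "g absolutely_integrable_on {a..b}"
    using assms(2) by (rule absolutely_integrable_continuous_real)
  fix u v assume uv: "a \<le> u" "u \<le> v" "v \<le> b"
  have "(g has_integral f v - f u) {u..v}"
    using uv by (intro fundamental_theorem_of_calculus has_vector_derivative_within_subset[OF assms(1)]) auto
  then show "integral {u..v} g = f v - f u" by (rule integral_unique)
qed

lemma AC_has_vector_derivative:
  assumes "AC a b f g" "continuous_on {a..b} g" "x \<in> {a..b}"
  shows "(f has_vector_derivative g x) (at x within {a..b})"
proof -
  have "((\<lambda>x. f a + integral {a..x} g) has_vector_derivative g x) (at x within {a..b})"
    by (rule has_vector_derivative_eq_rhs, rule has_vector_derivative_add[OF has_vector_derivative_const])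
       (use integral_has_vector_derivative[OF assms(2,3)] in auto)
  then show ?thesis
    by (rule has_vector_derivative_transform[OF assms(3), rotated]) (use assms(1) in \<open>unfold AC_def, blast\<close>)
qed

text \<open>The difference of two densities of the same function has zero integral over every
  subinterval.\<close>

lemma AC_unique:
  assumes "AC a b f g" "AC a b f g'"
  shows "AE x in lebesgue. x \<in> {a..b} \<longrightarrow> g x = g' x"
proof -
  have "AE x in lebesgue. x \<in> {a..b} \<longrightarrow> g x - g' x = 0"
  proof (rule AE_zero_if_interval_integrals_zero)
    show "(\<lambda>x. g x - g' x) absolutely_integrable_on {a..b}"
      by (rule set_integral_diff(1)[OF AC_integrable[OF assms(1)] AC_integrable[OF assms(2)]])
    fix u v assume uv: "a \<le> u" "u \<le> v" "v \<le> b"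
    then show "integral {u..v} (\<lambda>x. g x - g' x) = 0"
      using AC_integral[OF assms(1) uv] AC_integral[OF assms(2) uv]
      by (simp add: integral_diff AC_integrable_on[OF assms(1)] AC_integrable_on[OF assms(2)])
  qed
  then show ?thesis by simp
qed

lemma AC_combine:
  assumes 1: "AC a b f g" and 2: "AC b c f g" and "a \<le> b" "b \<le> c"
  shows "AC a c f g"
proof (rule AC_I)
  have "{a..b} \<union> {b..c} = {a..c}" using assms by auto
  then show gi: "g absolutely_integrable_on {a..c}"
    using absolutely_integrable_Un[OF AC_integrable[OF 1] AC_integrable[OF 2]] by simp
  fix u v assume uv: "a \<le> u" "u \<le> v" "v \<le> c"
  have gi': "g integrable_on {u..v}"
    using absolutely_integrable_subinterval[OF gi uv(1,3)] set_lebesgue_integral_eq_integral(1) by blast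
  consider "v \<le> b" | "b \<le> u" | "u \<le> b" "b \<le> v" by linarith
  then show "integral {u..v} g = f v - f u"
  proof cases
    case 1 then show ?thesis using uv by (intro AC_integral[OF assms(1)]) auto
  next
    case 2 then show ?thesis using uv by (intro AC_integral[OF assms(2)]) auto
  next
    case 3
    then have "integral {u..b} g + integral {b..v} g = integral {u..v} g"
      using gi' by (intro Henstock_Kurzweil_Integration.integral_combine) auto
    then show ?thesis
      using 3 uv AC_integral[OF assms(1), of u b] AC_integral[OF assms(2), of b v] by simp
  qed
qed

lemma AC_linear:
  assumes "AC a b f g" "bounded_linear L"
  shows "AC a b (\<lambda>x. L (f x)) (\<lambda>x. L (g x))"
proof (rule AC_I)
  show "(\<lambda>x. L (g x)) absolutely_integrable_on {a..b}"
    using absolutely_integrable_linear[OF AC_integrable[OF assms(1)] assms(2)] by (simp add: o_def)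
  fix u v assume uv: "a \<le> u" "u \<le> v" "v \<le> b"
  have "integral {u..v} (\<lambda>x. L (g x)) = L (integral {u..v} g)"
    using integral_linear[OF AC_integrable_on[OF assms(1)] assms(2), of u v] uv by (simp add: o_def)
  also have "\<dots> = L (f v) - L (f u)"
    using AC_integral[OF assms(1) uv] assms(2) by (simp add: linear_diff bounded_linear.linear)
  finally show "integral {u..v} (\<lambda>x. L (g x)) = L (f v) - L (f u)" .
qed

lemma AC_add:
  assumes "AC a b f g" "AC a b f' g'"
  shows "AC a b (\<lambda>x. f x + f' x) (\<lambda>x. g x + g' x)"
proof (rule AC_I)
  show "(\<lambda>x. g x + g' x) absolutely_integrable_on {a..b}"
    by (rule set_integral_add(1)[OF AC_integrable[OF assms(1)] AC_integrable[OF assms(2)]])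
  fix u v assume uv: "a \<le> u" "u \<le> v" "v \<le> b"
  then show "integral {u..v} (\<lambda>x. g x + g' x) = f v + f' v - (f u + f' u)"
    using AC_integral[OF assms(1) uv] AC_integral[OF assms(2) uv]
    by (simp add: integral_add AC_integrable_on[OF assms(1)] AC_integrable_on[OF assms(2)])
qed

lemma AC_diff:
  assumes "AC a b f g" "AC a b f' g'"
  shows "AC a b (\<lambda>x. f x - f' x) (\<lambda>x. g x - g' x)"
  using AC_add[OF assms(1) AC_linear[OF assms(2) bounded_linear_minus[OF bounded_linear_ident]]]
  by (simp only: add_uminus_conv_diff)

lemma AC_const: "AC a b (\<lambda>x. c) (\<lambda>x. 0)"
  by (rule AC_of_deriv[OF has_vector_derivative_const continuous_on_const])

lemma eq_0_if_norm_le_all_multiples: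
  fixes c :: real and x :: "'a::real_normed_vector"
  assumes *: "\<And>e::real. e > 0 \<Longrightarrow> norm x \<le> e * c"
  shows "x = 0"
proof -
  have "norm x \<le> 0"
  proof (rule field_le_epsilon)
    fix e :: real assume e: "e > 0"
    define D where "D = 1 + \<bar>c\<bar>"
    have D: "D > 0" "c \<le> D" unfolding D_def by linarith+
    have "e / D > 0" using D e by simp
    then have "norm x \<le> e / D * c" by (rule *)
    moreover have "e / D * c \<le> e / D * D"
      by (rule mult_left_mono) (use \<open>e / D > 0\<close> D in linarith)+
    moreover have "e / D * D = e" using D by simp
    ultimately show "norm x \<le> 0 + e" by linarith
  qed
  then show ?thesis by simp
qed

text \<open>This replaces Lebesgue's differentiation theorem in the product and chain rules below.\<close>

lemma eq_if_increments_negligible: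
  fixes \<Psi> :: "real \<Rightarrow> 'a::real_normed_vector" and M :: "real \<Rightarrow> real"
  assumes "a \<le> b"
    and loc: "\<And>x e. x \<in> {a..b} \<Longrightarrow> e > 0 \<Longrightarrow>
      \<exists>d>0. \<forall>u v. a \<le> u \<and> u \<le> x \<and> x \<le> v \<and> v \<le> b \<and> v - u < d \<longrightarrow>
        norm (\<Psi> v - \<Psi> u) \<le> e * (M v - M u)"
  shows "\<Psi> b = \<Psi> a"
proof -
  have *: "norm (\<Psi> b - \<Psi> a) \<le> e * (M b - M a)" if "e > 0" for e
  proof -
    have "a \<le> a \<and> b \<le> b \<longrightarrow> norm (\<Psi> b - \<Psi> a) \<le> e * (M b - M a)"
    \<comment> \<open>The estimate is additive over adjacent intervals because its right-hand side
      is an increment of \<open>M\<close>, so bisection turns the local hypothesis into a global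
      one.\<close>
    proof (rule Bolzano[where P = "\<lambda>u v. a \<le> u \<and> v \<le> b \<longrightarrow> norm (\<Psi> v - \<Psi> u) \<le> e * (M v - M u)", OF \<open>a \<le> b\<close>])
      fix u v w
      assume trans: "a \<le> u \<and> v \<le> b \<longrightarrow> norm (\<Psi> v - \<Psi> u) \<le> e * (M v - M u)"
        "a \<le> v \<and> w \<le> b \<longrightarrow> norm (\<Psi> w - \<Psi> v) \<le> e * (M w - M v)" "u \<le> v" "v \<le> w"
      show "a \<le> u \<and> w \<le> b \<longrightarrow> norm (\<Psi> w - \<Psi> u) \<le> e * (M w - M u)"
      proof
        assume "a \<le> u \<and> w \<le> b"
        then have "norm (\<Psi> v - \<Psi> u) \<le> e * (M v - M u)" "norm (\<Psi> w - \<Psi> v) \<le> e * (M w - M v)"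
          using trans by simp_all
        moreover have "norm (\<Psi> w - \<Psi> u) \<le> norm (\<Psi> w - \<Psi> v) + norm (\<Psi> v - \<Psi> u)"
          using norm_triangle_ineq[of "\<Psi> w - \<Psi> v" "\<Psi> v - \<Psi> u"] by simp
        ultimately show "norm (\<Psi> w - \<Psi> u) \<le> e * (M w - M u)"
          by (simp add: algebra_simps)
      qed
    next
      fix x assume "a \<le> x" "x \<le> b"
      then have "\<exists>d>0. \<forall>u v. a \<le> u \<and> u \<le> x \<and> x \<le> v \<and> v \<le> b \<and> v - u < d \<longrightarrow>
          norm (\<Psi> v - \<Psi> u) \<le> e * (M v - M u)"
        using that by (intro loc) simp_all
      then show "\<exists>d>0. \<forall>u v. u \<le> x \<and> x \<le> v \<and> v - u < d \<longrightarrow> a \<le> u \<and> v \<le> b \<longrightarrow>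
          norm (\<Psi> v - \<Psi> u) \<le> e * (M v - M u)"
        by (elim ex_forward conj_forward all_forward) simp_all
    qed
    then show ?thesis by simp
  qed
  have "\<Psi> b - \<Psi> a = 0"
    by (rule eq_0_if_norm_le_all_multiples[of _ "M b - M a"]) (rule *)
  then show ?thesis by (rule right_minus_eq[THEN iffD1])
qed

section \<open>Product and chain rules for absolutely continuous functions\<close>

lemma absolutely_integrable_bilinear_continuous:
  fixes h :: "'a::euclidean_space \<Rightarrow> 'b::euclidean_space \<Rightarrow> 'c::euclidean_space" and f :: "real \<Rightarrow> 'a"
  assumes "bounded_bilinear h" "continuous_on {a..b} f" "g absolutely_integrable_on {a..b}"
  shows "(\<lambda>x. h (f x) (g x)) absolutely_integrable_on {a..b}"
proof (rule absolutely_integrable_bounded_measurable_product[of h f _ g])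
  show "bilinear h" using assms by (simp add: bilinear_conv_bounded_bilinear)
  show "f \<in> borel_measurable (lebesgue_on {a..b})"
    using assms by (intro continuous_imp_measurable_on_sets_lebesgue) auto
  show "bounded (f ` {a..b})"
    using assms by (intro compact_imp_bounded compact_continuous_image) auto
qed (use assms in auto)

text \<open>To recognize \<open>P\<close> as a density of \<open>F\<close> it suffices that near
  each point the increments of \<open>F\<close> have some exact density \<open>q\<close>, depending
  on the interval, that differs from \<open>P\<close> by at most \<open>e\<close> times a fixed
  integrable weight \<open>m\<close>. Then \<open>F\<close> minus the integral of \<open>P\<close>
  has increments negligible against those of the integral of \<open>m\<close>.\<close>

lemma AC_if_locally_close:
  fixes F P :: "real \<Rightarrow> 'a::euclidean_space" and m :: "real \<Rightarrow> real"
  assumes P: "P absolutely_integrable_on {a..b}" and m: "m absolutely_integrable_on {a..b}"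
    and loc: "\<And>x e. x \<in> {a..b} \<Longrightarrow> e > 0 \<Longrightarrow> \<exists>d>0. \<forall>u v. a \<le> u \<and> u \<le> x \<and> x \<le> v \<and> v \<le> b \<and> v - u < d \<longrightarrow>
      (\<exists>q. (q has_integral F v - F u) {u..v} \<and> (\<forall>t\<in>{u..v}. norm (q t - P t) \<le> e * m t))"
  shows "AC a b F P"
proof -
  define G where "G x = F x - integral {a..x} P" for x
  have incr: "(g has_integral integral {a..v} g - integral {a..u} g) {u..v}"
    if g: "g absolutely_integrable_on {a..b}" and uv: "a \<le> u" "u \<le> v" "v \<le> b"
    for u v and g :: "real \<Rightarrow> 'b::euclidean_space"
  proof -
    have i: "g integrable_on {s..t}" if "a \<le> s" "t \<le> b" for s t
      using absolutely_integrable_subinterval[OF g that] set_lebesgue_integral_eq_integral(1) by blast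
    have "integral {a..u} g + integral {u..v} g = integral {a..v} g"
      using uv by (intro Henstock_Kurzweil_Integration.integral_combine i) auto
    then have "integral {a..v} g - integral {a..u} g = integral {u..v} g" by (metis add_diff_cancel_left')
    then show ?thesis using i[of u v] uv by (simp add: has_integral_integral)
  qed
  have G: "G x = G a" if x: "x \<in> {a..b}" for x
  proof (rule eq_if_increments_negligible[where \<Psi> = G and M = "\<lambda>x. integral {a..x} m"])
    show "a \<le> x" using x by simp
    fix y e :: real assume "y \<in> {a..x}" and e: "e > 0"
    then have "y \<in> {a..b}" using x by simp
    from loc[OF this e] obtain d where d: "d > 0"
      "\<And>u v. a \<le> u \<and> u \<le> y \<and> y \<le> v \<and> v \<le> b \<and> v - u < d \<Longrightarrow>
        \<exists>q. (q has_integral F v - F u) {u..v} \<and> (\<forall>t\<in>{u..v}. norm (q t - P t) \<le> e * m t)"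
      by metis
    show "\<exists>d>0. \<forall>u v. a \<le> u \<and> u \<le> y \<and> y \<le> v \<and> v \<le> x \<and> v - u < d \<longrightarrow>
        norm (G v - G u) \<le> e * (integral {a..v} m - integral {a..u} m)"
    proof (intro exI[of _ d] conjI allI impI d(1))
      fix u v assume A: "a \<le> u \<and> u \<le> y \<and> y \<le> v \<and> v \<le> x \<and> v - u < d"
      then have uv: "a \<le> u" "u \<le> v" "v \<le> b" using x by auto
      have "a \<le> u \<and> u \<le> y \<and> y \<le> v \<and> v \<le> b \<and> v - u < d" using A x by simp
      from d(2)[OF this] obtain q where q: "(q has_integral F v - F u) {u..v}"
        "\<And>t. t \<in> {u..v} \<Longrightarrow> norm (q t - P t) \<le> e * m t" by blast
      have 1: "((\<lambda>t. q t - P t) has_integral G v - G u) {u..v}"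
        by (rule has_integral_eq_rhs[OF has_integral_diff[OF q(1) incr[OF P uv]]]) (simp add: G_def)
      have 2: "((\<lambda>t. e * m t) has_integral e * (integral {a..v} m - integral {a..u} m)) {u..v}"
        by (rule has_integral_mult_right[OF incr[OF m uv]])
      have "norm (integral {u..v} (\<lambda>t. q t - P t)) \<le> integral {u..v} (\<lambda>t. e * m t)"
        using 1 2 q(2) by (intro integral_norm_bound_integral) (auto simp: integrable_on_def)
      then show "norm (G v - G u) \<le> e * (integral {a..v} m - integral {a..u} m)"
        by (simp only: integral_unique[OF 1] integral_unique[OF 2])
    qed
  qed
  show ?thesis
    unfolding AC_def
  proof (intro conjI ballI P)
    fix x assume "x \<in> {a..b}"
    from G[OF this] show "F x = F a + integral {a..x} P" by (simp add: G_def diff_eq_eq)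
  qed
qed

lemma AC_bilinear:
  fixes h :: "'a::euclidean_space \<Rightarrow> 'b::euclidean_space \<Rightarrow> 'c::euclidean_space"
  assumes h: "bounded_bilinear h" and f: "AC a b f f'" and g: "AC a b g g'"
  shows "AC a b (\<lambda>x. h (f x) (g x)) (\<lambda>x. h (f x) (g' x) + h (f' x) (g x))"
proof -
  interpret h: bounded_bilinear h by fact
  interpret h': bounded_bilinear "\<lambda>x y. h y x" by (rule h.flip)
  obtain C where C: "C > 0" "\<And>x y. norm (h x y) \<le> norm x * norm y * C"
    using h.pos_bounded by blast
  define P where "P x = h (f x) (g' x) + h (f' x) (g x)" for x
  have P1: "(\<lambda>x. h (f x) (g' x)) absolutely_integrable_on {a..b}"
    by (rule absolutely_integrable_bilinear_continuous[OF h AC_continuous[OF f] AC_integrable[OF g]])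
  have P2: "(\<lambda>x. h (f' x) (g x)) absolutely_integrable_on {a..b}"
    by (rule absolutely_integrable_bilinear_continuous[OF h'.bounded_bilinear_axioms AC_continuous[OF g] AC_integrable[OF f]])
  have Pi: "P absolutely_integrable_on {a..b}"
    unfolding P_def by (rule set_integral_add(1)[OF P1 P2])
  define m where "m x = norm (f' x) + norm (g' x)" for x
  have mi: "m absolutely_integrable_on {a..b}"
    unfolding m_def
    by (rule set_integral_add(1)[OF absolutely_integrable_norm[OF AC_integrable[OF f], unfolded o_def]
          absolutely_integrable_norm[OF AC_integrable[OF g], unfolded o_def]])
  have loc: "\<exists>d>0. \<forall>u v. a \<le> u \<and> u \<le> x \<and> x \<le> v \<and> v \<le> b \<and> v - u < d \<longrightarrow>
      (\<exists>q. (q has_integral h (f v) (g v) - h (f u) (g u)) {u..v} \<and> (\<forall>t\<in>{u..v}. norm (q t - P t) \<le> e * m t))"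
    if x: "x \<in> {a..b}" and e: "e > 0" for x e
  proof -
    have e': "e / (2 * C) > 0" using e C by simp
    obtain d1 where d1: "d1 > 0" "\<And>y. y \<in> {a..b} \<Longrightarrow> dist y x < d1 \<Longrightarrow> dist (f y) (f x) < e / (2 * C)"
      using AC_continuous[OF f] x e' unfolding continuous_on_iff by metis
    obtain d2 where d2: "d2 > 0" "\<And>y. y \<in> {a..b} \<Longrightarrow> dist y x < d2 \<Longrightarrow> dist (g y) (g x) < e / (2 * C)"
      using AC_continuous[OF g] x e' unfolding continuous_on_iff by metis
    show ?thesis
    proof (intro exI[of _ "min d1 d2"] conjI allI impI)
      show "min d1 d2 > 0" using d1 d2 by simp
      fix u v assume "a \<le> u \<and> u \<le> x \<and> x \<le> v \<and> v \<le> b \<and> v - u < min d1 d2"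
      then have uv: "a \<le> u" "u \<le> x" "x \<le> v" "v \<le> b" "v - u < d1" "v - u < d2" by auto
      have nf: "norm (f u - f t) * C \<le> e" if "t \<in> {u..v}" for t
      proof -
        have "dist (f u) (f x) < e / (2 * C)" "dist (f t) (f x) < e / (2 * C)"
          using that uv by (auto intro!: d1 simp: dist_real_def)
        then have "norm (f u - f t) \<le> e / (2 * C) + e / (2 * C)"
          using dist_triangle2[of "f u" "f t" "f x"] by (simp add: dist_norm)
        then show ?thesis using C by (simp add: field_simps)
      qed
      have ng: "norm (g v - g t) * C \<le> e" if "t \<in> {u..v}" for t
      proof -
        have "dist (g v) (g x) < e / (2 * C)" "dist (g t) (g x) < e / (2 * C)"
          using that uv by (auto intro!: d2 simp: dist_real_def)
        then have "norm (g v - g t) \<le> e / (2 * C) + e / (2 * C)"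
          using dist_triangle2[of "g v" "g t" "g x"] by (simp add: dist_norm)
        then show ?thesis using C by (simp add: field_simps)
      qed
      have gI: "(g' has_integral g v - g u) {u..v}"
        using AC_integral[OF g, of u v] AC_integrable_on[OF g, of u v] uv by (simp add: has_integral_integral)
      have fI: "(f' has_integral f v - f u) {u..v}"
        using AC_integral[OF f, of u v] AC_integrable_on[OF f, of u v] uv by (simp add: has_integral_integral)
      have 1: "((\<lambda>t. h (f u) (g' t)) has_integral h (f u) (g v - g u)) {u..v}"
        using has_integral_linear[OF gI h.bounded_linear_right[of "f u"]] by (simp add: o_def)
      have 2: "((\<lambda>t. h (f' t) (g v)) has_integral h (f v - f u) (g v)) {u..v}"
        using has_integral_linear[OF fI h.bounded_linear_left[of "g v"]] by (simp add: o_def)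
      have q: "((\<lambda>t. h (f u) (g' t) + h (f' t) (g v)) has_integral h (f v) (g v) - h (f u) (g u)) {u..v}"
        by (rule has_integral_eq_rhs[OF has_integral_add[OF 1 2]]) (simp add: h.diff_left h.diff_right)
      have "norm ((h (f u) (g' t) + h (f' t) (g v)) - P t) \<le> e * m t" if t: "t \<in> {u..v}" for t
      proof -
        have "(h (f u) (g' t) + h (f' t) (g v)) - P t = h (f u - f t) (g' t) + h (f' t) (g v - g t)"
          by (simp add: P_def h.diff_left h.diff_right)
        then have "norm ((h (f u) (g' t) + h (f' t) (g v)) - P t) \<le> norm (h (f u - f t) (g' t)) + norm (h (f' t) (g v - g t))"
          by (metis norm_triangle_ineq)
        also have "\<dots> \<le> norm (f u - f t) * norm (g' t) * C + norm (f' t) * norm (g v - g t) * C"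
          by (intro add_mono C)
        also have "\<dots> = (norm (f u - f t) * C) * norm (g' t) + (norm (g v - g t) * C) * norm (f' t)"
          by (simp add: algebra_simps)
        also have "\<dots> \<le> e * norm (g' t) + e * norm (f' t)"
          using nf[OF t] ng[OF t] by (intro add_mono mult_right_mono) auto
        also have "\<dots> = e * m t" by (simp add: m_def algebra_simps)
        finally show "norm ((h (f u) (g' t) + h (f' t) (g v)) - P t) \<le> e * m t" .
      qed
      with q show "\<exists>q. (q has_integral h (f v) (g v) - h (f u) (g u)) {u..v} \<and> (\<forall>t\<in>{u..v}. norm (q t - P t) \<le> e * m t)"
        by blast
    qed
  qed
  have "AC a b (\<lambda>x. h (f x) (g x)) P"
    by (rule AC_if_locally_close[OF Pi mi loc])
  then show ?thesis by (simp add: P_def[abs_def])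
qed

text \<open>On a short interval the mean value theorem writes the increment of \<open>N o f\<close>
  as one frozen slope times the increment of \<open>f\<close>, and continuity of \<open>N'\<close>
  makes that slope uniformly close to \<open>N' (f t)\<close>. Convexity of \<open>I\<close> keeps
  the intermediate point inside \<open>I\<close>.\<close>

lemma AC_chain:
  fixes f :: "real \<Rightarrow> real" and N :: "real \<Rightarrow> real"
  assumes f: "AC a b f f'" and I: "\<And>x. x \<in> {a..b} \<Longrightarrow> f x \<in> I" "convex I"
    and N: "\<And>y. y \<in> I \<Longrightarrow> (N has_real_derivative N' y) (at y)" and N': "continuous_on I N'"
  shows "AC a b (\<lambda>x. N (f x)) (\<lambda>x. N' (f x) * f' x)"
proof -
  define P where "P x = N' (f x) * f' x" for x
  have cN: "continuous_on {a..b} (\<lambda>x. N' (f x))"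
    by (rule continuous_on_compose2[OF N' AC_continuous[OF f]]) (use I in auto)
  have Pi: "P absolutely_integrable_on {a..b}"
    unfolding P_def
    by (rule absolutely_integrable_bilinear_continuous[OF bounded_bilinear_mult cN AC_integrable[OF f]])
  define m where "m x = norm (f' x)" for x
  have mi: "m absolutely_integrable_on {a..b}"
    unfolding m_def by (rule absolutely_integrable_norm[OF AC_integrable[OF f], unfolded o_def])
  have loc: "\<exists>d>0. \<forall>u v. a \<le> u \<and> u \<le> x \<and> x \<le> v \<and> v \<le> b \<and> v - u < d \<longrightarrow>
      (\<exists>q. (q has_integral N (f v) - N (f u)) {u..v} \<and> (\<forall>t\<in>{u..v}. norm (q t - P t) \<le> e * m t))"
    if x: "x \<in> {a..b}" and e: "e > 0" for x e
  proof -
    have "e / 2 > 0" using e by simp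
    then obtain d0 where d0: "d0 > 0" "\<And>y. y \<in> I \<Longrightarrow> dist y (f x) < d0 \<Longrightarrow> dist (N' y) (N' (f x)) < e / 2"
      using N' I(1)[OF x] unfolding continuous_on_iff by metis
    obtain d1 where d1: "d1 > 0" "\<And>y. y \<in> {a..b} \<Longrightarrow> dist y x < d1 \<Longrightarrow> dist (f y) (f x) < d0"
      using AC_continuous[OF f] x d0(1) unfolding continuous_on_iff by metis
    show ?thesis
    proof (intro exI[of _ d1] conjI allI impI)
      show "d1 > 0" using d1 by simp
      fix u v assume "a \<le> u \<and> u \<le> x \<and> x \<le> v \<and> v \<le> b \<and> v - u < d1"
      then have uv: "a \<le> u" "u \<le> x" "x \<le> v" "v \<le> b" "v - u < d1" by auto
      have near: "\<bar>f t - f x\<bar> < d0" if "t \<in> {u..v}" for t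
        using d1(2)[of t] that uv by (auto simp: dist_real_def)
      have seg: "closed_segment (f u) (f v) \<subseteq> I"
        using I(1)[of u] I(1)[of v] uv by (intro closed_segment_subset I(2)) auto
      obtain \<xi> where \<xi>: "\<xi> \<in> closed_segment (f u) (f v)" "N (f v) - N (f u) = N' \<xi> * (f v - f u)"
      proof -
        consider "f u = f v" | "f u < f v" | "f v < f u" by linarith
        then show thesis
        proof cases
          case 1 then show thesis using that[of "f u"] by simp
        next
          case 2
          have "\<exists>z. f u < z \<and> z < f v \<and> N (f v) - N (f u) = (f v - f u) * N' z"
          proof (rule MVT2[OF 2])
            fix y assume "f u \<le> y" "y \<le> f v"
            then have "y \<in> closed_segment (f u) (f v)" using 2 by (simp add: closed_segment_eq_real_ivl)
            then show "(N has_real_derivative N' y) (at y)"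
              using seg by (intro N) blast
          qed
          then obtain z where "f u < z" "z < f v" "N (f v) - N (f u) = (f v - f u) * N' z" by blast
          then show thesis using 2 by (intro that[of z]) (auto simp: closed_segment_eq_real_ivl algebra_simps)
        next
          case 3
          have "\<exists>z. f v < z \<and> z < f u \<and> N (f u) - N (f v) = (f u - f v) * N' z"
          proof (rule MVT2[OF 3])
            fix y assume "f v \<le> y" "y \<le> f u"
            then have "y \<in> closed_segment (f u) (f v)" using 3 by (simp add: closed_segment_eq_real_ivl)
            then show "(N has_real_derivative N' y) (at y)"
              using seg by (intro N) blast
          qed
          then obtain z where "f v < z" "z < f u" "N (f u) - N (f v) = (f u - f v) * N' z" by blast
          then show thesis using 3 by (intro that[of z]) (auto simp: closed_segment_eq_real_ivl algebra_simps)
        qed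
      qed
      have "\<xi> \<in> I"
        using \<xi>(1) seg by blast
      moreover have "\<bar>\<xi> - f x\<bar> < d0"
        using \<xi>(1) near[of u] near[of v] uv by (auto simp: closed_segment_eq_real_ivl split: if_splits)
      ultimately have N\<xi>: "\<bar>N' \<xi> - N' (f x)\<bar> < e / 2" using d0(2)[of \<xi>] by (simp add: dist_real_def)
      have Nt: "\<bar>N' \<xi> - N' (f t)\<bar> \<le> e" if "t \<in> {u..v}" for t
      proof -
        have "\<bar>N' (f t) - N' (f x)\<bar> < e / 2"
          using d0(2)[of "f t"] near[OF that] I(1)[of t] that uv by (simp add: dist_real_def)
        with N\<xi> show ?thesis by linarith
      qed
      have fI: "(f' has_integral f v - f u) {u..v}"
        using AC_integral[OF f, of u v] AC_integrable_on[OF f, of u v] uv by (simp add: has_integral_integral)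
      have 1: "((\<lambda>t. N' \<xi> * f' t) has_integral N (f v) - N (f u)) {u..v}"
        using has_integral_mult_right[OF fI, of "N' \<xi>"] \<xi>(2) by simp
      have "norm (N' \<xi> * f' t - P t) \<le> e * m t" if t: "t \<in> {u..v}" for t
      proof -
        have "norm (N' \<xi> * f' t - P t) = \<bar>N' \<xi> - N' (f t)\<bar> * m t"
          by (simp add: P_def m_def left_diff_distrib[symmetric] abs_mult)
        also have "\<dots> \<le> e * m t" using Nt[OF t] by (intro mult_right_mono) (auto simp: m_def)
        finally show "norm (N' \<xi> * f' t - P t) \<le> e * m t" .
      qed
      with 1 show "\<exists>q. (q has_integral N (f v) - N (f u)) {u..v} \<and> (\<forall>t\<in>{u..v}. norm (q t - P t) \<le> e * m t)"
        by blast
    qed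
  qed
  have "AC a b (\<lambda>x. N (f x)) P"
    by (rule AC_if_locally_close[OF Pi mi loc])
  then show ?thesis by (simp add: P_def[abs_def])
qed

section \<open>Test functions and the fundamental lemma\<close>

text \<open>The smoothness clause of \<open>test_function\<close> without the support condition, so
  that it can be treated by closure properties.\<close>

definition smooth :: "(real \<Rightarrow> real) \<Rightarrow> bool" where
  "smooth f \<longleftrightarrow> (\<forall>j x. (deriv ^^ j) f differentiable (at x))"

lemma smooth_iff: "smooth f \<longleftrightarrow> (\<forall>x. f differentiable (at x)) \<and> smooth (deriv f)"
proof -
  have "(deriv ^^ j) (deriv f) = (deriv ^^ Suc j) f" for j
    by (simp only: funpow_swap1 funpow.simps o_apply)
  then have 1: "smooth (deriv f) \<longleftrightarrow> (\<forall>j x. (deriv ^^ Suc j) f differentiable (at x))"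
    by (simp only: smooth_def)
  have 2: "smooth f \<longleftrightarrow> (\<forall>x. (deriv ^^ 0) f differentiable (at x)) \<and> (\<forall>j x. (deriv ^^ Suc j) f differentiable (at x))"
    unfolding smooth_def by (metis not0_implies_Suc)
  show ?thesis unfolding 1 2 by simp
qed

lemma smooth_has_derivative: "smooth f \<Longrightarrow> (f has_real_derivative deriv f x) (at x)"
  using smooth_iff[of f] by (simp add: DERIV_deriv_iff_real_differentiable)

lemma smooth_deriv: "smooth f \<Longrightarrow> smooth (deriv f)"
  using smooth_iff by blast

lemma smooth_continuous: "smooth f \<Longrightarrow> continuous_on S f"
  by (intro continuous_at_imp_continuous_on ballI DERIV_isCont[OF smooth_has_derivative])

text \<open>A coinduction principle: any family of functions closed under differentiation consists
  of smooth functions. It avoids formulas for higher derivatives.\<close>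

lemma smoothI:
  assumes F: "\<And>f. f \<in> F \<Longrightarrow> \<exists>g\<in>F. \<forall>x. (f has_real_derivative g x) (at x)" and f: "f \<in> F"
  shows "smooth f"
proof -
  have *: "deriv f \<in> F \<and> (\<forall>x. f differentiable (at x))" if f: "f \<in> F" for f
  proof -
    obtain g where g: "g \<in> F" "\<And>x. (f has_real_derivative g x) (at x)" using F[OF f] by blast
    then have "deriv f = g" by (intro ext DERIV_imp_deriv)
    then show ?thesis using g by (auto simp: real_differentiable_def)
  qed
  have "(deriv ^^ j) f \<in> F" for j
    by (induction j) (use f * in auto)
  then show ?thesis unfolding smooth_def using * by blast
qed

text \<open>The smallest convenient family that contains a product of smooth functions and is closed
  under differentiation: the Leibniz rule turns a product into a sum of products.\<close>

inductive_set product_sums :: "(real \<Rightarrow> real) set" where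
  prod: "smooth f \<Longrightarrow> smooth g \<Longrightarrow> (\<lambda>x. f x * g x) \<in> product_sums"
| sum: "f \<in> product_sums \<Longrightarrow> g \<in> product_sums \<Longrightarrow> (\<lambda>x. f x + g x) \<in> product_sums"

lemma smooth_product_sums: "f \<in> product_sums \<Longrightarrow> smooth f"
proof (rule smoothI)
  fix f assume "f \<in> product_sums"
  then show "\<exists>g\<in>product_sums. \<forall>x. (f has_real_derivative g x) (at x)"
  proof induction
    case (prod f g)
    have "(\<lambda>x. deriv f x * g x + deriv g x * f x) \<in> product_sums"
      using prod by (intro product_sums.intros smooth_deriv)
    moreover have "\<forall>x. ((\<lambda>x. f x * g x) has_real_derivative deriv f x * g x + deriv g x * f x) (at x)"
      using prod by (intro allI DERIV_mult smooth_has_derivative)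
    ultimately show ?case by (intro bexI[where x = "\<lambda>x. deriv f x * g x + deriv g x * f x"])
  next
    case (sum f g)
    then obtain f' g' where "f' \<in> product_sums" "\<And>x. (f has_real_derivative f' x) (at x)"
      "g' \<in> product_sums" "\<And>x. (g has_real_derivative g' x) (at x)" by blast
    then show ?case
      by (intro bexI[where x = "\<lambda>x. f' x + g' x"] product_sums.intros allI DERIV_add)
  qed
qed

lemma smooth_mult: "smooth f \<Longrightarrow> smooth g \<Longrightarrow> smooth (\<lambda>x. f x * g x)"
  by (rule smooth_product_sums[OF product_sums.prod])

lemma smooth_const: "smooth (\<lambda>x. c)"
  by (rule smoothI[of "range (\<lambda>c x. c)"]) (auto intro!: exI[of _ 0])

lemma smooth_add: assumes "smooth f" "smooth g" shows "smooth (\<lambda>x. f x + g x)"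
proof -
  have "(\<lambda>x. f x * 1 + g x * 1) \<in> product_sums"
    using assms by (intro product_sums.intros smooth_const)
  then show ?thesis using smooth_product_sums by force
qed

lemma smooth_affine:
  assumes "smooth f"
  shows "smooth (\<lambda>x. f (k * x + d))"
proof (rule smoothI[of "{\<lambda>x. c * f (k * x + d) |c f. smooth f}"])
  show "(\<lambda>x. f (k * x + d)) \<in> {\<lambda>x. c * f (k * x + d) |c f. smooth f}"
    by (rule CollectI, rule exI[of _ 1], rule exI[of _ f]) (use assms in simp)
  fix g assume "g \<in> {\<lambda>x. c * f (k * x + d) |c f. smooth f}"
  then obtain c h where g: "g = (\<lambda>x. c * h (k * x + d))" "smooth h" by blast
  have "(g has_real_derivative (c * k) * deriv h (k * x + d)) (at x)" for x
  proof -
    have "((\<lambda>x. h (k * x + d)) has_real_derivative deriv h (k * x + d) * k) (at x)"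
      by (rule DERIV_chain2[OF smooth_has_derivative[OF g(2)]]) (auto intro!: derivative_eq_intros)
    then show ?thesis unfolding g(1) by (auto intro!: derivative_eq_intros)
  qed
  then show "\<exists>g'\<in>{\<lambda>x. c * f (k * x + d) |c f. smooth f}. \<forall>x. (g has_real_derivative g' x) (at x)"
    using smooth_deriv[OF g(2)] by (intro bexI[of _ "\<lambda>x. (c * k) * deriv h (k * x + d)"]) blast+
qed

text \<open>The standard flat function exp(-1/x) for x > 0, multiplied by a polynomial in 1/x. All
  derivatives of \<open>theta 1\<close> lie in this family, the derivative acting on polynomials by
  p to X^2 (p - p').\<close>

definition theta :: "real poly \<Rightarrow> real \<Rightarrow> real" where
  "theta p x = (if x > 0 then poly p (1 / x) * exp (- (1 / x)) else 0)"

lemma tendsto_poly_exp: "((\<lambda>y. poly p y * exp (- y)) \<longlongrightarrow> 0) at_top" for p :: "real poly"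
proof -
  have "((\<lambda>y. \<Sum>i\<le>degree p. coeff p i * (y ^ i / exp y)) \<longlongrightarrow> (\<Sum>i\<le>degree p. coeff p i * 0)) at_top"
    by (intro tendsto_sum tendsto_mult tendsto_const tendsto_power_div_exp_0)
  moreover have "(\<Sum>i\<le>degree p. coeff p i * (y ^ i / exp y)) = poly p y * exp (- y)" for y
    by (simp add: poly_altdef sum_distrib_right exp_minus divide_inverse mult.assoc)
  ultimately show ?thesis by simp
qed

lemma theta_has_derivative:
  "(theta p has_real_derivative theta ([:0, 0, 1:] * (p - pderiv p)) x) (at x)"
proof -
  consider "x > 0" | "x < 0" | "x = 0" by linarith
  then show ?thesis
  proof cases
    case 1
    have "((\<lambda>x. poly p (1 / x) * exp (- (1 / x))) has_real_derivative
        theta ([:0, 0, 1:] * (p - pderiv p)) x) (at x)"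
      by (rule DERIV_cong, (rule derivative_intros poly_DERIV DERIV_chain2[OF poly_DERIV] | use 1 in simp; fail)+)
         (use 1 in \<open>simp add: theta_def field_simps power2_eq_square\<close>)
    then show ?thesis
      by (rule has_field_derivative_transform_within_open[where S = "{0<..}"]) (use 1 in \<open>auto simp: theta_def\<close>)
  next
    case 2
    have "((\<lambda>x. 0) has_real_derivative theta ([:0, 0, 1:] * (p - pderiv p)) x) (at x)"
      using 2 by (simp add: theta_def)
    then show ?thesis
      by (rule has_field_derivative_transform_within_open[where S = "{..<0}"]) (use 2 in \<open>auto simp: theta_def\<close>)
  next
    case 3
    have "((\<lambda>h. theta p h / h) \<longlongrightarrow> 0) (at 0)"
    proof (rule filterlim_split_at)
      show "((\<lambda>h. theta p h / h) \<longlongrightarrow> 0) (at_left 0)"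
        by (rule tendsto_eventually) (auto simp: theta_def eventually_at_filter)
      have "((\<lambda>y. theta p (inverse y) / inverse y) \<longlongrightarrow> 0) at_top"
      \<comment> \<open>Substituting h = 1/y turns the difference quotient into y p(y) exp(-y); the
        extra factor y from dividing by h is absorbed in \<open>pCons 0 p\<close>.\<close>
      proof (rule Lim_transform_eventually[OF tendsto_poly_exp[of "pCons 0 p"]])
        show "\<forall>\<^sub>F y in at_top. poly (pCons 0 p) y * exp (- y) = theta p (inverse y) / inverse y"
          using eventually_gt_at_top[of "0::real"]
          by eventually_elim (simp add: theta_def field_simps)
      qed
      then show "((\<lambda>h. theta p h / h) \<longlongrightarrow> 0) (at_right 0)"
        by (simp add: filterlim_at_right_to_top)
    qed
    then show ?thesis using 3 by (simp add: DERIV_def theta_def)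
  qed
qed

lemma smooth_theta: "smooth (theta p)"
  by (rule smoothI[of "range theta"]) (use theta_has_derivative in auto)

text \<open>A product of two flat functions supported on the interval from \<open>c\<close> to
  \<open>d\<close>, whose slopes steepen with \<open>n\<close>; it stays below 1 and converges to
  the indicator of the open interval. The arguments are written in the affine shape that
  \<open>smooth_affine\<close> expects.\<close>

definition bump :: "real \<Rightarrow> real \<Rightarrow> nat \<Rightarrow> real \<Rightarrow> real" where
  "bump c d n x = theta 1 (real n * x + - (real n * c)) * theta 1 ((- real n) * x + real n * d)"

lemma smooth_bump: "smooth (bump c d n)"
  unfolding bump_def[abs_def] by (intro smooth_mult smooth_affine smooth_theta)

lemma bump_bounds: "0 \<le> bump c d n x" "bump c d n x \<le> 1"
proof -
  have "0 \<le> theta 1 y \<and> theta 1 y \<le> 1" for y by (simp add: theta_def)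
  then show "0 \<le> bump c d n x" "bump c d n x \<le> 1"
    unfolding bump_def by (auto intro!: mult_nonneg_nonneg mult_le_one)
qed

lemma bump_eq_0: "x \<notin> {c<..<d} \<Longrightarrow> bump c d n x = 0"
proof -
  assume "x \<notin> {c<..<d}"
  then have "real n * x \<le> real n * c \<or> real n * d \<le> real n * x"
    by (auto simp: not_less intro: mult_left_mono)
  then show ?thesis by (auto simp: bump_def theta_def)
qed

lemma bump_pos: "x \<in> {c<..<d} \<Longrightarrow> n > 0 \<Longrightarrow> bump c d n x > 0"
  by (auto simp: bump_def theta_def)

lemma bump_tendsto: "x \<in> {c<..<d} \<Longrightarrow> (\<lambda>n. bump c d n x) \<longlonglongrightarrow> 1"
proof -
  assume x: "x \<in> {c<..<d}"
  have *: "(\<lambda>n. theta 1 (real n * y)) \<longlonglongrightarrow> 1" if y: "y > 0" for y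
  proof (rule Lim_transform_eventually)
    have "(\<lambda>n. exp (- (1 / y * inverse (real n)))) \<longlonglongrightarrow> exp (- (1 / y * 0))"
      by (intro tendsto_intros lim_inverse_n)
    then show "(\<lambda>n. exp (- (1 / y * inverse (real n)))) \<longlonglongrightarrow> 1" by simp
    show "\<forall>\<^sub>F n in sequentially. exp (- (1 / y * inverse (real n))) = theta 1 (real n * y)"
      using eventually_gt_at_top[of "0::nat"]
      by eventually_elim (use y in \<open>simp add: theta_def field_simps\<close>)
  qed
  have "(\<lambda>n. theta 1 (real n * (x - c)) * theta 1 (real n * (d - x))) \<longlonglongrightarrow> 1 * 1"
    using x by (intro tendsto_mult *) auto
  then show ?thesis by (simp add: bump_def algebra_simps)
qed

lemma test_function_bump: "a < c \<Longrightarrow> d < b \<Longrightarrow> test_function a b (bump c d n)"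
  unfolding test_function_def using smooth_bump[of c d n, unfolded smooth_def] bump_eq_0[of _ c d n]
  by (intro conjI exI[of _ c] exI[of _ d]) auto

lemma test_function_smooth: "test_function a b \<phi> \<Longrightarrow> smooth \<phi>"
  by (simp add: test_function_def smooth_def)

lemma test_function_deriv:
  assumes "test_function a b \<phi>"
  shows "test_function a b (deriv \<phi>)"
proof -
  obtain c d where cd: "a < c" "d < b" "\<And>x. x \<notin> {c..d} \<Longrightarrow> \<phi> x = 0"
    using assms by (auto simp: test_function_def)
  have "deriv \<phi> x = 0" if "x \<notin> {c..d}" for x
  proof -
    have "((\<lambda>x. 0) has_real_derivative 0) (at x)" by simp
    then have "(\<phi> has_real_derivative 0) (at x)"
      by (rule has_field_derivative_transform_within_open[where S = "- {c..d}"])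
         (use that cd in \<open>auto intro: open_Compl\<close>)
    then show ?thesis by (rule DERIV_imp_deriv)
  qed
  moreover have "smooth (deriv \<phi>)" using assms by (intro smooth_deriv test_function_smooth)
  ultimately show ?thesis using cd unfolding test_function_def smooth_def by blast
qed

section \<open>Pairing with test functions: uniqueness of weak derivatives and the du Bois-Reymond
  lemma\<close>

lemma test_function_integrable:
  fixes f :: "real \<Rightarrow> 'a::euclidean_space"
  assumes \<phi>: "test_function a b \<phi>" and f: "locally_L1 a b f"
  shows "set_integrable lebesgue {a<..<b} (\<lambda>x. \<phi> x *\<^sub>R f x)"
proof -
  obtain c d where cd: "a < c" "d < b" "\<And>x. x \<notin> {c..d} \<Longrightarrow> \<phi> x = 0"
    using \<phi> by (auto simp: test_function_def)
  have "(\<lambda>x. \<phi> x *\<^sub>R f x) absolutely_integrable_on {c..d}"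
    by (rule absolutely_integrable_bilinear_continuous[OF bounded_bilinear_scaleR])
       (use cd f \<phi> in \<open>auto simp: locally_L1_def intro: smooth_continuous test_function_smooth\<close>)
  moreover have "(\<lambda>x. indicat_real {c..d} x *\<^sub>R \<phi> x *\<^sub>R f x) = (\<lambda>x. indicat_real {a<..<b} x *\<^sub>R \<phi> x *\<^sub>R f x)"
  proof
    fix x show "indicat_real {c..d} x *\<^sub>R \<phi> x *\<^sub>R f x = indicat_real {a<..<b} x *\<^sub>R \<phi> x *\<^sub>R f x"
      using cd by (cases "x \<in> {c..d}") auto
  qed
  ultimately show ?thesis unfolding set_integrable_def by simp
qed

text \<open>The functions \<open>bump c d n\<close> converge boundedly to the indicator of the
  interval from \<open>c\<close> to \<open>d\<close>, so dominated convergence gives zero integral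
  over every compact subinterval, and interval integrals determine the function almost
  everywhere.\<close>

lemma fundamental_lemma:
  fixes f :: "real \<Rightarrow> 'a::euclidean_space"
  assumes f: "locally_L1 a b f"
    and zero: "\<And>\<phi>. test_function a b \<phi> \<Longrightarrow> (LINT x:{a<..<b}|lebesgue. \<phi> x *\<^sub>R f x) = 0"
  shows "AE x in lebesgue. x \<in> {a<..<b} \<longrightarrow> f x = 0"
proof -
  have int0: "integral {c..d} f = 0" if cd: "a < c" "d < b" for c d
  proof -
    have fi: "f absolutely_integrable_on {c..d}" using f cd by (auto simp: locally_L1_def)
    have 0: "integral {c..d} (\<lambda>x. bump c d n x *\<^sub>R f x) = 0" for n
    proof -
      have "(\<lambda>x. bump c d n x *\<^sub>R f x) absolutely_integrable_on {c..d}"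
        by (rule absolutely_integrable_bilinear_continuous[OF bounded_bilinear_scaleR _ fi])
           (intro smooth_continuous smooth_bump)
      then have "integral {c..d} (\<lambda>x. bump c d n x *\<^sub>R f x) = (LINT x:{c..d}|lebesgue. bump c d n x *\<^sub>R f x)"
        by (rule set_lebesgue_integral_eq_integral(2)[symmetric])
      also have "\<dots> = (LINT x:{a<..<b}|lebesgue. bump c d n x *\<^sub>R f x)"
        unfolding set_lebesgue_integral_def
      proof (rule Bochner_Integration.integral_cong[OF refl])
        fix x
        show "indicat_real {c..d} x *\<^sub>R bump c d n x *\<^sub>R f x = indicat_real {a<..<b} x *\<^sub>R bump c d n x *\<^sub>R f x"
          using cd bump_eq_0[of x c d n] by (cases "x \<in> {c<..<d}") auto
      qed
      also have "\<dots> = 0" using cd by (intro zero test_function_bump)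
      finally show ?thesis .
    qed
    have "(\<lambda>n. integral {c..d} (\<lambda>x. bump c d n x *\<^sub>R f x)) \<longlonglongrightarrow> integral {c..d} (\<lambda>x. indicat_real {c<..<d} x *\<^sub>R f x)"
    proof (rule dominated_convergence(2)[where h = "\<lambda>x. norm (f x)"])
      show "(\<lambda>x. bump c d n x *\<^sub>R f x) integrable_on {c..d}" for n
        by (rule set_lebesgue_integral_eq_integral(1),
            rule absolutely_integrable_bilinear_continuous[OF bounded_bilinear_scaleR _ fi])
           (intro smooth_continuous smooth_bump)
      show "(\<lambda>x. norm (f x)) integrable_on {c..d}"
        using fi by (simp add: absolutely_integrable_on_def)
      show "norm (bump c d n x *\<^sub>R f x) \<le> norm (f x)" for n x
        using bump_bounds[of c d n x] by (simp add: mult_left_le_one_le)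
      show "(\<lambda>n. bump c d n x *\<^sub>R f x) \<longlonglongrightarrow> indicat_real {c<..<d} x *\<^sub>R f x" for x
        by (cases "x \<in> {c<..<d}") (auto intro!: tendsto_eq_intros bump_tendsto simp: bump_eq_0)
    qed
    then have "integral {c..d} (\<lambda>x. indicat_real {c<..<d} x *\<^sub>R f x) = 0"
      unfolding 0 by (simp add: LIMSEQ_const_iff)
    moreover have "integral {c..d} (\<lambda>x. indicat_real {c<..<d} x *\<^sub>R f x) = integral {c..d} f"
      by (rule integral_spike[of "{c, d}"]) (auto simp: indicator_def)
    ultimately show ?thesis by simp
  qed
  \<comment> \<open>Local integrability says nothing up to the end points, so the open interval is
    exhausted by countably many compact ones.\<close>
  have "AE x in lebesgue. x \<in> {a + inverse (real (Suc n))..b - inverse (real (Suc n))} \<longrightarrow> f x = 0" for n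
  proof (rule AE_zero_if_interval_integrals_zero)
    have "inverse (real (Suc n)) > 0" by simp
    then show "f absolutely_integrable_on {a + inverse (real (Suc n))..b - inverse (real (Suc n))}"
      using f by (auto simp: locally_L1_def)
    fix u v assume "a + inverse (real (Suc n)) \<le> u" "v \<le> b - inverse (real (Suc n))"
    then show "integral {u..v} f = 0"
      using \<open>inverse (real (Suc n)) > 0\<close> by (intro int0) linarith+
  qed
  then have "AE x in lebesgue. \<forall>n. x \<in> {a + inverse (real (Suc n))..b - inverse (real (Suc n))} \<longrightarrow> f x = 0"
    by (simp only: AE_all_countable) blast
  then show ?thesis
  proof eventually_elim
    case (elim x)
    show ?case
    proof
      assume "x \<in> {a<..<b}"
      then have "0 < min (x - a) (b - x)" by simp
      then obtain n where "inverse (real (Suc n)) < min (x - a) (b - x)"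
        using reals_Archimedean by blast
      then have "x \<in> {a + inverse (real (Suc n))..b - inverse (real (Suc n))}" by auto
      then show "f x = 0" using elim by blast
    qed
  qed
qed

lemma locally_L1_diff: "locally_L1 a b f \<Longrightarrow> locally_L1 a b g \<Longrightarrow> locally_L1 a b (\<lambda>x. f x - g x)"
  unfolding locally_L1_def by (blast intro: set_integral_diff(1))

lemma locally_L1_absolutely_integrable: "g absolutely_integrable_on {a..b} \<Longrightarrow> locally_L1 a b g"
  unfolding locally_L1_def by (meson absolutely_integrable_subinterval less_imp_le)

lemma locally_L1_const: "locally_L1 a b (\<lambda>x. c)"
  unfolding locally_L1_def
  by (intro allI impI absolutely_integrable_continuous_real continuous_on_const)

lemma has_weak_deriv_unique:
  assumes "has_weak_deriv a b f g" "has_weak_deriv a b f h"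
  shows "AE x in lebesgue. x \<in> {a<..<b} \<longrightarrow> g x = h x"
proof -
  have L: "locally_L1 a b g" "locally_L1 a b h" using assms by (auto simp: has_weak_deriv_def)
  have "AE x in lebesgue. x \<in> {a<..<b} \<longrightarrow> g x - h x = 0"
  proof (rule fundamental_lemma[OF locally_L1_diff[OF L]])
    fix \<phi> assume \<phi>: "test_function a b \<phi>"
    have "(LINT x:{a<..<b}|lebesgue. \<phi> x *\<^sub>R g x - \<phi> x *\<^sub>R h x) = 0"
      using assms \<phi>
      by (subst set_integral_diff(2)[OF test_function_integrable[OF \<phi> L(1)] test_function_integrable[OF \<phi> L(2)]])
         (simp add: has_weak_deriv_def)
    then show "(LINT x:{a<..<b}|lebesgue. \<phi> x *\<^sub>R (g x - h x)) = 0"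
      by (simp add: scaleR_diff_right)
  qed
  then show ?thesis by simp
qed

text \<open>The two intervals differ by a null set, and completeness of the measure transfers
  measurability as well. This passes between the open intervals of weak derivatives and the closed
  ones of \<open>AC\<close>.\<close>

lemma set_lebesgue_integral_open_interval:
  fixes f :: "real \<Rightarrow> 'a::euclidean_space"
  shows "(LINT x:{a<..<b}|lebesgue. f x) = (LINT x:{a..b}|lebesgue. f x)"
    and "set_integrable lebesgue {a<..<b} f \<longleftrightarrow> f absolutely_integrable_on {a..b}"
proof -
  have "AE x in lebesgue. x \<notin> {a, b}"
    by (rule AE_not_in) (auto simp: negligible_iff_null_sets[symmetric])
  then have ae: "AE x in lebesgue. indicat_real {a<..<b} x *\<^sub>R f x = indicat_real {a..b} x *\<^sub>R f x"
    by eventually_elim (auto simp: indicator_def)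
  then have ae': "AE x in lebesgue. indicat_real {a..b} x *\<^sub>R f x = indicat_real {a<..<b} x *\<^sub>R f x"
    by eventually_elim (rule sym)
  have m: "(\<lambda>x. indicat_real {a<..<b} x *\<^sub>R f x) \<in> borel_measurable lebesgue \<longleftrightarrow>
     (\<lambda>x. indicat_real {a..b} x *\<^sub>R f x) \<in> borel_measurable lebesgue"
    using borel_measurable_AE[OF _ ae] borel_measurable_AE[OF _ ae'] by blast
  show "set_integrable lebesgue {a<..<b} f \<longleftrightarrow> f absolutely_integrable_on {a..b}"
    unfolding set_integrable_def
    using integrable_cong_AE_imp[OF _ _ ae] integrable_cong_AE_imp[OF _ _ ae'] m
    by (metis borel_measurable_integrable)
  show "(LINT x:{a<..<b}|lebesgue. f x) = (LINT x:{a..b}|lebesgue. f x)"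
    unfolding set_lebesgue_integral_def
    using integral_cong_AE[OF _ _ ae] m by (metis borel_measurable_integrable not_integrable_integral_eq)
qed

text \<open>Integration by parts: the density of the product of \<open>\<phi>\<close> and
  \<open>f\<close> integrates to zero because \<open>\<phi>\<close> vanishes at both ends.\<close>

lemma AC_has_weak_deriv:
  assumes f: "AC a b f g"
  shows "has_weak_deriv a b f g"
  unfolding has_weak_deriv_def
proof (intro conjI allI impI)
  show lf: "locally_L1 a b f"
    using AC_continuous[OF f] by (intro locally_L1_absolutely_integrable absolutely_integrable_continuous_real)
  show lg: "locally_L1 a b g"
    using AC_integrable[OF f] by (rule locally_L1_absolutely_integrable)
  fix \<phi> assume \<phi>: "test_function a b \<phi>"
  note s = test_function_smooth[OF \<phi>]
  show "(LINT x:{a<..<b}|lebesgue. deriv \<phi> x *\<^sub>R f x) = - (LINT x:{a<..<b}|lebesgue. \<phi> x *\<^sub>R g x)"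
  proof (cases "a < b")
    case False
    then have "{a<..<b} = {}" by simp
    then show ?thesis by (simp add: set_lebesgue_integral_def)
  next
    case ab: True
    have "AC a b \<phi> (deriv \<phi>)"
      by (rule AC_of_deriv)
         (auto intro: smooth_continuous smooth_deriv s has_field_derivative_at_within smooth_has_derivative
           simp: has_real_derivative_iff_has_vector_derivative[symmetric])
    from AC_bilinear[OF bounded_bilinear_scaleR this f]
    have A: "AC a b (\<lambda>x. \<phi> x *\<^sub>R f x) (\<lambda>x. \<phi> x *\<^sub>R g x + deriv \<phi> x *\<^sub>R f x)" .
    have I1: "set_integrable lebesgue {a<..<b} (\<lambda>x. \<phi> x *\<^sub>R g x)"
      by (rule test_function_integrable[OF \<phi> lg])
    have I2: "set_integrable lebesgue {a<..<b} (\<lambda>x. deriv \<phi> x *\<^sub>R f x)"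
      by (rule test_function_integrable[OF test_function_deriv[OF \<phi>] lf])
    have "\<phi> a = 0" "\<phi> b = 0" using \<phi> by (auto simp: test_function_def)
    then have "0 = integral {a..b} (\<lambda>x. \<phi> x *\<^sub>R g x + deriv \<phi> x *\<^sub>R f x)"
      using AC_integral[OF A, of a b] ab by simp
    also have "\<dots> = (LINT x:{a<..<b}|lebesgue. \<phi> x *\<^sub>R g x + deriv \<phi> x *\<^sub>R f x)"
      unfolding set_lebesgue_integral_open_interval
      by (rule set_lebesgue_integral_eq_integral(2)[OF AC_integrable[OF A], symmetric])
    also have "\<dots> = (LINT x:{a<..<b}|lebesgue. \<phi> x *\<^sub>R g x) + (LINT x:{a<..<b}|lebesgue. deriv \<phi> x *\<^sub>R f x)"
      by (rule set_integral_add(2)[OF I1 I2])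
    finally show ?thesis by (simp add: eq_neg_iff_add_eq_0 add.commute)
  qed
qed

text \<open>The indefinite integral vanishes to the left of the support, and to the right of it
  equals the total integral, which is zero; hence it is again compactly supported.\<close>

lemma test_function_antiderivative:
  assumes \<eta>: "test_function a b \<eta>" and ab: "a < b" and 0: "integral {a..b} \<eta> = 0"
  obtains \<Phi> where "test_function a b \<Phi>" "deriv \<Phi> = \<eta>"
proof -
  obtain c d where cd: "a < c" "d < b" "\<And>x. x \<notin> {c..d} \<Longrightarrow> \<eta> x = 0"
    using \<eta> by (auto simp: test_function_def)
  define \<Phi> where "\<Phi> x = integral {a..x} \<eta>" for x
  have zero: "integral {u..v} \<eta> = 0" if "\<And>x. x \<in> {u..v} \<Longrightarrow> \<eta> x = 0" for u v
    using integral_cong[of "{u..v}" \<eta> "\<lambda>_. 0"] that by simp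
  have left: "\<Phi> x = 0" if "x < c" for x
    unfolding \<Phi>_def by (rule zero) (use that cd in auto)
  have int: "\<eta> integrable_on {u..v}" for u v
    using \<eta> by (intro integrable_continuous_real smooth_continuous test_function_smooth)
  have right: "\<Phi> x = 0" if "x > d" for x
  proof (cases "x < a")
    case True then show ?thesis by (simp add: \<Phi>_def)
  next
    case False
    \<comment> \<open>The point \<open>x\<close> may lie beyond \<open>b\<close>, so the splitting
      point is cut off at \<open>b\<close>; \<open>\<eta>\<close> vanishes from there on in either
      case.\<close>
    have "integral {a..min x b} \<eta> + integral {min x b..x} \<eta> = \<Phi> x"
      unfolding \<Phi>_def using False ab by (intro Henstock_Kurzweil_Integration.integral_combine int) auto
    moreover have "integral {a..min x b} \<eta> + integral {min x b..b} \<eta> = integral {a..b} \<eta>"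
      using False ab by (intro Henstock_Kurzweil_Integration.integral_combine int) auto
    moreover have "\<eta> y = 0" if "y \<ge> min x b" for y
      using that cd(3)[of y] cd(2) \<open>x > d\<close> by (cases "y \<le> d") auto
    then have "integral {min x b..x} \<eta> = 0" "integral {min x b..b} \<eta> = 0"
      by (intro zero; simp)+
    ultimately show ?thesis using 0 by simp
  qed
  have der: "(\<Phi> has_real_derivative \<eta> x) (at x)" for x
  proof (cases "x > a")
    case True
    have "(\<Phi> has_real_derivative \<eta> x) (at x within {a..x + 1})"
      unfolding \<Phi>_def[abs_def]
      by (rule integral_has_real_derivative) (use True \<eta> in \<open>auto intro: smooth_continuous test_function_smooth\<close>)
    then show ?thesis
      using True by (subst (asm) at_within_interior) auto
  next
    case False
    have "((\<lambda>x. 0) has_real_derivative \<eta> x) (at x)" using False cd by simp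
    then show ?thesis
      by (rule has_field_derivative_transform_within_open[where S = "{..<c}"])
         (use False cd left in auto)
  qed
  have d: "deriv \<Phi> = \<eta>" by (intro ext DERIV_imp_deriv der)
  have "smooth \<Phi>"
    unfolding smooth_iff[of \<Phi>] d using der \<eta> test_function_smooth real_differentiable_def by blast
  then have "test_function a b \<Phi>"
    unfolding test_function_def smooth_def
    using cd left right by (intro conjI exI[of _ c] exI[of _ d]) (auto simp: not_le)
  with d show thesis using that by blast
qed

lemma integral_eq_LINT_test:
  assumes "test_function a b \<psi>"
  shows "(LINT x:{a<..<b}|lebesgue. \<psi> x *\<^sub>R c) = integral {a..b} \<psi> *\<^sub>R (c::'a::euclidean_space)"
proof -
  have \<psi>: "\<psi> absolutely_integrable_on {a..b}"
    using assms by (intro absolutely_integrable_continuous_real smooth_continuous test_function_smooth)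
  then have \<psi>c: "(\<lambda>x. \<psi> x *\<^sub>R c) absolutely_integrable_on {a..b}"
    using absolutely_integrable_linear[OF \<psi> bounded_linear_scaleR_left[of c]] by (simp add: o_def)
  have "integral {a..b} (\<lambda>x. \<psi> x *\<^sub>R c) = integral {a..b} \<psi> *\<^sub>R c"
    using integral_linear[OF set_lebesgue_integral_eq_integral(1)[OF \<psi>] bounded_linear_scaleR_left[of c]]
    by (simp add: o_def)
  then show ?thesis
    unfolding set_lebesgue_integral_open_interval set_lebesgue_integral_eq_integral(2)[OF \<psi>c] .
qed

lemma test_function_lincomb:
  assumes "test_function a b \<phi>" "test_function a b \<psi>"
  shows "test_function a b (\<lambda>x. \<phi> x + r * \<psi> x)"
proof -
  obtain c d where cd: "a < c" "d < b" "\<And>x. x \<notin> {c..d} \<Longrightarrow> \<phi> x = 0"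
    using assms(1) by (auto simp: test_function_def)
  obtain c' d' where cd': "a < c'" "d' < b" "\<And>x. x \<notin> {c'..d'} \<Longrightarrow> \<psi> x = 0"
    using assms(2) by (auto simp: test_function_def)
  have "smooth (\<lambda>x. \<phi> x + r * \<psi> x)"
    using assms by (intro smooth_add smooth_mult smooth_const test_function_smooth)
  moreover have "\<phi> x + r * \<psi> x = 0" if "x \<notin> {min c c'..max d d'}" for x
  proof -
    have "x \<notin> {c..d}" "x \<notin> {c'..d'}" using that by auto
    then show ?thesis using cd(3) cd'(3) by simp
  qed
  moreover have "a < min c c'" "max d d' < b" using cd cd' by auto
  ultimately show ?thesis
    unfolding test_function_def smooth_def[symmetric] by blast
qed

lemma du_Bois_Reymond:
  fixes f :: "real \<Rightarrow> 'a::euclidean_space"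
  assumes ab: "a < b" and f: "locally_L1 a b f"
    and zero: "\<And>\<phi>. test_function a b \<phi> \<Longrightarrow> (LINT x:{a<..<b}|lebesgue. deriv \<phi> x *\<^sub>R f x) = 0"
  obtains c where "AE x in lebesgue. x \<in> {a<..<b} \<longrightarrow> f x = c"
proof -
  obtain c d where cd: "a < c" "c < d" "d < b" using dense ab by meson
  define B where "B = bump c d 1"
  have B: "test_function a b B" unfolding B_def using cd by (intro test_function_bump)
  have cB: "continuous_on {a..b} B" using B by (intro smooth_continuous test_function_smooth)
  define I where "I = integral {a..b} B"
  have "I \<noteq> 0"
  proof
    assume "I = 0"
    then have "\<forall>x\<in>{a..b}. B x = 0"
      unfolding I_def using integral_eq_0_iff[OF cB ab] bump_bounds by (auto simp: B_def)
    moreover have "B ((c + d) / 2) > 0" unfolding B_def using cd by (intro bump_pos) auto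
    ultimately show False using cd by auto
  qed
  \<comment> \<open>The candidate constant is the mean of \<open>f\<close> weighted by a fixed bump
    \<open>B\<close>. Any test function becomes mean-free, hence a derivative of a test function,
    after subtracting the right multiple of \<open>B\<close>.\<close>
  define C where "C = (1 / I) *\<^sub>R (LINT x:{a<..<b}|lebesgue. B x *\<^sub>R f x)"
  have "AE x in lebesgue. x \<in> {a<..<b} \<longrightarrow> f x - C = 0"
  proof (rule fundamental_lemma[OF locally_L1_diff[OF f locally_L1_const]])
    fix \<psi> assume \<psi>: "test_function a b \<psi>"
    define r where "r = - (integral {a..b} \<psi> / I)"
    define \<eta> where "\<eta> x = \<psi> x + r * B x" for x
    have \<eta>: "test_function a b \<eta>" unfolding \<eta>_def by (rule test_function_lincomb[OF \<psi> B])
    have "continuous_on {a..b} \<psi>" using \<psi> by (intro smooth_continuous test_function_smooth)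
    then have "integral {a..b} \<eta> = integral {a..b} \<psi> + r * I"
      unfolding \<eta>_def I_def
      by (subst integral_add) (auto intro!: integrable_continuous_real continuous_intros cB)
    then have "integral {a..b} \<eta> = 0" using \<open>I \<noteq> 0\<close> by (simp add: r_def)
    then obtain \<Phi> where \<Phi>: "test_function a b \<Phi>" "deriv \<Phi> = \<eta>"
      using test_function_antiderivative[OF \<eta> ab] by blast
    have I1: "set_integrable lebesgue {a<..<b} (\<lambda>x. \<psi> x *\<^sub>R f x)"
      by (rule test_function_integrable[OF \<psi> f])
    have I2: "set_integrable lebesgue {a<..<b} (\<lambda>x. B x *\<^sub>R f x)"
      by (rule test_function_integrable[OF B f])
    have I3: "set_integrable lebesgue {a<..<b} (\<lambda>x. \<psi> x *\<^sub>R C)"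
      by (rule test_function_integrable[OF \<psi> locally_L1_const])
    have "0 = (LINT x:{a<..<b}|lebesgue. \<psi> x *\<^sub>R f x + r *\<^sub>R B x *\<^sub>R f x)"
      using zero[OF \<Phi>(1)] by (simp add: \<Phi>(2) \<eta>_def scaleR_add_left)
    also have "\<dots> = (LINT x:{a<..<b}|lebesgue. \<psi> x *\<^sub>R f x) + r *\<^sub>R (LINT x:{a<..<b}|lebesgue. B x *\<^sub>R f x)"
      by (simp only: set_integral_add(2)[OF I1 set_integrable_scaleR_right[OF I2]] set_integral_scaleR_right)
    also have "r *\<^sub>R (LINT x:{a<..<b}|lebesgue. B x *\<^sub>R f x) = - (integral {a..b} \<psi> *\<^sub>R C)"
      by (simp add: r_def C_def)
    also have "integral {a..b} \<psi> *\<^sub>R C = (LINT x:{a<..<b}|lebesgue. \<psi> x *\<^sub>R C)"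
      by (rule integral_eq_LINT_test[OF \<psi>, symmetric])
    finally show "(LINT x:{a<..<b}|lebesgue. \<psi> x *\<^sub>R (f x - C)) = 0"
      by (simp add: scaleR_diff_right set_integral_diff(2)[OF I1 I3])
  qed
  then show thesis using that[of C] by simp
qed

text \<open>\<open>f\<close> and the indefinite integral of \<open>g\<close> have the same weak
  derivative, so they differ by a constant; this is the one-dimensional Sobolev embedding.\<close>

lemma weak_deriv_AC:
  fixes f :: "real \<Rightarrow> 'a::euclidean_space"
  assumes ab: "a < b" and w: "has_weak_deriv a b f g" and g: "g absolutely_integrable_on {a..b}"
  obtains F where "AC a b F g" "AE x in lebesgue. x \<in> {a<..<b} \<longrightarrow> f x = F x"
proof -
  define G where "G x = integral {a..x} g" for x
  have G: "AC a b G g" unfolding AC_def G_def using g by simp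
  have wG: "has_weak_deriv a b G g" by (rule AC_has_weak_deriv[OF G])
  have L: "locally_L1 a b f" "locally_L1 a b G" using w wG by (auto simp: has_weak_deriv_def)
  obtain c where c: "AE x in lebesgue. x \<in> {a<..<b} \<longrightarrow> f x - G x = c"
  proof (rule du_Bois_Reymond[OF ab locally_L1_diff[OF L]])
    fix \<phi> assume \<phi>: "test_function a b \<phi>"
    note \<phi>' = test_function_deriv[OF \<phi>]
    have "(LINT x:{a<..<b}|lebesgue. deriv \<phi> x *\<^sub>R f x - deriv \<phi> x *\<^sub>R G x) = 0"
      using w wG \<phi>
      by (subst set_integral_diff(2)[OF test_function_integrable[OF \<phi>' L(1)] test_function_integrable[OF \<phi>' L(2)]])
         (simp add: has_weak_deriv_def)
    then show "(LINT x:{a<..<b}|lebesgue. deriv \<phi> x *\<^sub>R (f x - G x)) = 0"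
      by (simp add: scaleR_diff_right)
  qed
  show thesis
  proof (rule that)
    show "AC a b (\<lambda>x. G x + c) g" using AC_add[OF G AC_const[of a b c]] by simp
    show "AE x in lebesgue. x \<in> {a<..<b} \<longrightarrow> f x = G x + c"
      using c by eventually_elim (auto simp: algebra_simps)
  qed
qed

lemma weak_deriv_eq_AE:
  assumes "has_weak_deriv a b f g"
  shows "AE x in lebesgue. x \<in> {a<..<b} \<longrightarrow> weak_deriv a b f x = g x"
  using has_weak_deriv_unique[OF someI[of "has_weak_deriv a b f", OF assms] assms]
  by (simp add: weak_deriv_def)

lemma has_weak_deriv_cong_AE:
  assumes w: "has_weak_deriv a b f g" and ae: "AE x in lebesgue. x \<in> {a<..<b} \<longrightarrow> f x = f' x"
  shows "has_weak_deriv a b f' g"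
proof -
  have L: "locally_L1 a b f'"
    unfolding locally_L1_def
  proof (intro allI impI)
    fix c d assume cd: "a < c \<and> d < b"
    have fi: "f absolutely_integrable_on {c..d}" using w cd by (auto simp: has_weak_deriv_def locally_L1_def)
    show "f' absolutely_integrable_on {c..d}"
    proof (rule absolutely_integrable_spike[OF fi])
      show "negligible {x. \<not> (x \<in> {a<..<b} \<longrightarrow> f x = f' x)}"
        using ae by (simp only: AE_lebesgue_negligible)
    qed (use cd in auto)
  qed
  have Lf: "locally_L1 a b f" using w by (simp add: has_weak_deriv_def)
  have "(LINT x:{a<..<b}|lebesgue. deriv \<phi> x *\<^sub>R f' x) = (LINT x:{a<..<b}|lebesgue. deriv \<phi> x *\<^sub>R f x)"
    if \<phi>: "test_function a b \<phi>" for \<phi>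
    unfolding set_lebesgue_integral_def
  proof (rule integral_cong_AE)
    note i = test_function_integrable[OF test_function_deriv[OF \<phi>]]
    show "(\<lambda>x. indicat_real {a<..<b} x *\<^sub>R deriv \<phi> x *\<^sub>R f' x) \<in> borel_measurable lebesgue"
      "(\<lambda>x. indicat_real {a<..<b} x *\<^sub>R deriv \<phi> x *\<^sub>R f x) \<in> borel_measurable lebesgue"
      using i[OF L] i[OF Lf] by (auto simp: set_integrable_def)
    show "AE x in lebesgue. indicat_real {a<..<b} x *\<^sub>R deriv \<phi> x *\<^sub>R f' x = indicat_real {a<..<b} x *\<^sub>R deriv \<phi> x *\<^sub>R f x"
      using ae by eventually_elim (auto simp: indicator_def)
  qed
  then show ?thesis using w L by (simp add: has_weak_deriv_def)
qed

section \<open>Curves\<close>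

lemma AE_interval_negligible:
  fixes a b :: real
  assumes "AE x in lebesgue. x \<in> {a<..<b} \<longrightarrow> P x"
  obtains N where "negligible N" "\<And>x. x \<in> {a..b} - N \<Longrightarrow> P x"
proof
  show "negligible ({x. \<not> (x \<in> {a<..<b} \<longrightarrow> P x)} \<union> {a, b})"
    using assms by (simp only: AE_lebesgue_negligible negligible_Un_eq) simp
  show "P x" if "x \<in> {a..b} - ({x. \<not> (x \<in> {a<..<b} \<longrightarrow> P x)} \<union> {a, b})" for x
    using that
    by (cases "x \<in> {a<..<b}") auto
qed

lemma LINT_eq_integral_AE:
  fixes g :: "real \<Rightarrow> 'a::euclidean_space"
  assumes g: "g absolutely_integrable_on {a..b}" and ae: "AE x in lebesgue. x \<in> {a<..<b} \<longrightarrow> f x = g x"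
  shows "(LINT x:{a..b}|lebesgue. f x) = integral {a..b} g"
proof -
  obtain N where N: "negligible N" "\<And>x. x \<in> {a..b} - N \<Longrightarrow> f x = g x"
    using AE_interval_negligible[OF ae] by blast
  have "f absolutely_integrable_on {a..b}"
    by (rule absolutely_integrable_spike[OF g N])
  then have "(LINT x:{a..b}|lebesgue. f x) = integral {a..b} f"
    by (rule set_lebesgue_integral_eq_integral(2))
  also have "\<dots> = integral {a..b} g" by (rule integral_spike[OF N(1)]) (use N(2) in simp)
  finally show ?thesis .
qed

lemma L2_absolutely_integrable:
  assumes "L2 a b f"
  shows "f absolutely_integrable_on {a..b}" "(\<lambda>x. (norm (f x))\<^sup>2) absolutely_integrable_on {a..b}"
proof -
  show sq: "(\<lambda>x. (norm (f x))\<^sup>2) absolutely_integrable_on {a..b}"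
    using assms set_lebesgue_integral_open_interval(2)[of a b "\<lambda>x. (norm (f x))\<^sup>2"] by (simp add: L2_def)
  have "f absolutely_integrable_on {a<..<b}"
  proof (rule measurable_bounded_by_integrable_imp_absolutely_integrable)
    show "f \<in> borel_measurable (lebesgue_on {a<..<b})"
      using assms by (subst borel_measurable_restrict_space_iff) (simp_all add: L2_def set_borel_measurable_def)
    have "(\<lambda>x. 1 + (norm (f x))\<^sup>2) integrable_on {a..b}"
      by (intro integrable_add set_lebesgue_integral_eq_integral(1)[OF sq] integrable_const_ivl)
    then show "(\<lambda>x. 1 + (norm (f x))\<^sup>2) integrable_on {a<..<b}"
      by (simp add: integrable_on_Icc_iff_Ioo)
    show "norm (f x) \<le> 1 + (norm (f x))\<^sup>2" for x
      using zero_le_power2[of "norm (f x) - 1"] norm_ge_zero[of "f x"]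
      unfolding power2_diff power_one mult_1_right by linarith
  qed auto
  then show "f absolutely_integrable_on {a..b}"
    by (simp add: set_lebesgue_integral_open_interval(2))
qed

text \<open>The difference is continuous and zero almost everywhere, hence a density of the constant
  0; a continuous density is a derivative, so it vanishes everywhere, end points included.\<close>

lemma continuous_AE_eq:
  fixes f g :: "real \<Rightarrow> 'a::euclidean_space"
  assumes "a < b" "continuous_on {a..b} f" "continuous_on {a..b} g"
    and ae: "AE x in lebesgue. x \<in> {a<..<b} \<longrightarrow> f x = g x" and x: "x \<in> {a..b}"
  shows "f x = g x"
proof -
  have c: "continuous_on {a..b} (\<lambda>x. f x - g x)" using assms by (intro continuous_intros)
  obtain N where N: "negligible N" "\<And>x. x \<in> {a..b} - N \<Longrightarrow> f x = g x"
    using AE_interval_negligible[OF ae] by blast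
  have "AC a b (\<lambda>x. 0) (\<lambda>x. f x - g x)"
    by (rule AC_cong[OF AC_const[of a b 0] _ N(1)]) (use N(2) in auto)
  from AC_has_vector_derivative[OF this c x]
  have "((\<lambda>x. 0) has_vector_derivative f x - g x) (at x within {a..b})" .
  moreover have "((\<lambda>x. 0) has_vector_derivative 0) (at x within {a..b})" by simp
  ultimately have "f x - g x = 0"
    using vector_derivative_unique_within_closed_interval[OF \<open>a < b\<close>, of x] x by (metis box_real(2))
  then show ?thesis by simp
qed

lemma AC_L2:
  assumes "AC a b f g"
  shows "L2 a b f"
proof -
  have c: "continuous_on {a..b} f" by (rule AC_continuous[OF assms])
  have "f absolutely_integrable_on {a<..<b}"
    unfolding set_lebesgue_integral_open_interval by (rule absolutely_integrable_continuous_real[OF c])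
  moreover have "(\<lambda>x. (norm (f x))\<^sup>2) absolutely_integrable_on {a<..<b}"
    unfolding set_lebesgue_integral_open_interval
    by (intro absolutely_integrable_continuous_real continuous_intros c)
  ultimately show ?thesis
    by (auto simp: L2_def set_borel_measurable_def set_integrable_def)
qed

text \<open>From here on Sobolev curves are handled only in this form: two successive indefinite
  integrals with a square-integrable last density. Continuity of \<open>\<gamma>\<close> forces it
  to equal the continuous representative everywhere and not just almost everywhere.\<close>

lemma H2_curve_iff:
  fixes \<gamma> :: "real \<Rightarrow> 'a::euclidean_space"
  shows "H2_curve a b \<gamma> \<longleftrightarrow> a < b \<and> (\<exists>v h. AC a b \<gamma> v \<and> AC a b v h \<and>
    (\<lambda>x. (norm (h x))\<^sup>2) absolutely_integrable_on {a..b})"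
proof (intro iffI conjI)
  assume H: "H2_curve a b \<gamma>"
  then show ab: "a < b" by (simp add: H2_curve_def)
  obtain g h where gh: "L2 a b g" "L2 a b h" "has_weak_deriv a b \<gamma> g" "has_weak_deriv a b g h"
    using H by (auto simp: H2_curve_def W22_def)
  obtain v where v: "AC a b v h" "AE x in lebesgue. x \<in> {a<..<b} \<longrightarrow> g x = v x"
    using weak_deriv_AC[OF ab gh(4) L2_absolutely_integrable(1)[OF gh(2)]] by blast
  obtain F where F: "AC a b F g" "AE x in lebesgue. x \<in> {a<..<b} \<longrightarrow> \<gamma> x = F x"
    using weak_deriv_AC[OF ab gh(3) L2_absolutely_integrable(1)[OF gh(1)]] by blast
  have eq: "\<gamma> x = F x" if "x \<in> {a..b}" for x
    using continuous_AE_eq[OF ab _ AC_continuous[OF F(1)] F(2) that] H by (simp add: H2_curve_def)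
  obtain N where N: "negligible N" "\<And>x. x \<in> {a..b} - N \<Longrightarrow> g x = v x"
    using AE_interval_negligible[OF v(2)] by blast
  have "AC a b \<gamma> v"
    by (rule AC_cong[OF F(1) eq N(1)]) (use N(2) in auto)
  with v(1) L2_absolutely_integrable(2)[OF gh(2)]
  show "\<exists>v h. AC a b \<gamma> v \<and> AC a b v h \<and> (\<lambda>x. (norm (h x))\<^sup>2) absolutely_integrable_on {a..b}"
    by blast
next
  assume H: "a < b \<and> (\<exists>v h. AC a b \<gamma> v \<and> AC a b v h \<and> (\<lambda>x. (norm (h x))\<^sup>2) absolutely_integrable_on {a..b})"
  then obtain v h where vh: "AC a b \<gamma> v" "AC a b v h" "(\<lambda>x. (norm (h x))\<^sup>2) absolutely_integrable_on {a..b}"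
    by blast
  have "h absolutely_integrable_on {a<..<b}"
    unfolding set_lebesgue_integral_open_interval by (rule AC_integrable[OF vh(2)])
  then have "L2 a b h"
    using vh(3) unfolding L2_def set_lebesgue_integral_open_interval(2)[symmetric]
    by (auto simp: set_borel_measurable_def set_integrable_def)
  then have "W22 a b \<gamma>"
    unfolding W22_def using AC_L2[OF vh(1)] AC_L2[OF vh(2)] AC_has_weak_deriv[OF vh(1)] AC_has_weak_deriv[OF vh(2)]
    by blast
  then show "H2_curve a b \<gamma>"
    using H AC_continuous[OF vh(1)] by (simp add: H2_curve_def)
qed

text \<open>\<open>r\<close> is the speed, \<open>T\<close> the unit tangent, and \<open>\<tau> = dT/dx\<close>, so that the curvature is \<open>\<tau> / r\<close>.\<close>

definition frame :: "real \<Rightarrow> real \<Rightarrow> (real \<Rightarrow> 'a::euclidean_space) \<Rightarrow> (real \<Rightarrow> real) \<Rightarrow> (real \<Rightarrow> 'a) \<Rightarrow> (real \<Rightarrow> 'a) \<Rightarrow> bool" where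
  "frame a b \<gamma> r T \<tau> \<longleftrightarrow> a < b \<and> continuous_on {a..b} r \<and> (\<forall>x\<in>{a..b}. 0 < r x \<and> norm (T x) = 1) \<and>
     AC a b \<gamma> (\<lambda>x. r x *\<^sub>R T x) \<and> AC a b T \<tau> \<and> (\<lambda>x. (norm (\<tau> x))\<^sup>2) absolutely_integrable_on {a..b}"

lemma frameD:
  assumes "frame a b \<gamma> r T \<tau>"
  shows "a < b" "continuous_on {a..b} r" "\<And>x. x \<in> {a..b} \<Longrightarrow> 0 < r x" "\<And>x. x \<in> {a..b} \<Longrightarrow> norm (T x) = 1"
    "AC a b \<gamma> (\<lambda>x. r x *\<^sub>R T x)" "AC a b T \<tau>" "(\<lambda>x. (norm (\<tau> x))\<^sup>2) absolutely_integrable_on {a..b}"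
    "continuous_on {a..b} T"
  using assms AC_continuous by (auto simp: frame_def)

lemma frame_subinterval:
  assumes "frame a b \<gamma> r T \<tau>" "a \<le> c" "c < d" "d \<le> b"
  shows "frame c d \<gamma> r T \<tau>"
  unfolding frame_def
proof (intro conjI ballI)
  have s: "{c..d} \<subseteq> {a..b}" using assms by auto
  show "continuous_on {c..d} r" using frameD(2)[OF assms(1)] s by (rule continuous_on_subset)
  show "0 < r x" "norm (T x) = 1" if "x \<in> {c..d}" for x using frameD(3,4)[OF assms(1)] s that by auto
  show "AC c d \<gamma> (\<lambda>x. r x *\<^sub>R T x)" "AC c d T \<tau>"
    by (rule AC_subinterval[OF frameD(5)[OF assms(1)]] AC_subinterval[OF frameD(6)[OF assms(1)]]; use assms in simp)+
  show "(\<lambda>x. (norm (\<tau> x))\<^sup>2) absolutely_integrable_on {c..d}"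
    using absolutely_integrable_subinterval[OF frameD(7)[OF assms(1)]] assms by blast
qed (use assms in simp)

lemma frame_velocity:
  assumes "frame a b \<gamma> r T \<tau>" "x \<in> {a..b}"
  shows "velocity a b \<gamma> x = r x *\<^sub>R T x"
  unfolding velocity_def
  by (rule vector_derivative_within_closed_interval[OF frameD(1)[OF assms(1)] assms(2)
        AC_has_vector_derivative[OF frameD(5)[OF assms(1)] _ assms(2)]])
     (intro continuous_intros frameD[OF assms(1)])

lemma frame_norm_velocity:
  assumes "frame a b \<gamma> r T \<tau>" "x \<in> {a..b}"
  shows "norm (velocity a b \<gamma> x) = r x"
  using frame_velocity[OF assms] frameD(3,4)[OF assms] by simp

lemma frame_immersed: "frame a b \<gamma> r T \<tau> \<Longrightarrow> H2_curve a b \<gamma> \<Longrightarrow> immersed_H2_curve a b \<gamma>"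
  unfolding immersed_H2_curve_def
  using frame_norm_velocity frameD(3) by (metis less_irrefl norm_zero)

text \<open>The unit tangent is v / sqrt(v . v), differentiated by the chain rule on the positive
  half-line, where immersedness keeps v . v.\<close>

lemma immersed_H2_curve_frame:
  assumes "immersed_H2_curve a b \<gamma>"
  obtains r T \<tau> where "frame a b \<gamma> r T \<tau>"
proof -
  obtain v h where ab: "a < b" and v: "AC a b \<gamma> v" and h: "AC a b v h"
    and h2: "(\<lambda>x. (norm (h x))\<^sup>2) absolutely_integrable_on {a..b}"
    using assms unfolding immersed_H2_curve_def H2_curve_iff by blast
  note cv = AC_continuous[OF h]
  have "velocity a b \<gamma> x = v x" if "x \<in> {a..b}" for x
    unfolding velocity_def
    by (rule vector_derivative_within_closed_interval[OF ab that AC_has_vector_derivative[OF v cv that]])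
  then have v0: "v x \<noteq> 0" if "x \<in> {a..b}" for x using assms that by (auto simp: immersed_H2_curve_def)
  define q where "q x = v x \<bullet> v x" for x
  have q: "AC a b q (\<lambda>x. v x \<bullet> h x + h x \<bullet> v x)"
    unfolding q_def by (rule AC_bilinear[OF bounded_bilinear_inner h h])
  have q0: "q x \<in> {0<..}" if "x \<in> {a..b}" for x using v0[OF that] by (simp add: q_def)
  define N where "N y = 1 / sqrt y" for y :: real
  define N' where "N' y = - 1 / (2 * y * sqrt y)" for y :: real
  have N: "(N has_real_derivative N' y) (at y)" if "y \<in> {0<..}" for y
  proof -
    have "(N has_real_derivative - (inverse (sqrt y) / 2) / (sqrt y)\<^sup>2) (at y)"
      unfolding N_def[abs_def]
      by (rule DERIV_cong[OF DERIV_divide[OF DERIV_const DERIV_real_sqrt]])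
         (use that in \<open>auto simp: power2_eq_square field_simps\<close>)
    moreover have "- (inverse (sqrt y) / 2) / (sqrt y)\<^sup>2 = N' y"
      using that by (simp add: N'_def field_simps)
    ultimately show ?thesis by simp
  qed
  have cN': "continuous_on {0<..} N'" unfolding N'_def by (intro continuous_intros) auto
  have nq: "AC a b (\<lambda>x. N (q x)) (\<lambda>x. N' (q x) * (v x \<bullet> h x + h x \<bullet> v x))"
    by (rule AC_chain[OF q q0 _ N cN']) auto
  define r where "r x = norm (v x)" for x
  define T where "T x = N (q x) *\<^sub>R v x" for x
  define \<tau> where "\<tau> x = N (q x) *\<^sub>R h x + (N' (q x) * (v x \<bullet> h x + h x \<bullet> v x)) *\<^sub>R v x" for x
  have T: "AC a b T \<tau>" unfolding T_def \<tau>_def by (rule AC_bilinear[OF bounded_bilinear_scaleR nq h])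
  have Nq: "N (q x) = 1 / r x" for x by (simp add: N_def q_def r_def norm_eq_sqrt_inner)
  have r0: "r x > 0" if "x \<in> {a..b}" for x using v0[OF that] by (simp add: r_def)
  have rT: "r x *\<^sub>R T x = v x" if "x \<in> {a..b}" for x using r0[OF that] by (simp add: T_def Nq)
  \<comment> \<open>The norm of \<open>\<tau>\<close> is at most \<open>C\<close> times that of
    \<open>h\<close>. As \<open>C\<close> is continuous on a compact interval, square integrability
    passes from \<open>h\<close> to \<open>\<tau>\<close>.\<close>
  define C where "C x = \<bar>N (q x)\<bar> + 2 * \<bar>N' (q x)\<bar> * (norm (v x))\<^sup>2" for x
  have "continuous_on {a..b} C"
    unfolding C_def
    by (intro continuous_intros AC_continuous[OF nq] cv continuous_on_compose2[OF cN' AC_continuous[OF q]])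
       (use q0 in auto)
  then obtain M where M: "\<And>x. x \<in> {a..b} \<Longrightarrow> C x \<le> M"
    using compact_imp_bounded[OF compact_continuous_image[of "{a..b}" C]]
    by (force simp: bounded_iff abs_le_iff)
  have bound: "(norm (\<tau> x))\<^sup>2 \<le> M\<^sup>2 * (norm (h x))\<^sup>2" if x: "x \<in> {a..b}" for x
  proof -
    have "norm (\<tau> x) \<le> norm (N (q x) *\<^sub>R h x) + norm ((N' (q x) * (v x \<bullet> h x + h x \<bullet> v x)) *\<^sub>R v x)"
      unfolding \<tau>_def by (rule norm_triangle_ineq)
    also have "\<dots> = \<bar>N (q x)\<bar> * norm (h x) + 2 * \<bar>N' (q x)\<bar> * norm (v x) * \<bar>v x \<bullet> h x\<bar>"
      by (simp add: inner_commute abs_mult algebra_simps)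
    also have "\<dots> \<le> \<bar>N (q x)\<bar> * norm (h x) + 2 * \<bar>N' (q x)\<bar> * norm (v x) * (norm (v x) * norm (h x))"
      by (intro add_left_mono mult_left_mono Cauchy_Schwarz_ineq2) auto
    also have "\<dots> = C x * norm (h x)" by (simp add: C_def power2_eq_square algebra_simps)
    also have "\<dots> \<le> M * norm (h x)" using M[OF x] by (rule mult_right_mono) simp
    finally have "(norm (\<tau> x))\<^sup>2 \<le> (M * norm (h x))\<^sup>2" by (rule power_mono) simp
    then show ?thesis by (simp add: power_mult_distrib)
  qed
  have \<tau>2: "(\<lambda>x. (norm (\<tau> x))\<^sup>2) absolutely_integrable_on {a..b}"
  proof (rule measurable_bounded_by_integrable_imp_absolutely_integrable)
    have "\<tau> \<in> borel_measurable (lebesgue_on {a..b})"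
      by (rule absolutely_integrable_imp_borel_measurable[OF AC_integrable[OF T]]) simp
    then show "(\<lambda>x. (norm (\<tau> x))\<^sup>2) \<in> borel_measurable (lebesgue_on {a..b})" by measurable
    show "(\<lambda>x. M\<^sup>2 * (norm (h x))\<^sup>2) integrable_on {a..b}"
      by (intro integrable_on_mult_right set_lebesgue_integral_eq_integral(1)[OF h2])
  qed (use bound in auto)
  have "frame a b \<gamma> r T \<tau>"
    unfolding frame_def
  proof (intro conjI ballI)
    show "continuous_on {a..b} r" unfolding r_def by (intro continuous_intros cv)
    show "AC a b \<gamma> (\<lambda>x. r x *\<^sub>R T x)"
      by (rule AC_cong[OF v _ negligible_empty]) (use rT in auto)
    show "norm (T x) = 1" if "x \<in> {a..b}" for x
      using r0[OF that] by (simp add: T_def Nq) (simp add: r_def)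
  qed (use ab r0 T \<tau>2 in auto)
  then show thesis by (rule that)
qed

lemma frame_arc_deriv:
  assumes "frame a b \<gamma> r T \<tau>"
  shows "AE x in lebesgue. x \<in> {a<..<b} \<longrightarrow> arc_deriv a b \<gamma> \<gamma> x = T x"
  using weak_deriv_eq_AE[OF AC_has_weak_deriv[OF frameD(5)[OF assms]]]
proof eventually_elim
  case (elim x)
  show ?case
  proof
    assume "x \<in> {a<..<b}"
    then have x: "x \<in> {a..b}" "x \<in> {a<..<b}" by auto
    then show "arc_deriv a b \<gamma> \<gamma> x = T x"
      using elim frameD(3)[OF assms x(1)] by (simp add: arc_deriv_def frame_norm_velocity[OF assms x(1)])
  qed
qed

text \<open>\<open>arc_deriv\<close> of the curve agrees with \<open>T\<close> only almost
  everywhere, but weak derivatives do not see null sets, so \<open>\<tau>\<close> is still its weak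
  derivative.\<close>

lemma frame_curvature:
  assumes "frame a b \<gamma> r T \<tau>"
  shows "AE x in lebesgue. x \<in> {a<..<b} \<longrightarrow> curvature a b \<gamma> x = (1 / r x) *\<^sub>R \<tau> x"
proof -
  have "AE x in lebesgue. x \<in> {a<..<b} \<longrightarrow> T x = arc_deriv a b \<gamma> \<gamma> x"
    using frame_arc_deriv[OF assms] by eventually_elim simp
  then have "has_weak_deriv a b (arc_deriv a b \<gamma> \<gamma>) \<tau>"
    by (rule has_weak_deriv_cong_AE[OF AC_has_weak_deriv[OF frameD(6)[OF assms]]])
  from weak_deriv_eq_AE[OF this] show ?thesis
  proof eventually_elim
    case (elim x)
    show ?case
    proof
      assume "x \<in> {a<..<b}"
      then have x: "x \<in> {a..b}" "x \<in> {a<..<b}" by auto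
      then show "curvature a b \<gamma> x = (1 / r x) *\<^sub>R \<tau> x"
        using elim by (simp add: curvature_def arc_deriv_def[of a b \<gamma> "arc_deriv a b \<gamma> \<gamma>"] frame_norm_velocity[OF assms x(1)])
    qed
  qed
qed

lemma frame_signed_curvature:
  assumes "frame a b \<gamma> r T \<tau>"
  shows "AE x in lebesgue. x \<in> {a<..<b} \<longrightarrow>
    signed_curvature a b u v \<gamma> x = (1 / r x) * (\<tau> x \<bullet> ((T x \<bullet> u) *\<^sub>R v - (T x \<bullet> v) *\<^sub>R u))"
  using frame_arc_deriv[OF assms] frame_curvature[OF assms]
  by eventually_elim (simp add: signed_curvature_def Let_def)

section \<open>Length and bending energy in terms of a frame\<close>

lemma frame_integrable_r:
  assumes "frame a b \<gamma> r T \<tau>"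
  shows "r absolutely_integrable_on {a..b}"
  by (rule absolutely_integrable_continuous_real[OF frameD(2)[OF assms]])

lemma frame_integrable_energy:
  assumes f: "frame a b \<gamma> r T \<tau>"
  shows "(\<lambda>x. (norm (\<tau> x))\<^sup>2 / r x) absolutely_integrable_on {a..b}"
proof -
  have "continuous_on {a..b} (\<lambda>x. 1 / r x)"
    by (intro continuous_intros frameD(2)[OF f]) (use frameD(3)[OF f] in force)
  from absolutely_integrable_bilinear_continuous[OF bounded_bilinear_mult this frameD(7)[OF f]]
  show ?thesis by simp
qed

lemma frame_arclength:
  assumes f: "frame a b \<gamma> r T \<tau>" and x: "x \<in> {a..b}"
  shows "arclength_param a b \<gamma> x = integral {a..x} r"
  unfolding arclength_param_def
proof (rule LINT_eq_integral_AE)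
  show "r absolutely_integrable_on {a..x}"
    using absolutely_integrable_subinterval[OF frame_integrable_r[OF f], of a x] x by simp
  show "AE y in lebesgue. y \<in> {a<..<x} \<longrightarrow> norm (velocity a b \<gamma> y) = r y"
    using x frame_norm_velocity[OF f] by (intro AE_I2) auto
qed

lemma frame_curve_length:
  assumes f: "frame a b \<gamma> r T \<tau>"
  shows "curve_length a b \<gamma> = integral {a..b} r"
  using frame_arclength[OF f, of b] frameD(1)[OF f] by (simp add: curve_length_def arclength_param_def)

lemma frame_curve_length_pos:
  assumes f: "frame a b \<gamma> r T \<tau>"
  shows "integral {a..b} r > 0"
proof -
  have "integral {a..b} r \<ge> 0"
    using frameD(3)[OF f] by (intro integral_nonneg integrable_continuous_real frameD(2)[OF f]) (auto intro: less_imp_le)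
  moreover have "integral {a..b} r \<noteq> 0"
    using integral_eq_0_iff[OF frameD(2)[OF f] frameD(1)[OF f]] frameD(1,3)[OF f]
    by (metis atLeastAtMost_iff less_eq_real_def less_irrefl)
  ultimately show ?thesis by linarith
qed

lemma frame_bending_energy:
  assumes f: "frame a b \<gamma> r T \<tau>"
  shows "bending_energy a b \<gamma> = integral {a..b} (\<lambda>x. (norm (\<tau> x))\<^sup>2 / r x)"
  unfolding bending_energy_def
proof (rule LINT_eq_integral_AE[OF frame_integrable_energy[OF f]])
  show "AE x in lebesgue. x \<in> {a<..<b} \<longrightarrow>
    (norm (curvature a b \<gamma> x))\<^sup>2 * norm (velocity a b \<gamma> x) = (norm (\<tau> x))\<^sup>2 / r x"
    using frame_curvature[OF f]
  proof eventually_elim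
    case (elim x)
    show ?case
    proof
      assume "x \<in> {a<..<b}"
      then have x: "x \<in> {a..b}" "x \<in> {a<..<b}" by auto
      then show "(norm (curvature a b \<gamma> x))\<^sup>2 * norm (velocity a b \<gamma> x) = (norm (\<tau> x))\<^sup>2 / r x"
        using elim frameD(3)[OF f x(1)]
        by (simp add: frame_norm_velocity[OF f x(1)] power_divide power2_eq_square)
    qed
  qed
qed

text \<open>Both twice the product of \<open>T\<close> with \<open>\<tau>\<close> and 0 are
  densities of the constant |T|^2 = 1.\<close>

lemma frame_orthogonal:
  assumes f: "frame a b \<gamma> r T \<tau>"
  shows "AE x in lebesgue. x \<in> {a..b} \<longrightarrow> T x \<bullet> \<tau> x = 0"
proof -
  have "AC a b (\<lambda>x. T x \<bullet> T x) (\<lambda>x. T x \<bullet> \<tau> x + \<tau> x \<bullet> T x)"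
    by (rule AC_bilinear[OF bounded_bilinear_inner frameD(6)[OF f] frameD(6)[OF f]])
  moreover have "AC a b (\<lambda>x. T x \<bullet> T x) (\<lambda>x. 0)"
    by (rule AC_cong[OF AC_const[of a b 1] _ negligible_empty])
       (use frameD(4)[OF f] in \<open>auto simp: norm_eq_1\<close>)
  ultimately have "AE x in lebesgue. x \<in> {a..b} \<longrightarrow> T x \<bullet> \<tau> x + \<tau> x \<bullet> T x = 0"
    by (rule AC_unique)
  then show ?thesis by eventually_elim (simp add: inner_commute)
qed

section \<open>Translation, concatenation and closed curves\<close>

lemma AC_shift:
  assumes "AC (a + c) (b + c) f g"
  shows "AC a b (\<lambda>x. f (x + c)) (\<lambda>x. g (x + c))"
proof (rule AC_I)
  have sh: "(\<lambda>x. g (x + c)) = g \<circ> (+) c" for g :: "real \<Rightarrow> 'b" by (simp add: o_def add.commute)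
  show "(\<lambda>x. g (x + c)) absolutely_integrable_on {a..b}"
    using AC_integrable[OF assms] integrable_on_shift_Icc_real[of g c a b]
      integrable_on_shift_Icc_real[of "\<lambda>x. norm (g x)" c a b]
    unfolding absolutely_integrable_on_def by (simp add: o_def add.commute)
  fix u v assume "a \<le> u" "u \<le> v" "v \<le> b"
  then show "integral {u..v} (\<lambda>x. g (x + c)) = f (v + c) - f (u + c)"
    unfolding sh integral_shift_Icc_real by (intro AC_integral[OF assms]) auto
qed

lemma absolutely_integrable_shift:
  fixes g :: "real \<Rightarrow> 'a::euclidean_space"
  assumes "g absolutely_integrable_on {a + c..b + c}"
  shows "(\<lambda>x. g (x + c)) absolutely_integrable_on {a..b}"
proof -
  have "AC (a + c) (b + c) (\<lambda>x. integral {a + c..x} g) g"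
    using assms by (simp add: AC_def)
  from AC_integrable[OF AC_shift[OF this]] show ?thesis .
qed

lemma H2_curve_shift:
  assumes "H2_curve (a + c) (b + c) \<gamma>"
  shows "H2_curve a b (\<lambda>t. \<gamma> (t + c))"
proof -
  obtain v h where vh: "AC (a + c) (b + c) \<gamma> v" "AC (a + c) (b + c) v h"
    "(\<lambda>x. (norm (h x))\<^sup>2) absolutely_integrable_on {a + c..b + c}" "a < b"
    using assms unfolding H2_curve_iff by auto
  show ?thesis
    unfolding H2_curve_iff
    using AC_shift[OF vh(1)] AC_shift[OF vh(2)] absolutely_integrable_shift[OF vh(3)] vh(4) by blast
qed

lemma frame_shift:
  assumes f: "frame (a + c) (b + c) \<gamma> r T \<tau>"
  shows "frame a b (\<lambda>x. \<gamma> (x + c)) (\<lambda>x. r (x + c)) (\<lambda>x. T (x + c)) (\<lambda>x. \<tau> (x + c))"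
  unfolding frame_def
proof (intro conjI ballI)
  show "a < b" using frameD(1)[OF f] by simp
  show "continuous_on {a..b} (\<lambda>x. r (x + c))"
    by (rule continuous_on_compose2[OF frameD(2)[OF f]]) (auto intro!: continuous_intros)
  show "0 < r (x + c)" "norm (T (x + c)) = 1" if "x \<in> {a..b}" for x
    using frameD(3,4)[OF f, of "x + c"] that by auto
  show "AC a b (\<lambda>x. \<gamma> (x + c)) (\<lambda>x. r (x + c) *\<^sub>R T (x + c))" by (rule AC_shift[OF frameD(5)[OF f]])
  show "AC a b (\<lambda>x. T (x + c)) (\<lambda>x. \<tau> (x + c))" by (rule AC_shift[OF frameD(6)[OF f]])
  show "(\<lambda>x. (norm (\<tau> (x + c)))\<^sup>2) absolutely_integrable_on {a..b}"
    by (rule absolutely_integrable_shift[OF frameD(7)[OF f]])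
qed

lemma length_energy_shift:
  assumes f: "frame (a + c) (b + c) \<gamma> r T \<tau>"
  shows "curve_length a b (\<lambda>x. \<gamma> (x + c)) = curve_length (a + c) (b + c) \<gamma>"
    "bending_energy a b (\<lambda>x. \<gamma> (x + c)) = bending_energy (a + c) (b + c) \<gamma>"
proof -
  have sh: "(\<lambda>x. g (x + c)) = g \<circ> (+) c" for g :: "real \<Rightarrow> real" by (simp add: o_def add.commute)
  show "curve_length a b (\<lambda>x. \<gamma> (x + c)) = curve_length (a + c) (b + c) \<gamma>"
    unfolding frame_curve_length[OF f] frame_curve_length[OF frame_shift[OF f]] sh integral_shift_Icc_real ..
  show "bending_energy a b (\<lambda>x. \<gamma> (x + c)) = bending_energy (a + c) (b + c) \<gamma>"
    unfolding frame_bending_energy[OF f] frame_bending_energy[OF frame_shift[OF f]]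
    using integral_shift_Icc_real[of a b "\<lambda>x. (norm (\<tau> x))\<^sup>2 / r x" c] by (simp add: o_def add.commute)
qed

lemma length_energy_combine:
  assumes f: "frame a c \<gamma> r T \<tau>" and "a < b" "b < c"
  shows "curve_length a c \<gamma> = curve_length a b \<gamma> + curve_length b c \<gamma>"
    "bending_energy a c \<gamma> = bending_energy a b \<gamma> + bending_energy b c \<gamma>"
proof -
  have f1: "frame a b \<gamma> r T \<tau>" and f2: "frame b c \<gamma> r T \<tau>"
    using assms by (auto intro!: frame_subinterval[OF f])
  show "curve_length a c \<gamma> = curve_length a b \<gamma> + curve_length b c \<gamma>"
    unfolding frame_curve_length[OF f] frame_curve_length[OF f1] frame_curve_length[OF f2]
    using assms set_lebesgue_integral_eq_integral(1)[OF frame_integrable_r[OF f]]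
    by (intro Henstock_Kurzweil_Integration.integral_combine[symmetric]) auto
  show "bending_energy a c \<gamma> = bending_energy a b \<gamma> + bending_energy b c \<gamma>"
    unfolding frame_bending_energy[OF f] frame_bending_energy[OF f1] frame_bending_energy[OF f2]
    using assms set_lebesgue_integral_eq_integral(1)[OF frame_integrable_energy[OF f]]
    by (intro Henstock_Kurzweil_Integration.integral_combine[symmetric]) auto
qed

text \<open>A closed curve extends as an H^2 curve beyond \<open>{a..b}\<close>, so the one-sided
  derivatives at the end points are two-sided ones.\<close>

lemma closed_H2_curve_derivative:
  assumes c: "closed_H2_curve \<gamma>" and ab: "a < b" and x: "x \<in> {a..b}"
  shows "velocity a b \<gamma> x = vector_derivative \<gamma> (at x)"
proof -
  have "H2_curve (a - 1) (b + 1) \<gamma>" using c ab by (simp add: closed_H2_curve_def)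
  then obtain v h where v: "AC (a - 1) (b + 1) \<gamma> v" "AC (a - 1) (b + 1) v h" unfolding H2_curve_iff by blast
  have "(\<gamma> has_vector_derivative v x) (at x within {a - 1..b + 1})"
    by (rule AC_has_vector_derivative[OF v(1) AC_continuous[OF v(2)]]) (use x in auto)
  then have d: "(\<gamma> has_vector_derivative v x) (at x)"
    using x by (subst (asm) at_within_interior) auto
  have "velocity a b \<gamma> x = v x"
    unfolding velocity_def
    by (rule vector_derivative_within_closed_interval[OF ab x has_vector_derivative_at_within[OF d]])
  then show ?thesis using vector_derivative_at[OF d] by simp
qed

lemma immersed_closed_iff:
  "immersed_closed_H2_curve \<gamma> \<longleftrightarrow> (\<forall>t. \<gamma> (t + 1) = \<gamma> t) \<and> (\<forall>a b. a < b \<longrightarrow> immersed_H2_curve a b \<gamma>)"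
proof (intro iffI conjI allI impI)
  assume A: "immersed_closed_H2_curve \<gamma>"
  then have c: "closed_H2_curve \<gamma>" by (simp add: immersed_closed_H2_curve_def)
  show "\<gamma> (t + 1) = \<gamma> t" for t using c by (simp add: closed_H2_curve_def)
  show "immersed_H2_curve a b \<gamma>" if "a < b" for a b
    using A c that closed_H2_curve_derivative[OF c that]
    by (simp add: immersed_H2_curve_def immersed_closed_H2_curve_def closed_H2_curve_def)
next
  assume A: "(\<forall>t. \<gamma> (t + 1) = \<gamma> t) \<and> (\<forall>a b. a < b \<longrightarrow> immersed_H2_curve a b \<gamma>)"
  then have c: "closed_H2_curve \<gamma>" by (simp add: closed_H2_curve_def immersed_H2_curve_def)
  have "vector_derivative \<gamma> (at x) \<noteq> 0" for x
  proof -
    have "immersed_H2_curve (x - 1) (x + 1) \<gamma>" using A by simp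
    then have "velocity (x - 1) (x + 1) \<gamma> x \<noteq> 0" by (simp add: immersed_H2_curve_def)
    then show ?thesis using closed_H2_curve_derivative[OF c, of "x - 1" "x + 1" x] by simp
  qed
  with c show "immersed_closed_H2_curve \<gamma>" by (simp add: immersed_closed_H2_curve_def)
qed

section \<open>Elliptic integrals and functions\<close>

lemma elliptic_radicand_pos:
  fixes m :: real
  assumes "0 \<le> m" "m < 1"
  shows "0 < 1 - m * (sin \<theta>)\<^sup>2" "1 - m * (sin \<theta>)\<^sup>2 \<le> 1"
proof -
  have s: "(sin \<theta>)\<^sup>2 \<le> 1" "(sin \<theta>)\<^sup>2 \<ge> 0" by (simp_all add: abs_square_le_1)
  have "m * (sin \<theta>)\<^sup>2 \<le> m * 1" using assms s by (intro mult_left_mono) auto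
  then show "0 < 1 - m * (sin \<theta>)\<^sup>2" using assms by linarith
  show "1 - m * (sin \<theta>)\<^sup>2 \<le> 1" using assms s by simp
qed

lemma LBINT_0_has_derivative:
  fixes f :: "real \<Rightarrow> real"
  assumes "continuous_on UNIV f"
  shows "((\<lambda>x. LBINT y=0..ereal x. f y) has_real_derivative f x) (at x)"
proof -
  define a where "a = min x 0 - 1"
  define b where "b = max x 0 + 1"
  have "((\<lambda>x. LBINT y=ereal 0..ereal x. f y) has_vector_derivative f x) (at x within {a..b})"
    by (rule interval_integral_FTC2) (use assms in \<open>auto simp: a_def b_def intro: continuous_on_subset\<close>)
  moreover have "at x within {a..b} = at x"
    by (rule at_within_interior) (auto simp: a_def b_def)
  ultimately show ?thesis
    by (simp add: has_real_derivative_iff_has_vector_derivative zero_ereal_def)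
qed

lemma odd_function_if_derivative_even:
  fixes f :: "real \<Rightarrow> real"
  assumes f: "\<And>x. (f has_real_derivative g x) (at x)" and g: "\<And>x. g (- x) = g x" and "f 0 = 0"
  shows "f (- x) = - f x"
proof -
  have "((\<lambda>x. f x + f (- x)) has_real_derivative g x + g (- x) * - 1) (at x)" for x
    by (intro DERIV_add f DERIV_chain2[OF f]) (auto intro!: derivative_eq_intros)
  then have d: "((\<lambda>x. f x + f (- x)) has_real_derivative 0) (at x)" for x
    by (simp add: g)
  have "f x + f (- x) = f 0 + f (- 0)"
    by (rule DERIV_isconst_all[of "\<lambda>x. f x + f (- x)"]) (use d in blast)
  then show ?thesis using \<open>f 0 = 0\<close> by simp
qed

text \<open>The parameter is kept general because values other than \<open>m_star\<close> enter the
  proof that \<open>m_star\<close> exists and is at least 3/4.\<close>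

locale elliptic_parameter =
  fixes m :: real
  assumes m0: "0 < m" and m1: "m < 1"
begin

definition \<Delta> :: "real \<Rightarrow> real" where "\<Delta> \<theta> = sqrt (1 - m * (sin \<theta>)\<^sup>2)"

lemma \<Delta>_pos: "0 < \<Delta> \<theta>" and \<Delta>_le: "\<Delta> \<theta> \<le> 1" and \<Delta>_sq: "(\<Delta> \<theta>)\<^sup>2 = 1 - m * (sin \<theta>)\<^sup>2"
  using elliptic_radicand_pos[of m \<theta>] m0 m1 by (auto simp: \<Delta>_def)

lemma continuous_\<Delta>: "continuous_on S \<Delta>"
  unfolding \<Delta>_def[abs_def] by (intro continuous_intros)

text \<open>The incomplete integral of the second kind. Composed with the amplitude it is a
  primitive of dn^2, from which the primitives of the tangent profile and of the squared curvature
  are built.\<close>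

definition Einc :: "real \<Rightarrow> real" where "Einc x = (LBINT \<theta>=0..ereal x. \<Delta> \<theta>)"

lemma ellF_derivative: "((\<lambda>x. ellF x m) has_real_derivative 1 / \<Delta> x) (at x)"
  unfolding ellF_def \<Delta>_def[symmetric]
  by (rule LBINT_0_has_derivative) (intro continuous_intros continuous_\<Delta>, use \<Delta>_pos in \<open>auto simp: less_imp_neq[symmetric]\<close>)

lemma Einc_derivative: "(Einc has_real_derivative \<Delta> x) (at x)"
  unfolding Einc_def[abs_def] by (rule LBINT_0_has_derivative[OF continuous_\<Delta>])

lemma ellF_0: "ellF 0 m = 0" and Einc_0: "Einc 0 = 0"
  by (simp_all add: ellF_def Einc_def zero_ereal_def[symmetric])

lemma Einc_pi_half: "Einc (pi / 2) = ellE m"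
  by (simp add: Einc_def ellE_def \<Delta>_def)

lemma ellF_odd: "ellF (- x) m = - ellF x m"
  by (rule odd_function_if_derivative_even[OF ellF_derivative _ ellF_0]) (simp add: \<Delta>_def)

lemma Einc_odd: "Einc (- x) = - Einc x"
  by (rule odd_function_if_derivative_even[OF Einc_derivative _ Einc_0]) (simp add: \<Delta>_def)

lemma ellF_strict_mono: "x < y \<Longrightarrow> ellF x m < ellF y m"
  by (rule DERIV_pos_imp_increasing[of x y]) (use ellF_derivative \<Delta>_pos in \<open>auto intro!: exI[of _ "1 / \<Delta> _"]\<close>)

lemma ellF_ge: "0 \<le> x \<Longrightarrow> x \<le> ellF x m"
proof -
  assume x: "0 \<le> x"
  have "(\<lambda>x. ellF x m - x) 0 \<le> (\<lambda>x. ellF x m - x) x"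
  proof (rule DERIV_nonneg_imp_nondecreasing[OF x])
    fix y
    have "((\<lambda>x. ellF x m - x) has_real_derivative 1 / \<Delta> y - 1) (at y)"
      by (intro DERIV_diff ellF_derivative DERIV_ident)
    moreover have "1 / \<Delta> y - 1 \<ge> 0" using \<Delta>_pos[of y] \<Delta>_le[of y] by (simp add: field_simps)
    ultimately show "\<exists>z. ((\<lambda>x. ellF x m - x) has_real_derivative z) (at y) \<and> 0 \<le> z" by blast
  qed
  then show ?thesis by (simp add: ellF_0)
qed

text \<open>\<open>jacobi_am\<close> is defined through \<open>inv\<close>, which is meaningful only
  for a bijection. Strict monotonicity gives injectivity; the bound x <= F(x) for x >= 0, oddness
  and the intermediate value theorem give surjectivity.\<close>

lemma bij_ellF: "bij (\<lambda>x. ellF x m)"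
proof (rule bijI)
  show "inj (\<lambda>x. ellF x m)"
    by (rule injI) (metis ellF_strict_mono less_irrefl linorder_neqE)
  have c: "continuous_on S (\<lambda>x. ellF x m)" for S
    by (intro continuous_at_imp_continuous_on ballI DERIV_isCont[OF ellF_derivative])
  show "surj (\<lambda>x. ellF x m)"
  proof (rule surjI[of _ "inv (\<lambda>x. ellF x m)"])
    fix y
    have "ellF (- \<bar>y\<bar>) m \<le> y" "y \<le> ellF \<bar>y\<bar> m"
      using ellF_ge[of "\<bar>y\<bar>"] by (auto simp: ellF_odd)
    then have "\<exists>x. - \<bar>y\<bar> \<le> x \<and> x \<le> \<bar>y\<bar> \<and> ellF x m = y"
      by (intro IVT') (auto intro: c)
    then show "ellF (inv (\<lambda>x. ellF x m) y) m = y"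
      by (intro f_inv_into_f[of y "\<lambda>x. ellF x m" UNIV]) auto
  qed
qed

section \<open>The Jacobi functions am, sn, cn, dn and the reference leaf\<close>

definition am :: "real \<Rightarrow> real" where "am u = jacobi_am u m"
definition sn :: "real \<Rightarrow> real" where "sn u = sin (am u)"
definition cn :: "real \<Rightarrow> real" where "cn u = cos (am u)"
definition dn :: "real \<Rightarrow> real" where "dn u = \<Delta> (am u)"

lemma cn_eq: "jacobi_cn u m = cn u" by (simp add: jacobi_cn_def cn_def am_def)

lemma ellF_am: "ellF (am u) m = u"
  unfolding am_def jacobi_am_def using surj_f_inv_f[OF bij_is_surj[OF bij_ellF], of u] by simp

lemma am_ellF: "am (ellF x m) = x"
  unfolding am_def jacobi_am_def using inv_f_f[OF bij_is_inj[OF bij_ellF], of x] by simp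

lemma am_derivative: "(am has_real_derivative dn u) (at u)"
proof -
  have "isCont am (ellF (am u) m)"
    by (rule isCont_inverse_function[where d = 1 and f = "\<lambda>x. ellF x m"])
       (auto simp: am_ellF intro: DERIV_isCont[OF ellF_derivative])
  then have "isCont am u" by (simp add: ellF_am)
  then have "(am has_real_derivative inverse (1 / \<Delta> (am u))) (at u)"
    using \<Delta>_pos[of "am u"]
    by (intro DERIV_inverse_function[where f = "\<lambda>x. ellF x m" and a = "u - 1" and b = "u + 1"] ellF_derivative)
       (auto simp: ellF_am)
  then show ?thesis by (simp add: dn_def)
qed

lemma dn_pos: "0 < dn u" and dn_sq: "(dn u)\<^sup>2 = 1 - m * (sn u)\<^sup>2" and sn_cn: "(sn u)\<^sup>2 + (cn u)\<^sup>2 = 1"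
  and dn_le: "dn u \<le> 1"
  by (simp_all add: dn_def sn_def cn_def \<Delta>_pos \<Delta>_sq \<Delta>_le)

lemma sn_derivative: "(sn has_real_derivative cn u * dn u) (at u)"
  unfolding sn_def[abs_def] cn_def by (rule DERIV_chain2[OF DERIV_sin am_derivative])

lemma cn_derivative: "(cn has_real_derivative - (sn u) * dn u) (at u)"
  unfolding cn_def[abs_def] sn_def by (rule DERIV_chain2[OF DERIV_cos am_derivative])

lemma \<Delta>_derivative: "(\<Delta> has_real_derivative - (m * sin x * cos x / \<Delta> x)) (at x)"
proof -
  have "(\<Delta> has_real_derivative (inverse (sqrt (1 - m * (sin x)\<^sup>2)) / 2) * (- (m * (2 * sin x * cos x)))) (at x)"
    unfolding \<Delta>_def[abs_def]
    by (rule DERIV_chain2[OF DERIV_real_sqrt])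
       (use elliptic_radicand_pos[of m x] m0 m1 in \<open>auto intro!: derivative_eq_intros\<close>)
  then show ?thesis by (rule DERIV_cong) (simp add: \<Delta>_def[symmetric] field_simps)
qed

lemma dn_derivative: "(dn has_real_derivative - (m * sn u * cn u)) (at u)"
  unfolding dn_def[abs_def]
  by (rule DERIV_cong[OF DERIV_chain2[OF \<Delta>_derivative am_derivative]])
     (use \<Delta>_pos[of "am u"] in \<open>simp add: dn_def sn_def cn_def\<close>)

definition K :: real where "K = ellK m"
definition E :: real where "E = ellE m"

lemma am_K: "am K = pi / 2" and am_mK: "am (- K) = - (pi / 2)" and am_0: "am 0 = 0"
  using am_ellF[of "pi / 2"] am_ellF[of "- (pi / 2)"] am_ellF[of 0]
  by (simp_all add: K_def ellK_def ellF_odd ellF_0)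

lemma K_pos: "K > 0"
  using ellF_strict_mono[of 0 "pi / 2"] by (simp add: K_def ellK_def ellF_0)

lemma E_pos: "E > 0"
proof -
  have "Einc 0 < Einc (pi / 2)"
    by (rule DERIV_pos_imp_increasing[of 0 "pi / 2"]) (use Einc_derivative \<Delta>_pos in \<open>auto intro!: exI[of _ "\<Delta> _"]\<close>)
  then show ?thesis by (simp add: Einc_0 Einc_pi_half E_def)
qed

lemma K_values: "cn K = 0" "cn (- K) = 0" "sn K = 1" "sn (- K) = - 1" "sn 0 = 0" "cn 0 = 1"
  by (simp_all add: cn_def sn_def am_K am_mK am_0)

lemma am_strict_mono: "u < v \<Longrightarrow> am u < am v"
  by (rule DERIV_pos_imp_increasing[of u v]) (use am_derivative dn_pos in \<open>auto intro!: exI[of _ "dn _"]\<close>)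

lemma sn_nonzero: "u \<in> {- K..K} \<Longrightarrow> u \<noteq> 0 \<Longrightarrow> sn u \<noteq> 0"
proof -
  assume u: "u \<in> {- K..K}" "u \<noteq> 0"
  have "am u \<le> pi / 2"
    using am_strict_mono[of u K] u by (cases "u = K") (auto simp: am_K)
  moreover have "- (pi / 2) \<le> am u"
    using am_strict_mono[of "- K" u] u by (cases "u = - K") (auto simp: am_mK)
  ultimately have *: "- (pi / 2) \<le> am u" "am u \<le> pi / 2" by simp_all
  have "am u < 0 \<or> 0 < am u" using am_strict_mono[of u 0] am_strict_mono[of 0 u] u(2) am_0 by linarith
  then show "sn u \<noteq> 0"
    using * sin_gt_zero[of "am u"] sin_gt_zero[of "- am u"] pi_gt_zero by (auto simp: sn_def)
qed

lemma cn_nonzero: "u \<in> {- K<..<K} \<Longrightarrow> cn u > 0"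
  unfolding cn_def using am_strict_mono[of u K] am_strict_mono[of "- K" u]
  by (intro cos_gt_zero_pi) (auto simp: am_K am_mK)

lemma sn_pos: "0 < u \<Longrightarrow> u \<le> K \<Longrightarrow> sn u > 0"
  unfolding sn_def using am_strict_mono[of 0 u] am_strict_mono[of u K] pi_gt_zero
  by (intro sin_gt_zero) (cases "u = K"; auto simp: am_0 am_K)+

text \<open>\<open>(zs, ys)\<close> is the unit tangent of the reference leaf, in the coordinates given by its
  tangent and normal at the midpoint \<open>u = 0\<close>, and \<open>as\<close> is the calibrating field \<open>zs' / (1 - zs\<^sup>2)\<close>.\<close>

definition zs :: "real \<Rightarrow> real" where "zs u = 1 - 2 * m * (sn u)\<^sup>2"
definition ys :: "real \<Rightarrow> real" where "ys u = 2 * sqrt m * sn u * dn u"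
definition as :: "real \<Rightarrow> real" where "as u = - (cn u / (sn u * dn u))"

lemma sqrt_m: "sqrt m * sqrt m = m" "(sqrt m)\<^sup>2 = m" using m0 by simp_all

lemma zs_ys: "(zs u)\<^sup>2 + (ys u)\<^sup>2 = 1"
proof -
  have "(ys u)\<^sup>2 = 4 * m * (sn u)\<^sup>2 * (1 - m * (sn u)\<^sup>2)"
    by (simp add: ys_def power_mult_distrib dn_sq m0 less_imp_le)
  then show ?thesis by (simp add: zs_def power2_eq_square algebra_simps)
qed

text \<open>Together with \<open>ys_derivative\<close> these are the planar Frenet equations for the
  signed curvature 2 sqrt(m) cn, so \<open>(zs, ys)\<close> is the tangent of the half-fold
  elastica.\<close>

lemma zs_derivative: "(zs has_real_derivative - (2 * sqrt m * cn u * ys u)) (at u)"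
  unfolding zs_def[abs_def] ys_def
  by (rule DERIV_cong, (rule derivative_intros sn_derivative)+) (use sqrt_m in \<open>simp add: algebra_simps\<close>)

lemma ys_derivative: "(ys has_real_derivative 2 * sqrt m * cn u * zs u) (at u)"
proof -
  have "(ys has_real_derivative 2 * sqrt m * (cn u * dn u) * dn u + - (m * sn u * cn u) * (2 * sqrt m * sn u)) (at u)"
    unfolding ys_def[abs_def]
    by (rule DERIV_mult[OF DERIV_cmult[OF sn_derivative] dn_derivative])
  moreover have "2 * sqrt m * (cn u * dn u) * dn u + - (m * sn u * cn u) * (2 * sqrt m * sn u)
     = 2 * sqrt m * cn u * ((dn u)\<^sup>2 - m * (sn u)\<^sup>2)"
    by (simp add: power2_eq_square algebra_simps)
  moreover have "(dn u)\<^sup>2 - m * (sn u)\<^sup>2 = zs u" by (simp add: dn_sq zs_def)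
  ultimately show ?thesis by (simp only:)
qed

text \<open>The Euler-Lagrange equation of the integral of z'^2 / (1 - z^2) under the constraint
  that z has mean zero, written as a Riccati equation for A = z' / (1 - z^2). The summand 1 is half
  the Lagrange multiplier.\<close>

lemma as_derivative:
  assumes "sn u \<noteq> 0"
  shows "(as has_real_derivative 1 + (as u)\<^sup>2 * zs u) (at u)"
proof -
  have dn: "dn u \<noteq> 0" using dn_pos[of u] by simp
  have "(as has_real_derivative
    - ((- (sn u) * dn u * (sn u * dn u) - cn u * (cn u * dn u * dn u + - (m * sn u * cn u) * sn u)) / (sn u * dn u * (sn u * dn u)))) (at u)"
    unfolding as_def[abs_def]
    by (rule DERIV_minus[OF DERIV_divide[OF cn_derivative DERIV_mult[OF sn_derivative dn_derivative]]])
       (use assms dn in simp)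
  moreover have "- ((- (sn u) * dn u * (sn u * dn u) - cn u * (cn u * dn u * dn u + - (m * sn u * cn u) * sn u)) / (sn u * dn u * (sn u * dn u)))
    = 1 + (as u)\<^sup>2 * zs u"
  proof -
    define s c d where "s = (sn u)\<^sup>2" and "c = (cn u)\<^sup>2" and "d = (dn u)\<^sup>2"
    have c: "c = 1 - s" using sn_cn[of u] by (simp add: s_def c_def)
    have d: "d = 1 - m * s" by (simp add: s_def d_def dn_sq)
    have sd: "s * d \<noteq> 0" using assms dn by (simp add: s_def d_def)
    have 1: "- ((- (sn u) * dn u * (sn u * dn u) - cn u * (cn u * dn u * dn u + - (m * sn u * cn u) * sn u)) / (sn u * dn u * (sn u * dn u)))
      = (s * d + c * d - m * s * c) / (s * d)"
      by (simp add: s_def c_def d_def power2_eq_square algebra_simps minus_divide_left)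
    have 2: "(as u)\<^sup>2 * zs u = c * (1 - 2 * m * s) / (s * d)"
      by (simp add: as_def zs_def s_def c_def d_def power_divide power_mult_distrib)
    have 3: "s * d + c * d - m * s * c = s * d + c * (1 - 2 * m * s)"
      unfolding d by (simp add: algebra_simps)
    show ?thesis unfolding 1 2 3 using sd by (simp add: add_divide_distrib)
  qed
  ultimately show ?thesis by simp
qed

text \<open>Since zs' is minus the curvature times \<open>ys\<close> and 1 - zs^2 = ys^2, the field
  \<open>as\<close> is minus the curvature divided by \<open>ys\<close>.\<close>

lemma as_ys: "sn u \<noteq> 0 \<Longrightarrow> as u * ys u = - (2 * sqrt m * cn u)"
  using dn_pos[of u] by (simp add: as_def ys_def field_simps)

text \<open>The equality case of z'^2 / (1 - z^2) >= 2 A z' - A^2 (1 - z^2) at the reference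
  profile: its squared curvature in the form linear in z' that the calibration uses.\<close>

lemma cn_sq_eq:
  assumes "sn u \<noteq> 0"
  shows "4 * m * (cn u)\<^sup>2 = 2 * as u * (- (2 * sqrt m * cn u * ys u)) - (as u)\<^sup>2 * (1 - (zs u)\<^sup>2)"
proof -
  have "2 * as u * (- (2 * sqrt m * cn u * ys u)) = - (2 * (2 * sqrt m * cn u)) * (as u * ys u)"
    by simp
  also have "\<dots> = 2 * (2 * sqrt m * cn u)\<^sup>2"
    unfolding as_ys[OF assms] by (simp add: power2_eq_square)
  finally have "2 * as u * (- (2 * sqrt m * cn u * ys u)) = 2 * (2 * sqrt m * cn u)\<^sup>2" .
  moreover have "(as u)\<^sup>2 * (1 - (zs u)\<^sup>2) = (2 * sqrt m * cn u)\<^sup>2"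
  proof -
    have "1 - (zs u)\<^sup>2 = (ys u)\<^sup>2" using zs_ys[of u] by linarith
    then have "(as u)\<^sup>2 * (1 - (zs u)\<^sup>2) = (as u * ys u)\<^sup>2" by (simp only: power_mult_distrib)
    then show ?thesis unfolding as_ys[OF assms] by simp
  qed
  moreover have "(2 * sqrt m * cn u)\<^sup>2 = 4 * m * (cn u)\<^sup>2" by (simp add: power_mult_distrib sqrt_m)
  ultimately show ?thesis by simp
qed

text \<open>The natural boundary condition of the variational problem; it removes the boundary terms
  at both ends although the end tangents of a competitor are free.\<close>

lemma as_K: "as K = 0" "as (- K) = 0" by (simp_all add: as_def K_values)

lemma as_nonzero: "u \<in> {- K<..<K} \<Longrightarrow> u \<noteq> 0 \<Longrightarrow> as u \<noteq> 0"
  using cn_nonzero[of u] sn_nonzero[of u] dn_pos[of u] by (auto simp: as_def)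

text \<open>\<open>as\<close> has a simple pole at 0 because sn vanishes there to first order with
  derivative 1.\<close>

lemma tendsto_u_as: "((\<lambda>u. u * as u) \<longlongrightarrow> - 1) (at 0)"
proof -
  have "((\<lambda>h. (sn (0 + h) - sn 0) / h) \<longlongrightarrow> cn 0 * dn 0) (at 0)"
    using sn_derivative[of 0] unfolding DERIV_def .
  then have 1: "((\<lambda>u. sn u / u) \<longlongrightarrow> dn 0) (at 0)" by (simp add: K_values)
  have c: "(cn \<longlongrightarrow> 1) (at 0)" "(dn \<longlongrightarrow> dn 0) (at 0)"
    using DERIV_isCont[OF cn_derivative[of 0]] DERIV_isCont[OF dn_derivative[of 0]]
    by (auto simp: isCont_def K_values)
  have d0: "dn 0 = 1" by (simp add: dn_def am_0 \<Delta>_def)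
  have "((\<lambda>u. - (cn u / ((sn u / u) * dn u))) \<longlongrightarrow> - (1 / (dn 0 * dn 0))) (at 0)"
    by (intro tendsto_intros c 1) (simp add: d0)
  then have "((\<lambda>u. - (cn u / ((sn u / u) * dn u))) \<longlongrightarrow> - 1) (at 0)" by (simp add: d0)
  moreover have "\<forall>\<^sub>F u in at 0. - (cn u / ((sn u / u) * dn u)) = u * as u"
    by (auto simp: eventually_at_filter as_def)
  ultimately show ?thesis by (rule Lim_transform_eventually)
qed

lemma \<Delta>_am_dn: "\<Delta> (am u) * dn u = (dn u)\<^sup>2"
  by (simp add: dn_def power2_eq_square)

text \<open>Rests on m cn^2 = dn^2 - (1 - m), with \<open>Einc\<close> composed with
  \<open>am\<close> as primitive of dn^2.\<close>

lemma cn_sq_primitive: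
  "((\<lambda>u. 4 * (Einc (am u) - (1 - m) * u)) has_real_derivative 4 * m * (cn u)\<^sup>2) (at u)"
proof -
  have "((\<lambda>u. 4 * (Einc (am u) - (1 - m) * u)) has_real_derivative 4 * (\<Delta> (am u) * dn u - (1 - m) * 1)) (at u)"
    by (intro DERIV_cmult DERIV_diff DERIV_chain2[OF Einc_derivative am_derivative] DERIV_ident)
  moreover have "4 * (\<Delta> (am u) * dn u - (1 - m) * 1) = 4 * m * (cn u)\<^sup>2"
  proof -
    have s: "(sn u)\<^sup>2 = 1 - (cn u)\<^sup>2" using sn_cn[of u] by linarith
    show ?thesis unfolding \<Delta>_am_dn dn_sq s by (simp add: algebra_simps)
  qed
  ultimately show ?thesis by simp
qed

lemma zs_primitive: "((\<lambda>u. 2 * Einc (am u) - u) has_real_derivative zs u) (at u)"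
proof -
  have "((\<lambda>u. 2 * Einc (am u) - u) has_real_derivative 2 * (\<Delta> (am u) * dn u) - 1) (at u)"
    by (intro DERIV_cmult DERIV_diff DERIV_chain2[OF Einc_derivative am_derivative] DERIV_ident)
  moreover have "2 * (\<Delta> (am u) * dn u) - 1 = zs u"
    unfolding \<Delta>_am_dn by (simp add: dn_sq zs_def)
  ultimately show ?thesis by simp
qed

lemma ys_primitive: "((\<lambda>u. - (2 * sqrt m * cn u)) has_real_derivative ys u) (at u)"
proof -
  have "((\<lambda>u. - (2 * sqrt m * cn u)) has_real_derivative - (2 * sqrt m * (- (sn u) * dn u))) (at u)"
    by (intro DERIV_minus DERIV_cmult cn_derivative)
  then show ?thesis by (simp add: ys_def mult.assoc)
qed

section \<open>Integrals over the parameter interval of one leaf\<close>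

lemma has_integral_of_primitive:
  assumes "\<And>u. (f has_real_derivative g u) (at u)"
  shows "(g has_integral f K - f (- K)) {- K..K}"
  using K_pos assms
  by (intro fundamental_theorem_of_calculus)
     (auto simp: has_real_derivative_iff_has_vector_derivative intro: has_vector_derivative_at_within)

lemma has_integral_cn_sq: "((\<lambda>u. 4 * m * (cn u)\<^sup>2) has_integral 8 * (E - (1 - m) * K)) {- K..K}"
  using has_integral_of_primitive[OF cn_sq_primitive]
  by (simp add: am_K am_mK Einc_odd Einc_pi_half E_def algebra_simps)

text \<open>The displacement of the leaf along its middle tangent; it vanishes exactly when K = 2 E,
  which is what singles out \<open>m_star\<close>.\<close>

lemma has_integral_zs: "(zs has_integral 2 * (2 * E - K)) {- K..K}"
  using has_integral_of_primitive[OF zs_primitive]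
  by (simp add: am_K am_mK Einc_odd Einc_pi_half E_def algebra_simps)

lemma has_integral_ys: "(ys has_integral 0) {- K..K}"
  using has_integral_of_primitive[OF ys_primitive] by (simp add: K_values)

lemma elliptic_continuous:
  "continuous_on S sn" "continuous_on S cn" "continuous_on S dn" "continuous_on S zs" "continuous_on S ys"
  by (intro continuous_at_imp_continuous_on ballI DERIV_isCont,
      (rule sn_derivative cn_derivative dn_derivative zs_derivative ys_derivative))+

lemma K_eq_integral: "ellK m = integral {0..pi / 2} (\<lambda>\<theta>. 1 / \<Delta> \<theta>)"
  and E_eq_integral: "ellE m = integral {0..pi / 2} \<Delta>"
proof -
  have "set_integrable lborel {0..pi / 2} (\<lambda>\<theta>. 1 / \<Delta> \<theta>)"
    by (rule borel_integrable_atLeastAtMost'[of 0 "pi / 2"])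
       (intro continuous_intros continuous_\<Delta>, use \<Delta>_pos in \<open>auto simp: less_imp_neq[symmetric]\<close>)
  then show "ellK m = integral {0..pi / 2} (\<lambda>\<theta>. 1 / \<Delta> \<theta>)"
    using interval_integral_eq_integral[of 0 "pi / 2" "\<lambda>\<theta>. 1 / \<Delta> \<theta>"]
    by (simp add: ellK_def ellF_def \<Delta>_def zero_ereal_def)
  have "set_integrable lborel {0..pi / 2} \<Delta>"
    by (rule borel_integrable_atLeastAtMost'[OF continuous_\<Delta>])
  then show "ellE m = integral {0..pi / 2} \<Delta>"
    using interval_integral_eq_integral[of 0 "pi / 2" \<Delta>]
    by (simp add: ellE_def \<Delta>_def zero_ereal_def)
qed

end

section \<open>The parameter\<close>

text \<open>K - 2 E is treated as a single integral because this integrand increases with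
  \<open>m\<close> at each angle.\<close>

definition gap_integrand :: "real \<Rightarrow> real \<Rightarrow> real" where
  "gap_integrand m \<theta> = 1 / sqrt (1 - m * (sin \<theta>)\<^sup>2) - 2 * sqrt (1 - m * (sin \<theta>)\<^sup>2)"

lemma continuous_gap_integrand:
  "0 \<le> m \<Longrightarrow> m < 1 \<Longrightarrow> continuous_on S (gap_integrand m)"
  unfolding gap_integrand_def[abs_def]
  by (intro continuous_intros) (use elliptic_radicand_pos in \<open>auto simp: less_imp_neq[symmetric]\<close>)

lemma gap_eq_integral:
  assumes "0 < m" "m < 1"
  shows "ellK m - 2 * ellE m = integral {0..pi / 2} (gap_integrand m)"
proof -
  interpret elliptic_parameter m by unfold_locales fact+
  have "(\<lambda>\<theta>. 1 / \<Delta> \<theta>) integrable_on {0..pi / 2}" "(\<lambda>\<theta>. 2 * \<Delta> \<theta>) integrable_on {0..pi / 2}"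
    using \<Delta>_pos by (auto intro!: integrable_continuous_real continuous_intros continuous_\<Delta> simp: less_imp_neq[symmetric])
  then show ?thesis
    unfolding K_eq_integral E_eq_integral gap_integrand_def \<Delta>_def[symmetric]
    by (simp add: integral_diff)
qed

lemma gap_strict_mono:
  assumes "0 < m" "m < m'" "m' < 1"
  shows "ellK m - 2 * ellE m < ellK m' - 2 * ellE m'"
proof -
  have lt: "gap_integrand m \<theta> \<le> gap_integrand m' \<theta>" "sin \<theta> \<noteq> 0 \<Longrightarrow> gap_integrand m \<theta> \<noteq> gap_integrand m' \<theta>" for \<theta>
  proof -
    define a where "a = sqrt (1 - m * (sin \<theta>)\<^sup>2)"
    define b where "b = sqrt (1 - m' * (sin \<theta>)\<^sup>2)"
    have b: "0 < b" using elliptic_radicand_pos[of m' \<theta>] assms by (simp add: b_def)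
    have ba: "b \<le> a" using assms by (simp add: a_def b_def mult_right_mono)
    have "1 / a \<le> 1 / b" using b ba by (intro divide_left_mono) auto
    with ba show "gap_integrand m \<theta> \<le> gap_integrand m' \<theta>"
      by (simp add: gap_integrand_def a_def[symmetric] b_def[symmetric])
    assume "sin \<theta> \<noteq> 0"
    then have "b < a" using assms by (simp add: a_def b_def)
    with \<open>1 / a \<le> 1 / b\<close> show "gap_integrand m \<theta> \<noteq> gap_integrand m' \<theta>"
      by (simp add: gap_integrand_def a_def[symmetric] b_def[symmetric])
  qed
  have c: "continuous_on {0..pi / 2} (\<lambda>\<theta>. gap_integrand m' \<theta> - gap_integrand m \<theta>)"
    using assms by (intro continuous_intros continuous_gap_integrand) auto
  have "integral {0..pi / 2} (\<lambda>\<theta>. gap_integrand m' \<theta> - gap_integrand m \<theta>) \<ge> 0"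
    using lt by (intro integral_nonneg integrable_continuous_real c) auto
  moreover have "integral {0..pi / 2} (\<lambda>\<theta>. gap_integrand m' \<theta> - gap_integrand m \<theta>) \<noteq> 0"
  proof
    assume "integral {0..pi / 2} (\<lambda>\<theta>. gap_integrand m' \<theta> - gap_integrand m \<theta>) = 0"
    then have "\<forall>\<theta>\<in>{0..pi / 2}. gap_integrand m' \<theta> - gap_integrand m \<theta> = 0"
      using integral_eq_0_iff[OF c] lt by auto
    \<comment> \<open>The sine equals 1 at this end point, where the two integrands differ.\<close>
    then have "gap_integrand m (pi / 2) = gap_integrand m' (pi / 2)" by simp
    then show False using lt(2)[of "pi / 2"] by simp
  qed
  moreover have "integral {0..pi / 2} (\<lambda>\<theta>. gap_integrand m' \<theta> - gap_integrand m \<theta>)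
    = (ellK m' - 2 * ellE m') - (ellK m - 2 * ellE m)"
    using assms by (simp add: gap_eq_integral integral_diff integrable_continuous_real continuous_gap_integrand)
  ultimately show ?thesis by linarith
qed

lemma integral_reflect_quarter:
  fixes f :: "real \<Rightarrow> real"
  shows "integral {0..pi / 2} (\<lambda>x. f (pi / 2 - x)) = integral {0..pi / 2} f"
proof -
  have "integral {- (pi / 2)..0} ((\<lambda>x. f (- x)) \<circ> (+) 0) = integral {0..pi / 2} f"
    using Henstock_Kurzweil_Integration.integral_reflect_real[of "pi / 2" 0 f] by (simp add: o_def)
  moreover have "integral {0..pi / 2} ((\<lambda>x. f (- x)) \<circ> (+) (- (pi / 2))) = integral {0 + - (pi / 2)..pi / 2 + - (pi / 2)} (\<lambda>x. f (- x))"
    by (rule integral_shift_Icc_real)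
  ultimately show ?thesis by (simp add: o_def)
qed

text \<open>Pairing \<open>\<theta>\<close> with \<open>\<pi>/2 - \<theta>\<close> gives \<open>(a + b) (1 / (a b) - 2)\<close> with
  \<open>a\<^sup>2 b\<^sup>2 = 1/4 + (3/4)\<^sup>2 sin\<^sup>2 cos\<^sup>2 \<ge> 1/4\<close>.\<close>

lemma gap_three_quarters: "ellK (3/4) - 2 * ellE (3/4) \<le> 0"
proof -
  let ?g = "gap_integrand (3/4)"
  have c: "continuous_on {0..pi / 2} ?g" by (rule continuous_gap_integrand) auto
  have c': "continuous_on {0..pi / 2} (\<lambda>x. ?g (pi / 2 - x))"
    by (rule continuous_on_compose2[OF continuous_gap_integrand[of "3/4" UNIV]]) (auto intro!: continuous_intros)
  have "?g x + ?g (pi / 2 - x) \<le> 0" for x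
  proof -
    define s where "s = (sin x)\<^sup>2"
    have cs: "(cos x)\<^sup>2 = 1 - s" unfolding s_def using sin_cos_squared_add[of x] by linarith
    have s: "0 \<le> s" "s \<le> 1" by (auto simp: s_def abs_square_le_1)
    define a where "a = sqrt (1 - 3/4 * s)"
    define b where "b = sqrt (1 - 3/4 * (1 - s))"
    have ab: "0 < a" "0 < b" using s by (auto simp: a_def b_def)
    have "(1/2)\<^sup>2 \<le> (a * b)\<^sup>2"
    proof -
      have "(a * b)\<^sup>2 = (1 - 3/4 * s) * (1 - 3/4 * (1 - s))"
        using s by (simp add: a_def b_def power_mult_distrib)
      also have "\<dots> = (1/2)\<^sup>2 + 9/16 * (s * (1 - s))" by (simp add: power2_eq_square field_simps)
      finally show ?thesis using s by simp
    qed
    then have "1/2 \<le> a * b" by (rule power2_le_imp_le) (use ab in simp)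
    then have "1 / (a * b) - 2 \<le> 0" using ab by (simp add: field_simps)
    then have "(a + b) * (1 / (a * b) - 2) \<le> 0" using ab by (intro mult_nonneg_nonpos) auto
    moreover have "(a + b) * (1 / (a * b) - 2) = (1 / a - 2 * a) + (1 / b - 2 * b)"
      using ab by (simp add: field_simps)
    moreover have "?g x = 1 / a - 2 * a" "?g (pi / 2 - x) = 1 / b - 2 * b"
      by (simp_all add: gap_integrand_def a_def b_def s_def[symmetric] sin_diff cs)
    ultimately show ?thesis by simp
  qed
  then have "integral {0..pi / 2} (\<lambda>x. ?g x + ?g (pi / 2 - x)) \<le> integral {0..pi / 2} (\<lambda>x. 0)"
    by (intro integral_le integrable_continuous_real continuous_intros c c') auto
  moreover have "integral {0..pi / 2} (\<lambda>x. ?g x + ?g (pi / 2 - x)) = integral {0..pi / 2} ?g + integral {0..pi / 2} ?g"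
    by (subst integral_add) (simp_all add: integrable_continuous_real c c' integral_reflect_quarter)
  ultimately show ?thesis by (simp add: gap_eq_integral)
qed

text \<open>A crude version of the logarithmic blow-up of K as m tends to 1: since E <= pi/2, it is
  enough to find a parameter with K >= pi.\<close>

lemma gap_eventually_nonneg: "\<exists>m. 3/4 \<le> m \<and> m < 1 \<and> 0 \<le> ellK m - 2 * ellE m"
proof -
  \<comment> \<open>Chosen so that e + pi/2 = exp(pi) e. With m = 1 - e^2 the bound
    \<open>\<Delta> x \<le> e + (pi/2 - x)\<close> makes K at least ln((e + pi/2) / e) = pi, and e
    <= 1/2 keeps m at or above 3/4.\<close>
  define e where "e = pi / (2 * (exp pi - 1))"
  have pi: "pi \<le> exp pi - 1" using exp_ge_add_one_self[of pi] by linarith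
  with pi_gt_zero have X: "0 < exp pi - 1" by linarith
  have e: "0 < e" unfolding e_def using pi_gt_zero X by (intro divide_pos_pos) simp_all
  have "e \<le> 1/2" unfolding e_def by (subst pos_divide_le_eq) (use pi X in simp_all)
  then have "e * e \<le> 1/2 * (1/2)" using e by (intro mult_mono) auto
  then have e2: "0 < e\<^sup>2" "e\<^sup>2 \<le> 1/4" using e by (auto simp: power2_eq_square)
  define m where "m = 1 - e\<^sup>2"
  have m: "3/4 \<le> m" "m < 1" "0 < m" using e2 by (auto simp: m_def)
  interpret elliptic_parameter m using m by unfold_locales
  have K: "pi \<le> ellK m"
  proof -
    have "((\<lambda>x. 1 / (e + (pi / 2 - x))) has_integral (- ln (e + (pi / 2 - pi / 2)) - - ln (e + (pi / 2 - 0)))) {0..pi / 2}"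
    proof (rule fundamental_theorem_of_calculus)
      fix x assume "x \<in> {0..pi / 2}"
      then have "((\<lambda>x. - ln (e + (pi / 2 - x))) has_real_derivative 1 / (e + (pi / 2 - x))) (at x)"
        using e by (auto intro!: derivative_eq_intros)
      then show "((\<lambda>x. - ln (e + (pi / 2 - x))) has_vector_derivative 1 / (e + (pi / 2 - x))) (at x within {0..pi / 2})"
        by (simp add: has_real_derivative_iff_has_vector_derivative has_vector_derivative_at_within)
    qed simp
    moreover have "- ln (e + (pi / 2 - pi / 2)) - - ln (e + (pi / 2 - 0)) = pi"
    proof -
      have "e * (2 * (exp pi - 1)) = pi" unfolding e_def using X by simp
      then have "e + pi / 2 = exp pi * e" by (simp add: algebra_simps)
      then have "(e + pi / 2) / e = exp pi" using e by simp
      then have "ln ((e + pi / 2) / e) = pi" by simp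
      then show ?thesis using e pi_gt_zero by (simp add: ln_div)
    qed
    ultimately have I: "((\<lambda>x. 1 / (e + (pi / 2 - x))) has_integral pi) {0..pi / 2}" by simp
    have "pi \<le> integral {0..pi / 2} (\<lambda>\<theta>. 1 / \<Delta> \<theta>)"
    proof (rule has_integral_le[OF I integrable_integral])
      show "(\<lambda>\<theta>. 1 / \<Delta> \<theta>) integrable_on {0..pi / 2}"
        using \<Delta>_pos by (auto intro!: integrable_continuous_real continuous_intros continuous_\<Delta> simp: less_imp_neq[symmetric])
      fix x assume x: "x \<in> {0..pi / 2}"
      have "(\<Delta> x)\<^sup>2 = (cos x)\<^sup>2 + e\<^sup>2 * (sin x)\<^sup>2"
        unfolding \<Delta>_sq unfolding m_def by (simp add: cos_squared_eq algebra_simps)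
      also have "\<dots> \<le> (pi / 2 - x)\<^sup>2 + e\<^sup>2 * 1"
      proof (intro add_mono mult_left_mono)
        have "\<bar>cos x\<bar> \<le> \<bar>pi / 2 - x\<bar>"
          using abs_sin_x_le_abs_x[of "pi / 2 - x"] by (simp add: sin_diff)
        then show "(cos x)\<^sup>2 \<le> (pi / 2 - x)\<^sup>2" by (simp add: abs_le_square_iff)
      qed (auto simp: abs_square_le_1)
      also have "\<dots> \<le> (e + (pi / 2 - x))\<^sup>2" using x e by (simp add: power2_sum)
      finally have "\<Delta> x \<le> e + (pi / 2 - x)" by (rule power2_le_imp_le) (use x e in simp)
      then show "1 / (e + (pi / 2 - x)) \<le> 1 / \<Delta> x" using \<Delta>_pos[of x] by (intro divide_left_mono) auto
    qed
    then show ?thesis by (simp add: K_eq_integral)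
  qed
  have "ellE m \<le> integral {0..pi / 2} (\<lambda>x. 1)"
    unfolding E_eq_integral using \<Delta>_le by (intro integral_le integrable_continuous_real continuous_\<Delta>) auto
  then have "ellE m \<le> pi / 2" by simp
  with K m show ?thesis by (intro exI[of _ m]) auto
qed

lemma continuous_gap:
  assumes "M < 1"
  shows "continuous_on {3/4..M} (\<lambda>m. ellK m - 2 * ellE m)"
proof -
  have "continuous_on {3/4..M} (\<lambda>m. integral (cbox 0 (pi / 2)) (gap_integrand m))"
  proof (rule integral_continuous_on_param)
    show "continuous_on ({3 / 4..M} \<times> cbox 0 (pi / 2)) (\<lambda>(x, y). gap_integrand x y)"
      unfolding gap_integrand_def[abs_def] case_prod_unfold
      by (intro continuous_intros) (use assms elliptic_radicand_pos(1) in \<open>force simp: less_imp_neq[symmetric]\<close>)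
  qed
  then show ?thesis
    by (rule continuous_on_eq) (use assms gap_eq_integral in auto)
qed

text \<open>Existence comes from a sign change of K - 2 E on an interval starting at 3/4, uniqueness
  from strict monotonicity. The lower bound 3/4 matters later for the junction vectors with odd
  \<open>k\<close>.\<close>

lemma m_star: "3/4 \<le> m_star" "m_star < 1" "ellK m_star = 2 * ellE m_star"
proof -
  obtain M where M: "3/4 \<le> M" "M < 1" "0 \<le> ellK M - 2 * ellE M" using gap_eventually_nonneg by blast
  have "\<exists>m\<ge>3/4. m \<le> M \<and> ellK m - 2 * ellE m = 0"
    by (rule IVT'[OF gap_three_quarters M(3,1) continuous_gap[OF M(2)]])
  then obtain m where m: "3/4 \<le> m" "m \<le> M" "ellK m = 2 * ellE m" by auto
  have "m_star = m"
    unfolding m_star_def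
  proof (rule the_equality)
    show "0 < m \<and> m < 1 \<and> ellK m = 2 * ellE m" using m M by auto
    fix m' assume m': "0 < m' \<and> m' < 1 \<and> ellK m' = 2 * ellE m'"
    show "m' = m"
      using gap_strict_mono[of m m'] gap_strict_mono[of m' m] m m' M(2) by (cases m m' rule: linorder_cases) auto
  qed
  with m M show "3/4 \<le> m_star" "m_star < 1" "ellK m_star = 2 * ellE m_star" by auto
qed

section \<open>The sharp inequality for one leaf\<close>

interpretation M: elliptic_parameter m_star
  using m_star by unfold_locales auto

lemma K_eq_2E: "M.K = 2 * M.E"
  using m_star by (simp add: M.K_def M.E_def)

text \<open>The product of the length 2 K of the reference leaf and its bending energy, the integral
  of 4 m cn^2 over the interval from -K to K.\<close>

lemma varpi_star_eq: "varpi_star = 2 * M.K * (8 * (M.E - (1 - m_star) * M.K))"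
  unfolding varpi_star_def K_eq_2E by (simp add: M.E_def[symmetric] power2_eq_square algebra_simps)

lemma varpi_star_pos: "varpi_star > 0"
  using m_star M.E_pos by (simp add: varpi_star_def M.E_def)

text \<open>The Hoelder-1/2 estimate for the tangent in terms of arclength. Its purpose is the
  behaviour at the midpoint: the energy of short arcs tends to zero, which supplies the little-o
  there.\<close>

lemma frame_tangent_increment:
  assumes f: "frame a b \<gamma> r T \<tau>" and uv: "a \<le> u" "u < v" "v \<le> b"
  shows "(norm (T v - T u))\<^sup>2 \<le> integral {u..v} r * (integral {u..v} (\<lambda>x. (norm (\<tau> x))\<^sup>2 / r x) + integral {u..v} r)"
proof -
  note f' = frame_subinterval[OF f uv]
  define S where "S = integral {u..v} r"
  define P where "P = integral {u..v} (\<lambda>x. (norm (\<tau> x))\<^sup>2 / r x)"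
  have S: "S > 0" unfolding S_def by (rule frame_curve_length_pos[OF f'])
  have ri: "r integrable_on {u..v}" and Pi: "(\<lambda>x. (norm (\<tau> x))\<^sup>2 / r x) integrable_on {u..v}"
    using set_lebesgue_integral_eq_integral(1)[OF frame_integrable_r[OF f']]
      set_lebesgue_integral_eq_integral(1)[OF frame_integrable_energy[OF f']] by auto
  have P: "P \<ge> 0" unfolding P_def
    by (rule integral_nonneg[OF Pi]) (use frameD(3)[OF f'] in \<open>auto intro!: divide_nonneg_pos\<close>)
  \<comment> \<open>Cauchy-Schwarz is obtained by integrating a pointwise weighted
    arithmetic-geometric inequality with the optimal weight. Adding \<open>S\<close> to the energy
    keeps the weight positive even when \<open>P\<close> is zero.\<close>
  define l where "l = sqrt ((P + S) / S)"
  have l: "l > 0" "l\<^sup>2 * S = P + S" using S P by (auto simp: l_def)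
  have "norm (T v - T u) = norm (integral {u..v} \<tau>)"
    using AC_integral[OF frameD(6)[OF f], of u v] uv by simp
  also have "\<dots> \<le> integral {u..v} (\<lambda>x. (l / 2) * r x + (1 / (2 * l)) * ((norm (\<tau> x))\<^sup>2 / r x))"
  proof (rule integral_norm_bound_integral)
    show "\<tau> integrable_on {u..v}" using AC_integrable_on[OF frameD(6)[OF f']] by simp
    show "(\<lambda>x. (l / 2) * r x + (1 / (2 * l)) * ((norm (\<tau> x))\<^sup>2 / r x)) integrable_on {u..v}"
      by (intro integrable_add integrable_on_mult_right ri Pi)
    fix x assume "x \<in> {u..v}"
    then have r: "r x > 0" by (rule frameD(3)[OF f'])
    have "0 \<le> (l * r x - norm (\<tau> x))\<^sup>2 / (2 * l * r x)" using l r by simp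
    also have "\<dots> = (l / 2) * r x + (1 / (2 * l)) * ((norm (\<tau> x))\<^sup>2 / r x) - norm (\<tau> x)"
      using l(1) r by (simp add: power2_eq_square field_simps)
    finally show "norm (\<tau> x) \<le> (l / 2) * r x + (1 / (2 * l)) * ((norm (\<tau> x))\<^sup>2 / r x)" by simp
  qed
  also have "\<dots> = (l / 2) * S + (1 / (2 * l)) * P"
    unfolding S_def P_def
    by (simp only: integral_add[OF integrable_on_mult_right[OF ri] integrable_on_mult_right[OF Pi]] integral_mult_right)
  also have "\<dots> \<le> (l / 2) * S + (1 / (2 * l)) * (P + S)"
    using l S by (intro add_left_mono mult_left_mono) auto
  also have "\<dots> = l * S"
    unfolding l(2)[symmetric] using l(1) by (simp add: power2_eq_square field_simps)
  finally have "(norm (T v - T u))\<^sup>2 \<le> (l * S)\<^sup>2" by (rule power_mono) simp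
  also have "\<dots> = S * (l\<^sup>2 * S)" by (simp add: power2_eq_square algebra_simps)
  also have "\<dots> = S * (P + S)" by (simp only: l(2))
  finally show ?thesis unfolding S_def P_def .
qed

section \<open>Comparison of a framed curve with the reference leaf of the same length\<close>

locale framed_curve =
  fixes a b :: real and \<gamma> :: "real \<Rightarrow> 'a::euclidean_space" and r T \<tau>
  assumes frame: "frame a b \<gamma> r T \<tau>"
begin

lemmas ab = frameD(1)[OF frame] and cont_r = frameD(2)[OF frame] and r_pos = frameD(3)[OF frame]
  and norm_T = frameD(4)[OF frame] and AC_T = frameD(6)[OF frame] and cont_T = frameD(8)[OF frame]

definition L where "L = integral {a..b} r"
definition \<Lambda> where "\<Lambda> = 2 * M.K / L"
text \<open>Arclength rescaled affinely onto the parameter interval of the reference leaf, so that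
  \<open>zs\<close> and \<open>as\<close> at \<open>\<sigma> x\<close> are the leaf's values at the
  corresponding point.\<close>

definition \<sigma> where "\<sigma> x = \<Lambda> * integral {a..x} r - M.K"

lemma L_pos: "L > 0" unfolding L_def by (rule frame_curve_length_pos[OF frame])
lemma \<Lambda>_pos: "\<Lambda> > 0" using L_pos M.K_pos by (simp add: \<Lambda>_def)

lemma \<sigma>_ends: "\<sigma> a = - M.K" "\<sigma> b = M.K"
  using L_pos by (simp_all add: \<sigma>_def \<Lambda>_def L_def[symmetric])

lemma \<sigma>_derivative: "x \<in> {a..b} \<Longrightarrow> (\<sigma> has_real_derivative \<Lambda> * r x) (at x within {a..b})"
  unfolding \<sigma>_def[abs_def]
  by (rule DERIV_cong[OF DERIV_diff[OF DERIV_cmult[OF integral_has_real_derivative[OF cont_r]] DERIV_const]]) auto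

lemma cont_\<sigma>: "continuous_on {a..b} \<sigma>"
  unfolding continuous_on_eq_continuous_within by (intro ballI DERIV_continuous[OF \<sigma>_derivative])

lemma \<sigma>_diff:
  assumes "a \<le> u" "u \<le> v" "v \<le> b"
  shows "\<sigma> v - \<sigma> u = \<Lambda> * integral {u..v} r"
proof -
  have "integral {a..u} r + integral {u..v} r = integral {a..v} r"
    using assms by (intro Henstock_Kurzweil_Integration.integral_combine integrable_continuous_real
      continuous_on_subset[OF cont_r]) auto
  then have "integral {u..v} r = integral {a..v} r - integral {a..u} r" by linarith
  then show ?thesis by (simp add: \<sigma>_def right_diff_distrib)
qed

lemma \<sigma>_less:
  assumes "a \<le> u" "u < v" "v \<le> b"
  shows "\<sigma> u < \<sigma> v"
proof -
  have "integral {u..v} r > 0"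
    using frame_curve_length_pos[OF frame_subinterval[OF frame]] assms by simp
  then have "\<sigma> v - \<sigma> u > 0" using \<sigma>_diff[of u v] assms \<Lambda>_pos by simp
  then show ?thesis by simp
qed

lemma \<sigma>_range: "x \<in> {a..b} \<Longrightarrow> \<sigma> x \<in> {- M.K..M.K}"
  using \<sigma>_less[of a x] \<sigma>_less[of x b] \<sigma>_ends by (cases "x = a"; cases "x = b") auto

text \<open>The midpoint in arclength. It exists by the intermediate value theorem and is unique
  since \<open>\<sigma>\<close> is strictly increasing.\<close>

definition c where "c = (SOME c. c \<in> {a..b} \<and> \<sigma> c = 0)"

lemma c_eq: "\<sigma> c = 0" and c_in: "c \<in> {a<..<b}"
proof -
  have "\<exists>c\<ge>a. c \<le> b \<and> \<sigma> c = 0"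
    using \<sigma>_ends M.K_pos ab cont_\<sigma> by (intro IVT') auto
  then have "\<exists>c. c \<in> {a..b} \<and> \<sigma> c = 0" by auto
  then have c: "c \<in> {a..b} \<and> \<sigma> c = 0" unfolding c_def by (rule someI_ex)
  then show "\<sigma> c = 0" by simp
  have "c \<noteq> a" "c \<noteq> b" using c \<sigma>_ends M.K_pos by auto
  then show "c \<in> {a<..<b}" using c by auto
qed

lemma \<sigma>_nonzero: "x \<in> {a..b} \<Longrightarrow> x \<noteq> c \<Longrightarrow> \<sigma> x \<noteq> 0"
  using \<sigma>_less[of x c] \<sigma>_less[of c x] c_eq c_in by (cases x c rule: linorder_cases) auto

lemma sn_nonzero: "x \<in> {a..b} \<Longrightarrow> x \<noteq> c \<Longrightarrow> M.sn (\<sigma> x) \<noteq> 0"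
  by (intro M.sn_nonzero \<sigma>_range \<sigma>_nonzero)

lemma integral_substitution:
  assumes "continuous_on UNIV F"
  shows "integral {a..b} (\<lambda>x. r x * F (\<sigma> x)) = integral {- M.K..M.K} F / \<Lambda>"
proof -
  have "((\<lambda>x. (\<Lambda> * r x) *\<^sub>R F (\<sigma> x)) has_integral integral {\<sigma> a..\<sigma> b} F) {a..b}"
    using ab \<sigma>_range \<sigma>_ends M.K_pos
    by (intro has_integral_substitution[where c = "- M.K" and d = M.K] continuous_on_subset[OF assms] \<sigma>_derivative) auto
  from integral_unique[OF this]
  have "\<Lambda> * integral {a..b} (\<lambda>x. r x * F (\<sigma> x)) = integral {- M.K..M.K} F"
    by (simp add: \<sigma>_ends mult.assoc)
  then show ?thesis using \<Lambda>_pos by (simp add: field_simps)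
qed

lemma integral_zs: "integral {a..b} (\<lambda>x. r x * M.zs (\<sigma> x)) = 0"
  using integral_substitution[OF M.elliptic_continuous(4)] integral_unique[OF M.has_integral_zs]
  by (simp add: K_eq_2E)

lemma integral_ys: "integral {a..b} (\<lambda>x. r x * M.ys (\<sigma> x)) = 0"
  using integral_substitution[OF M.elliptic_continuous(5)] integral_unique[OF M.has_integral_ys] by simp

text \<open>The bending energy density, with respect to \<open>x\<close>, of the reference leaf
  scaled to the length of the given curve.\<close>

definition k2 where "k2 x = \<Lambda>\<^sup>2 * (r x * (4 * m_star * (M.cn (\<sigma> x))\<^sup>2))"

lemma cont_comp: "continuous_on UNIV F \<Longrightarrow> continuous_on {a..b} (\<lambda>x. F (\<sigma> x))"
  by (rule continuous_on_compose2[OF _ cont_\<sigma>]) auto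

lemma cont_k2: "continuous_on {a..b} k2"
  unfolding k2_def[abs_def] by (intro continuous_intros cont_r cont_comp M.elliptic_continuous)

lemma integral_k2: "integral {a..b} k2 = varpi_star / L"
proof -
  have "continuous_on UNIV (\<lambda>u. 4 * m_star * (M.cn u)\<^sup>2)" by (intro continuous_intros M.elliptic_continuous)
  from integral_substitution[OF this]
  have "integral {a..b} (\<lambda>x. r x * (4 * m_star * (M.cn (\<sigma> x))\<^sup>2)) = 8 * (M.E - (1 - m_star) * M.K) / \<Lambda>"
    by (simp only: integral_unique[OF M.has_integral_cn_sq])
  then have "integral {a..b} k2 = \<Lambda>\<^sup>2 * (8 * (M.E - (1 - m_star) * M.K) / \<Lambda>)"
    unfolding k2_def[abs_def] by (simp only: integral_mult_right)
  also have "\<dots> = \<Lambda> * (8 * (M.E - (1 - m_star) * M.K))" using \<Lambda>_pos by (simp add: power2_eq_square)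
  also have "\<dots> = varpi_star / L" by (simp add: varpi_star_eq \<Lambda>_def)
  finally show ?thesis .
qed

end

text \<open>For a curve closing up after one leaf, the field \<open>\<Lambda> as (\<sigma> x)\<close> calibrates the elastic energy: up to the
  derivative of \<open>as (\<sigma> x) w x\<close> and a multiple of \<open>w r\<close>, which integrates to zero because the tangent
  has mean zero, the energy density exceeds that of the reference leaf by the nonnegative \<open>N\<close>.\<close>

locale leaf = framed_curve +
  assumes closed: "\<gamma> a = \<gamma> b"
begin

definition e where "e = T c"
definition z where "z x = T x \<bullet> e"
definition w where "w x = z x - M.zs (\<sigma> x)"

lemma norm_e: "norm e = 1" unfolding e_def using norm_T c_in by auto

lemma AC_z: "AC a b z (\<lambda>x. \<tau> x \<bullet> e)"
  unfolding z_def by (rule AC_linear[OF AC_T bounded_linear_inner_left])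

lemma AC_comp:
  assumes F: "\<And>x. x \<in> {u..v} \<Longrightarrow> (F has_real_derivative F' (\<sigma> x)) (at (\<sigma> x))"
    and c: "continuous_on {u..v} (\<lambda>x. F' (\<sigma> x))" and uv: "a \<le> u" "v \<le> b"
  shows "AC u v (\<lambda>x. F (\<sigma> x)) (\<lambda>x. F' (\<sigma> x) * (\<Lambda> * r x))"
proof (rule AC_of_deriv)
  have s: "{u..v} \<subseteq> {a..b}" using uv by auto
  show "continuous_on {u..v} (\<lambda>x. F' (\<sigma> x) * (\<Lambda> * r x))"
    by (intro continuous_intros c continuous_on_subset[OF cont_r s])
  fix x assume x: "x \<in> {u..v}"
  then have x': "x \<in> {a..b}" using s by auto
  have "((\<lambda>x. F (\<sigma> x)) has_real_derivative F' (\<sigma> x) * (\<Lambda> * r x)) (at x within {u..v})"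
    by (rule DERIV_chain2[OF F[OF x] DERIV_subset[OF \<sigma>_derivative[OF x'] s]])
  then show "((\<lambda>x. F (\<sigma> x)) has_vector_derivative F' (\<sigma> x) * (\<Lambda> * r x)) (at x within {u..v})"
    by (simp add: has_real_derivative_iff_has_vector_derivative)
qed

abbreviation \<kappa> where "\<kappa> x \<equiv> 2 * sqrt m_star * M.cn (\<sigma> x)"

lemma AC_zs: "AC a b (\<lambda>x. M.zs (\<sigma> x)) (\<lambda>x. - (\<kappa> x * M.ys (\<sigma> x)) * (\<Lambda> * r x))"
  by (rule AC_comp[OF M.zs_derivative]) (auto intro!: continuous_intros cont_comp M.elliptic_continuous)

lemma AC_ys: "AC a b (\<lambda>x. M.ys (\<sigma> x)) (\<lambda>x. (\<kappa> x * M.zs (\<sigma> x)) * (\<Lambda> * r x))"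
  by (rule AC_comp[OF M.ys_derivative]) (auto intro!: continuous_intros cont_comp M.elliptic_continuous)

lemma AC_w: "AC a b w (\<lambda>x. \<tau> x \<bullet> e - - (\<kappa> x * M.ys (\<sigma> x)) * (\<Lambda> * r x))"
  unfolding w_def by (rule AC_diff[OF AC_z AC_zs])

lemma cont_w: "continuous_on {a..b} w" by (rule AC_continuous[OF AC_w])

text \<open>The excess of energy density over the reference leaf, plus a multiplier term that
  integrates to zero for a closed arc. The factor \<open>2 * \<Lambda>\<^sup>2\<close> is the
  Lagrange multiplier after rescaling to length \<open>L\<close>.\<close>

definition g where "g x = (norm (\<tau> x))\<^sup>2 / r x - k2 x + 2 * \<Lambda>\<^sup>2 * (w x * r x)"

lemma g_integrable: "g absolutely_integrable_on {a..b}"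
  unfolding g_def
  by (intro set_integral_add(1) set_integral_diff(1) frame_integrable_energy[OF frame]
      absolutely_integrable_continuous_real continuous_intros cont_k2 cont_w cont_r)

lemma integral_w: "integral {a..b} (\<lambda>x. w x * r x) = 0"
proof -
  have i: "(\<lambda>x. r x *\<^sub>R T x) integrable_on {a..b}"
    by (intro integrable_continuous_real continuous_intros cont_r cont_T)
  have "integral {a..b} (\<lambda>x. r x *\<^sub>R T x) = 0"
    using AC_integral[OF frameD(5)[OF frame], of a b] ab closed by simp
  then have "integral {a..b} (\<lambda>x. (r x *\<^sub>R T x) \<bullet> e) = 0"
    using integral_linear[OF i bounded_linear_inner_left[of e]] by (simp add: o_def)
  moreover have "integral {a..b} (\<lambda>x. w x * r x) = integral {a..b} (\<lambda>x. (r x *\<^sub>R T x) \<bullet> e - r x * M.zs (\<sigma> x))"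
    by (rule integral_cong) (simp add: w_def z_def algebra_simps)
  moreover have "\<dots> = integral {a..b} (\<lambda>x. (r x *\<^sub>R T x) \<bullet> e) - integral {a..b} (\<lambda>x. r x * M.zs (\<sigma> x))"
    by (rule integral_diff)
       (intro integrable_continuous_real continuous_intros cont_r cont_T cont_comp M.elliptic_continuous)+
  ultimately show ?thesis by (simp add: integral_zs)
qed

lemma integral_g: "integral {a..b} g = bending_energy a b \<gamma> - varpi_star / L"
proof -
  have i1: "(\<lambda>x. (norm (\<tau> x))\<^sup>2 / r x) integrable_on {a..b}"
    by (rule set_lebesgue_integral_eq_integral(1)[OF frame_integrable_energy[OF frame]])
  have i2: "k2 integrable_on {a..b}" by (rule integrable_continuous_real[OF cont_k2])
  have i3: "(\<lambda>x. w x * r x) integrable_on {a..b}"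
    by (intro integrable_continuous_real continuous_intros cont_w cont_r)
  have "integral {a..b} g = integral {a..b} (\<lambda>x. (norm (\<tau> x))\<^sup>2 / r x - k2 x) + integral {a..b} (\<lambda>x. 2 * \<Lambda>\<^sup>2 * (w x * r x))"
    unfolding g_def[abs_def] by (intro integral_add integrable_diff integrable_on_mult_right i1 i2 i3)
  also have "integral {a..b} (\<lambda>x. 2 * \<Lambda>\<^sup>2 * (w x * r x)) = 0"
    by (simp only: integral_mult_right integral_w mult_zero_right)
  also have "integral {a..b} (\<lambda>x. (norm (\<tau> x))\<^sup>2 / r x - k2 x) = bending_energy a b \<gamma> - varpi_star / L"
    by (simp only: integral_diff[OF i1 i2] frame_bending_energy[OF frame] integral_k2)
  finally show ?thesis by simp
qed

text \<open>The first summand vanishes when the tangent moves along a great circle through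
  \<open>e\<close> with the speed prescribed by the field, the second when the profile is that of
  the leaf. At \<open>c\<close> the field takes the default value 0 of division by zero, at a single
  point.\<close>

definition N where "N x = (norm (\<tau> x - (\<Lambda> * M.as (\<sigma> x) * r x) *\<^sub>R (e - z x *\<^sub>R T x)))\<^sup>2 / r x
  + \<Lambda>\<^sup>2 * (M.as (\<sigma> x))\<^sup>2 * (w x)\<^sup>2 * r x"

lemma N_nonneg: "x \<in> {a..b} \<Longrightarrow> 0 \<le> N x"
  unfolding N_def using r_pos[of x] by (intro add_nonneg_nonneg) auto

text \<open>Expanding the square with \<open>T\<close> orthogonal to \<open>\<tau>\<close> leaves
  the factor 1 - z^2; adding (z - z_0)^2 cancels the quadratic term in z. What remains is linear in
  z and its derivative, and is the derivative of A (z - z_0) up to the multiplier term.\<close>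

lemma calibration_identity:
  assumes x: "x \<in> {a..b}" "x \<noteq> c" and orth: "T x \<bullet> \<tau> x = 0"
  shows "g x = N x + 2 * \<Lambda> * (M.as (\<sigma> x) * (\<tau> x \<bullet> e - - (\<kappa> x * M.ys (\<sigma> x)) * (\<Lambda> * r x))
    + (1 + (M.as (\<sigma> x))\<^sup>2 * M.zs (\<sigma> x)) * (\<Lambda> * r x) * w x)"
proof -
  define A Z Y R W where "A = M.as (\<sigma> x)" and "Z = M.zs (\<sigma> x)" and "Y = \<kappa> x * M.ys (\<sigma> x)" and "R = r x" and "W = z x"
  have R: "R > 0" using r_pos[OF x(1)] by (simp add: R_def)
  have TT: "T x \<bullet> T x = 1" "e \<bullet> e = 1" using norm_T[OF x(1)] norm_e by (simp_all add: norm_eq_1)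
  have W: "T x \<bullet> e = W" "e \<bullet> T x = W" by (simp_all add: W_def z_def inner_commute)
  have 1: "(norm (\<tau> x - (\<Lambda> * A * R) *\<^sub>R (e - W *\<^sub>R T x)))\<^sup>2
    = (norm (\<tau> x))\<^sup>2 - 2 * (\<Lambda> * A * R) * (\<tau> x \<bullet> e) + (\<Lambda> * A * R)\<^sup>2 * (1 - W\<^sup>2)"
  proof -
    have i: "\<tau> x \<bullet> (e - W *\<^sub>R T x) = \<tau> x \<bullet> e"
      using orth by (simp add: inner_diff_right inner_commute)
    have n: "(e - W *\<^sub>R T x) \<bullet> (e - W *\<^sub>R T x) = 1 - W\<^sup>2"
      using TT W by (simp add: inner_diff_left inner_diff_right power2_eq_square algebra_simps)
    have sq: "(norm (\<tau> x - q *\<^sub>R y))\<^sup>2 = (norm (\<tau> x))\<^sup>2 - 2 * q * (\<tau> x \<bullet> y) + q\<^sup>2 * (y \<bullet> y)" for q and y :: 'a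
      unfolding power2_norm_eq_inner
      by (simp add: inner_diff_left inner_diff_right inner_commute power2_eq_square algebra_simps)
    show ?thesis by (simp only: sq i n)
  qed
  have 2: "k2 x = \<Lambda>\<^sup>2 * R * (2 * A * (- Y) - A\<^sup>2 * (1 - Z\<^sup>2))"
    unfolding k2_def M.cn_sq_eq[OF sn_nonzero[OF x]] A_def Z_def Y_def R_def by simp
  have 3: "(norm (\<tau> x - (\<Lambda> * A * R) *\<^sub>R (e - W *\<^sub>R T x)))\<^sup>2 / R
    = (norm (\<tau> x))\<^sup>2 / R - 2 * (\<Lambda> * A) * (\<tau> x \<bullet> e) + (\<Lambda> * A)\<^sup>2 * R * (1 - W\<^sup>2)"
    unfolding 1 using R by (simp add: field_simps power2_eq_square)
  show ?thesis
    unfolding g_def N_def 2 w_def A_def[symmetric] Z_def[symmetric] Y_def[symmetric] R_def[symmetric] W_def[symmetric] 3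
    by (simp add: power2_eq_square algebra_simps)
qed

text \<open>Away from the midpoint the field has no singularity, so the total derivative integrates
  to honest boundary terms.\<close>

lemma integral_g_half:
  assumes pq: "a \<le> p" "p < q" "q \<le> b" and c: "c \<notin> {p..q}"
  shows "N integrable_on {p..q}"
    "integral {p..q} g = integral {p..q} N + 2 * \<Lambda> * (M.as (\<sigma> q) * w q - M.as (\<sigma> p) * w p)"
proof -
  have s: "{p..q} \<subseteq> {a..b}" using pq by auto
  have sn0: "M.sn (\<sigma> x) \<noteq> 0" if "x \<in> {p..q}" for x
    by (rule sn_nonzero) (use that s c in auto)
  have c1: "continuous_on {p..q} (\<lambda>x. M.as (\<sigma> x))"
  proof -
    have "continuous_on (\<sigma> ` {p..q}) M.as"
      using sn0 by (intro continuous_at_imp_continuous_on) (auto intro: DERIV_isCont[OF M.as_derivative])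
    then show ?thesis by (rule continuous_on_compose2[OF _ continuous_on_subset[OF cont_\<sigma> s]]) auto
  qed
  have c2: "continuous_on {p..q} (\<lambda>x. M.zs (\<sigma> x))"
    by (rule continuous_on_subset[OF cont_comp[OF M.elliptic_continuous(4)] s])
  have "continuous_on {p..q} (\<lambda>x. 1 + (M.as (\<sigma> x))\<^sup>2 * M.zs (\<sigma> x))"
    by (intro continuous_intros c1 c2)
  then have A: "AC p q (\<lambda>x. M.as (\<sigma> x)) (\<lambda>x. (1 + (M.as (\<sigma> x))\<^sup>2 * M.zs (\<sigma> x)) * (\<Lambda> * r x))"
    by (intro AC_comp[of p q M.as "\<lambda>u. 1 + (M.as u)\<^sup>2 * M.zs u"] M.as_derivative sn0) (use pq in auto)
  define D where "D x = M.as (\<sigma> x) * (\<tau> x \<bullet> e - - (\<kappa> x * M.ys (\<sigma> x)) * (\<Lambda> * r x))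
    + (1 + (M.as (\<sigma> x))\<^sup>2 * M.zs (\<sigma> x)) * (\<Lambda> * r x) * w x" for x
  have D: "AC p q (\<lambda>x. M.as (\<sigma> x) * w x) D"
    unfolding D_def by (rule AC_bilinear[OF bounded_bilinear_mult A AC_subinterval[OF AC_w pq(1,3)]])
  have gi: "g integrable_on {p..q}"
    using absolutely_integrable_subinterval[OF g_integrable pq(1,3)] set_lebesgue_integral_eq_integral(1) by blast
  have Di: "(\<lambda>x. 2 * \<Lambda> * D x) integrable_on {p..q}"
    by (intro integrable_on_mult_right AC_integrable_on[OF D]) auto
  define Z where "Z = {x. \<not> (x \<in> {a..b} \<longrightarrow> T x \<bullet> \<tau> x = 0)}"
  have Z: "negligible Z"
    unfolding Z_def using frame_orthogonal[OF frame] by (simp only: AE_lebesgue_negligible)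
  have eq: "N x = g x - 2 * \<Lambda> * D x" if "x \<in> {p..q} - Z" for x
  proof -
    have "x \<in> {a..b}" "x \<noteq> c" "T x \<bullet> \<tau> x = 0" using that s c by (auto simp: Z_def)
    from calibration_identity[OF this] show ?thesis by (simp add: D_def)
  qed
  show Ni: "N integrable_on {p..q}"
    by (rule integrable_spike[OF integrable_diff[OF gi Di] Z]) (use eq in auto)
  have "integral {p..q} N = integral {p..q} (\<lambda>x. g x - 2 * \<Lambda> * D x)"
    by (rule integral_spike[OF Z]) (use eq in auto)
  also have "\<dots> = integral {p..q} g - 2 * \<Lambda> * integral {p..q} D"
    by (simp only: integral_diff[OF gi Di] integral_mult_right)
  finally show "integral {p..q} g = integral {p..q} N + 2 * \<Lambda> * (M.as (\<sigma> q) * w q - M.as (\<sigma> p) * w p)"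
    using AC_integral[OF D, of p q] pq by simp
qed

text \<open>The field has a simple pole in \<open>\<sigma>\<close>, so the claim is that both z - 1
  and z_0 - 1 are small compared with \<open>\<sigma>\<close>. For the reference profile this is
  zs'(0) = 0. For the curve, 1 - z is half of |T - e|^2, hence at most \<open>\<sigma>\<close> times
  a quantity tending to zero.\<close>

lemma tendsto_boundary: "((\<lambda>x. M.as (\<sigma> x) * w x) \<longlongrightarrow> 0) (at c)"
proof -
  have atc: "at c within {a..b} = at c" using c_in by (intro at_within_interior) auto
  have near: "\<forall>\<^sub>F x in at c. x \<in> {a<..<b} \<and> x \<noteq> c"
    using c_in by (auto simp: eventually_at_filter intro!: eventually_mono[OF eventually_nhds_in_open[of "{a<..<b}"]])
  have \<sigma>0: "(\<sigma> \<longlongrightarrow> 0) (at c)"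
    using cont_\<sigma> c_in c_eq atc by (auto simp: continuous_on_def dest!: bspec[of _ _ c])
  have \<sigma>: "filterlim \<sigma> (at 0) (at c)"
    unfolding filterlim_at
  proof
    show "\<forall>\<^sub>F x in at c. \<sigma> x \<in> UNIV \<and> \<sigma> x \<noteq> 0"
      using near
    proof eventually_elim
      case (elim x)
      then show ?case using \<sigma>_nonzero[of x] by auto
    qed
  qed (rule \<sigma>0)
  have 1: "((\<lambda>x. \<sigma> x * M.as (\<sigma> x)) \<longlongrightarrow> - 1) (at c)"
    by (rule filterlim_compose[OF M.tendsto_u_as \<sigma>])
  have "((\<lambda>h. (M.zs (0 + h) - M.zs 0) / h) \<longlongrightarrow> 0) (at 0)"
    using M.zs_derivative[of 0] unfolding DERIV_def by (simp add: M.ys_def M.K_values)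
  from filterlim_compose[OF this \<sigma>]
  have 2: "((\<lambda>x. (M.zs (\<sigma> x) - 1) / \<sigma> x) \<longlongrightarrow> 0) (at c)" by (simp add: M.zs_def M.K_values)
  \<comment> \<open>The sum of energy and length densities that occurs in the tangent estimate;
    continuity of its primitive \<open>G\<close> at \<open>c\<close> yields the factor tending to
    zero.\<close>
  define q where "q x = (norm (\<tau> x))\<^sup>2 / r x + r x" for x
  define G where "G x = integral {a..x} q" for x
  have qi: "q absolutely_integrable_on {a..b}"
    unfolding q_def by (intro set_integral_add(1) frame_integrable_energy[OF frame] frame_integrable_r[OF frame])
  then have G: "AC a b G q" by (simp add: AC_def G_def)
  have G0: "((\<lambda>x. (1 / (2 * \<Lambda>)) * \<bar>G x - G c\<bar>) \<longlongrightarrow> (1 / (2 * \<Lambda>)) * \<bar>G c - G c\<bar>) (at c)"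
    using AC_continuous[OF G] c_in atc
    by (intro tendsto_intros) (auto simp: continuous_on_def dest!: bspec[of _ _ c])
  have bound: "(norm (T v - T u))\<^sup>2 \<le> (\<bar>\<sigma> v - \<sigma> u\<bar> / \<Lambda>) * \<bar>G v - G u\<bar>" if uv: "a \<le> u" "u < v" "v \<le> b" for u v
  proof -
    have i: "(\<lambda>x. (norm (\<tau> x))\<^sup>2 / r x) integrable_on {u..v}" "r integrable_on {u..v}"
      using set_lebesgue_integral_eq_integral(1)[OF frame_integrable_energy[OF frame_subinterval[OF frame uv]]]
        set_lebesgue_integral_eq_integral(1)[OF frame_integrable_r[OF frame_subinterval[OF frame uv]]] by auto
    have "G v - G u = integral {u..v} q" using AC_integral[OF G, of u v] uv by simp
    also have "\<dots> = integral {u..v} (\<lambda>x. (norm (\<tau> x))\<^sup>2 / r x) + integral {u..v} r"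
      unfolding q_def by (rule integral_add[OF i])
    finally have "(norm (T v - T u))\<^sup>2 \<le> integral {u..v} r * (G v - G u)"
      using frame_tangent_increment[OF frame uv] by simp
    also have "integral {u..v} r = (\<sigma> v - \<sigma> u) / \<Lambda>" using \<sigma>_diff[of u v] uv \<Lambda>_pos by simp
    also have "\<dots> * (G v - G u) \<le> \<bar>(\<sigma> v - \<sigma> u) / \<Lambda> * (G v - G u)\<bar>" by (rule abs_ge_self)
    also have "\<dots> = (\<bar>\<sigma> v - \<sigma> u\<bar> / \<Lambda>) * \<bar>G v - G u\<bar>" using \<Lambda>_pos by (simp add: abs_mult)
    finally show ?thesis .
  qed
  have 3: "((\<lambda>x. (z x - 1) / \<sigma> x) \<longlongrightarrow> 0) (at c)"
  proof (rule Lim_null_comparison)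
    show "((\<lambda>x. (1 / (2 * \<Lambda>)) * \<bar>G x - G c\<bar>) \<longlongrightarrow> 0) (at c)" using G0 by simp
    show "\<forall>\<^sub>F x in at c. norm ((z x - 1) / \<sigma> x) \<le> (1 / (2 * \<Lambda>)) * \<bar>G x - G c\<bar>"
      using near
    proof eventually_elim
      case (elim x)
      then have x: "x \<in> {a..b}" "x \<noteq> c" by auto
      have "(norm (T x - T c))\<^sup>2 \<le> (\<bar>\<sigma> x\<bar> / \<Lambda>) * \<bar>G x - G c\<bar>"
        using bound[of c x] bound[of x c] x c_in c_eq
        by (cases x c rule: linorder_cases) (auto simp: norm_minus_commute abs_minus_commute)
      moreover have *: "(norm (T x - T c))\<^sup>2 = 2 - 2 * z x"
        using norm_T[OF x(1)] norm_e
        by (simp add: power2_norm_eq_inner inner_diff_left inner_diff_right inner_commute z_def e_def[symmetric] norm_eq_1)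
      ultimately have "1 - z x \<le> ((\<bar>\<sigma> x\<bar> / \<Lambda>) * \<bar>G x - G c\<bar>) / 2" by simp
      moreover have "0 \<le> 2 - 2 * z x" unfolding *[symmetric] by simp
      then have "\<bar>z x - 1\<bar> = 1 - z x" by simp
      ultimately have "\<bar>z x - 1\<bar> \<le> ((\<bar>\<sigma> x\<bar> / \<Lambda>) * \<bar>G x - G c\<bar>) / 2" by simp
      also have "\<dots> = (\<bar>\<sigma> x\<bar> / (2 * \<Lambda>)) * \<bar>G x - G c\<bar>" by simp
      finally have "\<bar>z x - 1\<bar> \<le> (\<bar>\<sigma> x\<bar> / (2 * \<Lambda>)) * \<bar>G x - G c\<bar>" .
      then have "\<bar>z x - 1\<bar> / \<bar>\<sigma> x\<bar> \<le> (1 / (2 * \<Lambda>)) * \<bar>G x - G c\<bar>"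
        using \<sigma>_nonzero[OF x] by (simp add: field_simps)
      then show ?case by simp
    qed
  qed
  have "((\<lambda>x. (\<sigma> x * M.as (\<sigma> x)) * ((z x - 1) / \<sigma> x - (M.zs (\<sigma> x) - 1) / \<sigma> x)) \<longlongrightarrow> - 1 * (0 - 0)) (at c)"
    by (intro tendsto_intros 1 2 3)
  moreover have "\<forall>\<^sub>F x in at c. (\<sigma> x * M.as (\<sigma> x)) * ((z x - 1) / \<sigma> x - (M.zs (\<sigma> x) - 1) / \<sigma> x) = M.as (\<sigma> x) * w x"
    using near
  proof eventually_elim
    case (elim x)
    then have "\<sigma> x \<noteq> 0" by (intro \<sigma>_nonzero) auto
    then show ?case by (simp add: w_def diff_divide_distrib[symmetric])
  qed
  ultimately show ?thesis using Lim_transform_eventually by force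
qed

lemma tendsto_boundary_right: "((\<lambda>x. M.as (\<sigma> x) * w x) \<longlongrightarrow> 0) (at_right c)"
  and tendsto_boundary_left: "((\<lambda>x. M.as (\<sigma> x) * w x) \<longlongrightarrow> 0) (at_left c)"
  using tendsto_boundary by (auto intro: tendsto_within_subset[of _ _ _ UNIV])

section \<open>Passing to the limit at the midpoint, and the inequality\<close>

lemma g_integrable_on: "a \<le> u \<Longrightarrow> v \<le> b \<Longrightarrow> g integrable_on {u..v}"
  using absolutely_integrable_subinterval[OF g_integrable] set_lebesgue_integral_eq_integral(1) by blast

lemma AC_integral_g: "AC a b (\<lambda>x. integral {a..x} g) g"
  using g_integrable by (simp add: AC_def)

lemma tendsto_integral_g_right: "((\<lambda>p. integral {p..b} g) \<longlongrightarrow> integral {c..b} g) (at_right c)"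
  and tendsto_integral_g_left: "((\<lambda>p. integral {a..p} g) \<longlongrightarrow> integral {a..c} g) (at_left c)"
proof -
  have atc: "at c within {a..b} = at c" using c_in by (intro at_within_interior) auto
  have l: "((\<lambda>p. integral {a..p} g) \<longlongrightarrow> integral {a..c} g) (at c)"
    using AC_continuous[OF AC_integral_g] c_in atc by (auto simp: continuous_on_def dest!: bspec[of _ _ c])
  then show "((\<lambda>p. integral {a..p} g) \<longlongrightarrow> integral {a..c} g) (at_left c)"
    by (rule tendsto_within_subset) simp
  have r: "integral {p..b} g = integral {a..b} g - integral {a..p} g" if "p \<in> {a..b}" for p
    using Henstock_Kurzweil_Integration.integral_combine[of a p b g] that g_integrable_on[of a b] by simp
  have rc: "integral {c..b} g = integral {a..b} g - integral {a..c} g" using c_in by (intro r) auto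
  have "((\<lambda>p. integral {a..b} g - integral {a..p} g) \<longlongrightarrow> integral {c..b} g) (at c)"
    unfolding rc by (intro tendsto_intros l)
  moreover have "\<forall>\<^sub>F p in at c. integral {a..b} g - integral {a..p} g = integral {p..b} g"
  proof (rule eventually_at_topological[THEN iffD2], intro exI conjI ballI impI)
    show "open {a<..<b}" "c \<in> {a<..<b}" using c_in by auto
    show "integral {a..b} g - integral {a..p} g = integral {p..b} g" if "p \<in> {a<..<b}" for p
      using that by (intro r[symmetric]) auto
  qed
  ultimately have "((\<lambda>p. integral {p..b} g) \<longlongrightarrow> integral {c..b} g) (at c)"
    by (rule Lim_transform_eventually)
  then show "((\<lambda>p. integral {p..b} g) \<longlongrightarrow> integral {c..b} g) (at_right c)"
    by (rule tendsto_within_subset) simp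
qed

lemma integral_N_right: "p \<in> {c<..<b} \<Longrightarrow> integral {p..b} N = integral {p..b} g + 2 * \<Lambda> * (M.as (\<sigma> p) * w p)"
  using integral_g_half(2)[of p b] c_in by (simp add: \<sigma>_ends M.as_K)

lemma integral_N_left: "p \<in> {a<..<c} \<Longrightarrow> integral {a..p} N = integral {a..p} g - 2 * \<Lambda> * (M.as (\<sigma> p) * w p)"
  using integral_g_half(2)[of a p] c_in by (simp add: \<sigma>_ends M.as_K)

text \<open>Integrability of \<open>N\<close> is available only on intervals avoiding
  \<open>c\<close>, so its integral up to the midpoint is treated as a limit.\<close>

lemma tendsto_N_right: "((\<lambda>p. integral {p..b} N) \<longlongrightarrow> integral {c..b} g) (at_right c)"
proof (rule Lim_transform_eventually)
  show "((\<lambda>p. integral {p..b} g + 2 * \<Lambda> * (M.as (\<sigma> p) * w p)) \<longlongrightarrow> integral {c..b} g) (at_right c)"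
    using tendsto_add[OF tendsto_integral_g_right tendsto_mult[OF tendsto_const tendsto_boundary_right]] by simp
  show "\<forall>\<^sub>F p in at_right c. integral {p..b} g + 2 * \<Lambda> * (M.as (\<sigma> p) * w p) = integral {p..b} N"
    using c_in integral_N_right by (auto simp: eventually_at_right_field intro!: exI[of _ b])
qed

lemma tendsto_N_left: "((\<lambda>p. integral {a..p} N) \<longlongrightarrow> integral {a..c} g) (at_left c)"
proof (rule Lim_transform_eventually)
  show "((\<lambda>p. integral {a..p} g - 2 * \<Lambda> * (M.as (\<sigma> p) * w p)) \<longlongrightarrow> integral {a..c} g) (at_left c)"
    using tendsto_diff[OF tendsto_integral_g_left tendsto_mult[OF tendsto_const tendsto_boundary_left]] by simp
  show "\<forall>\<^sub>F p in at_left c. integral {a..p} g - 2 * \<Lambda> * (M.as (\<sigma> p) * w p) = integral {a..p} N"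
    using c_in integral_N_left by (auto simp: eventually_at_left_field intro!: exI[of _ a])
qed

lemma N_integrable_right: "p \<in> {c<..<b} \<Longrightarrow> N integrable_on {p..b}"
  and N_integrable_left: "p \<in> {a<..<c} \<Longrightarrow> N integrable_on {a..p}"
  using integral_g_half(1)[of p b] integral_g_half(1)[of a p] c_in by auto

lemma integral_g_nonneg: "integral {c..b} g \<ge> 0" "integral {a..c} g \<ge> 0"
proof -
  have "\<forall>\<^sub>F p in at_right c. 0 \<le> integral {p..b} N"
    using c_in N_nonneg
    by (auto simp: eventually_at_right_field intro!: exI[of _ b] integral_nonneg N_integrable_right)
  then show "integral {c..b} g \<ge> 0"
    by (rule tendsto_lowerbound[OF tendsto_N_right]) simp
  have "\<forall>\<^sub>F p in at_left c. 0 \<le> integral {a..p} N"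
    using c_in N_nonneg
    by (auto simp: eventually_at_left_field intro!: exI[of _ a] integral_nonneg N_integrable_left)
  then show "integral {a..c} g \<ge> 0"
    by (rule tendsto_lowerbound[OF tendsto_N_left]) simp
qed

lemma integral_g_split: "integral {a..b} g = integral {a..c} g + integral {c..b} g"
  using Henstock_Kurzweil_Integration.integral_combine[of a c b g] c_in g_integrable_on[of a b] by simp

lemma energy_ge: "varpi_star / L \<le> bending_energy a b \<gamma>"
  using integral_g integral_g_split integral_g_nonneg by linarith

end

section \<open>The equality case\<close>

context leaf
begin

text \<open>The direction obtained by solving T = zs e + ys \<open>\<omega>\<close>; in the equality
  case it is constant on either side of \<open>c\<close>, where \<open>ys\<close> vanishes.\<close>

definition \<omega> where "\<omega> x = (1 / M.ys (\<sigma> x)) *\<^sub>R (T x - M.zs (\<sigma> x) *\<^sub>R e)"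

lemma ys_nonzero: "x \<in> {a..b} \<Longrightarrow> x \<noteq> c \<Longrightarrow> M.ys (\<sigma> x) \<noteq> 0"
  using sn_nonzero[of x] M.dn_pos[of "\<sigma> x"] m_star by (simp add: M.ys_def)

lemma T_eq_\<omega>: "x \<in> {a..b} \<Longrightarrow> x \<noteq> c \<Longrightarrow> T x = M.zs (\<sigma> x) *\<^sub>R e + M.ys (\<sigma> x) *\<^sub>R \<omega> x"
  using ys_nonzero[of x] by (simp add: \<omega>_def)

text \<open>Vanishing of \<open>N\<close> almost everywhere gives z = z_0, everywhere by continuity,
  and a first-order equation for \<open>T\<close>. Both the leaf and \<open>T\<close> satisfy this
  equation, so differentiating \<open>\<omega>\<close> gives zero.\<close>

lemma rigidity_half:
  assumes pq: "a \<le> p" "p < q" "q \<le> b" and c: "c \<notin> {p..q}" and zero: "integral {p..q} N = 0" and x: "x \<in> {p..q}"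
  shows "w x = 0" "\<omega> x = \<omega> p"
proof -
  have s: "{p..q} \<subseteq> {a..b}" using pq by auto
  have Ni: "N integrable_on {p..q}" by (rule integral_g_half(1)[OF pq c])
  have Nn: "N x \<ge> 0" if "x \<in> {p..q}" for x using N_nonneg that s by blast
  have "AE x in lebesgue. x \<in> {p..q} \<longrightarrow> N x = 0"
  proof (rule AE_zero_if_interval_integrals_zero)
    show "N absolutely_integrable_on {p..q}"
      by (rule nonnegative_absolutely_integrable_1[OF Ni Nn])
    fix u v assume uv: "p \<le> u" "u \<le> v" "v \<le> q"
    have i: "N integrable_on {u..v}" by (rule integrable_on_subinterval[OF Ni]) (use uv in auto)
    have "integral {u..v} N \<le> integral {p..q} N"
      by (rule integral_subset_le[OF _ i Ni]) (use uv Nn in auto)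
    moreover have "0 \<le> integral {u..v} N"
      by (rule integral_nonneg[OF i]) (use uv Nn in auto)
    ultimately show "integral {u..v} N = 0" using zero by simp
  qed
  then have ae: "AE x in lebesgue. x \<in> {p<..<q} \<longrightarrow>
      w x = 0 \<and> \<tau> x = (\<Lambda> * M.as (\<sigma> x) * r x) *\<^sub>R (e - z x *\<^sub>R T x)"
  proof eventually_elim
    case (elim x)
    show ?case
    proof
      assume "x \<in> {p<..<q}"
      then have x: "x \<in> {p..q}" "x \<in> {a..b}" "x \<noteq> c" "a < x" "x < b" using s pq c by auto
      have r: "r x > 0" by (rule r_pos[OF x(2)])
      have "\<sigma> x \<in> {- M.K<..<M.K}" using \<sigma>_less[of a x] \<sigma>_less[of x b] x \<sigma>_ends by auto
      \<comment> \<open>The factor A^2 in \<open>N\<close> has to be nonzero to conclude w = 0. It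
        vanishes at the ends of the leaf, which is why the argument is confined to the open
        interval.\<close>
      then have as: "M.as (\<sigma> x) \<noteq> 0" using \<sigma>_nonzero[OF x(2,3)] by (rule M.as_nonzero)
      have "(norm (\<tau> x - (\<Lambda> * M.as (\<sigma> x) * r x) *\<^sub>R (e - z x *\<^sub>R T x)))\<^sup>2 / r x = 0 \<and>
        \<Lambda>\<^sup>2 * (M.as (\<sigma> x))\<^sup>2 * (w x)\<^sup>2 * r x = 0"
        using elim x(1) r unfolding N_def by (subst add_nonneg_eq_0_iff[symmetric]) auto
      then show "w x = 0 \<and> \<tau> x = (\<Lambda> * M.as (\<sigma> x) * r x) *\<^sub>R (e - z x *\<^sub>R T x)"
        using r as \<Lambda>_pos by simp
    qed
  qed
  have w0: "w x = 0" if "x \<in> {p..q}" for x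
    by (rule continuous_AE_eq[OF pq(2) continuous_on_subset[OF cont_w s] continuous_on_const[of _ 0] _ that])
       (use ae in \<open>eventually_elim, blast\<close>)
  then show "w x = 0" using x by blast
  have ys0: "M.ys (\<sigma> x) \<noteq> 0" if "x \<in> {p..q}" for x using ys_nonzero[of x] that s c by auto
  have cc: "continuous_on {p..q} (\<lambda>x. F (\<sigma> x))" if "continuous_on UNIV F" for F :: "real \<Rightarrow> real"
    by (rule continuous_on_subset[OF cont_comp[OF that] s])
  have "AC p q (\<lambda>x. 1 / M.ys (\<sigma> x)) (\<lambda>x. (- (\<kappa> x * M.zs (\<sigma> x)) / (M.ys (\<sigma> x))\<^sup>2) * (\<Lambda> * r x))"
  proof (rule AC_comp)
    fix x assume "x \<in> {p..q}"
    from ys0[OF this]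
    show "((\<lambda>u. 1 / M.ys u) has_real_derivative - (\<kappa> x * M.zs (\<sigma> x)) / (M.ys (\<sigma> x))\<^sup>2) (at (\<sigma> x))"
      by (intro DERIV_cong[OF DERIV_divide[OF DERIV_const M.ys_derivative]]) (auto simp: power2_eq_square)
  next
    show "continuous_on {p..q} (\<lambda>x. - (\<kappa> x * M.zs (\<sigma> x)) / (M.ys (\<sigma> x))\<^sup>2)"
      using ys0 by (intro continuous_intros cc M.elliptic_continuous) auto
  qed (use pq in auto)
  moreover have "AC p q (\<lambda>x. T x - M.zs (\<sigma> x) *\<^sub>R e) (\<lambda>x. \<tau> x - (- (\<kappa> x * M.ys (\<sigma> x)) * (\<Lambda> * r x)) *\<^sub>R e)"
    using AC_subinterval[OF AC_diff[OF AC_T AC_linear[OF AC_zs bounded_linear_scaleR_left[of e]]] pq(1,3)] .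
  ultimately have A: "AC p q \<omega> (\<lambda>x. (1 / M.ys (\<sigma> x)) *\<^sub>R (\<tau> x - (- (\<kappa> x * M.ys (\<sigma> x)) * (\<Lambda> * r x)) *\<^sub>R e) +
      ((- (\<kappa> x * M.zs (\<sigma> x)) / (M.ys (\<sigma> x))\<^sup>2) * (\<Lambda> * r x)) *\<^sub>R (T x - M.zs (\<sigma> x) *\<^sub>R e))"
    unfolding \<omega>_def by (rule AC_bilinear[OF bounded_bilinear_scaleR])
  obtain Z where Z: "negligible Z" "\<And>x. x \<in> {p..q} - Z \<Longrightarrow>
      w x = 0 \<and> \<tau> x = (\<Lambda> * M.as (\<sigma> x) * r x) *\<^sub>R (e - z x *\<^sub>R T x)"
    using AE_interval_negligible[OF ae] by blast
  have "AC p q \<omega> (\<lambda>x. 0)"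
  proof (rule AC_cong[OF A refl Z(1)])
    fix x assume x: "x \<in> {p..q} - Z"
    define k Y Zz R where "k = \<kappa> x" and "Y = M.ys (\<sigma> x)" and "Zz = M.zs (\<sigma> x)" and "R = \<Lambda> * r x"
    have Y: "Y \<noteq> 0" using ys0 x by (simp add: Y_def)
    have ZY: "Zz\<^sup>2 = 1 - Y\<^sup>2" using M.zs_ys[of "\<sigma> x"] by (simp add: Zz_def Y_def)
    have "M.as (\<sigma> x) * Y = - k"
      unfolding Y_def k_def by (rule M.as_ys[OF sn_nonzero]) (use x s c in auto)
    then have as: "M.as (\<sigma> x) = - (k / Y)" using Y by (simp add: field_simps)
    have "z x = Zz" using Z(2)[OF x] by (simp add: w_def Zz_def)
    then have \<tau>: "\<tau> x = (- (k / Y) * R) *\<^sub>R (e - Zz *\<^sub>R T x)"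
      \<comment> \<open>Here A = -k / Y, so the derivative of \<open>\<omega>\<close> becomes a
        combination of \<open>e\<close> and \<open>T\<close> whose coefficients cancel by Z^2 + Y^2
        = 1.\<close>
      using Z(2)[OF x] by (simp add: as R_def mult_ac)
    have "(1 / Y) *\<^sub>R (\<tau> x - (- (k * Y) * R) *\<^sub>R e) + ((- (k * Zz) / Y\<^sup>2) * R) *\<^sub>R (T x - Zz *\<^sub>R e)
      = ((1 / Y) * (- (k / Y) * R + k * Y * R) + (k * Zz / Y\<^sup>2) * R * Zz) *\<^sub>R e
        + ((1 / Y) * (k / Y * R * Zz) - (k * Zz / Y\<^sup>2) * R) *\<^sub>R T x"
      unfolding \<tau> by (simp add: algebra_simps)
    also have "(1 / Y) * (k / Y * R * Zz) - (k * Zz / Y\<^sup>2) * R = 0" using Y by (simp add: power2_eq_square)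
    also have "(1 / Y) * (- (k / Y) * R + k * Y * R) + (k * Zz / Y\<^sup>2) * R * Zz = (k * R / Y\<^sup>2) * (- 1 + Y\<^sup>2 + Zz\<^sup>2)"
      using Y by (simp add: power2_eq_square field_simps)
    also have "\<dots> = 0" by (simp add: ZY)
    finally show "0 = (1 / M.ys (\<sigma> x)) *\<^sub>R (\<tau> x - (- (\<kappa> x * M.ys (\<sigma> x)) * (\<Lambda> * r x)) *\<^sub>R e) +
      ((- (\<kappa> x * M.zs (\<sigma> x)) / (M.ys (\<sigma> x))\<^sup>2) * (\<Lambda> * r x)) *\<^sub>R (T x - M.zs (\<sigma> x) *\<^sub>R e)"
      unfolding k_def Y_def Zz_def R_def by simp
  qed
  then show "\<omega> x = \<omega> p" using AC_integral[of p q \<omega> "\<lambda>x. 0" p x] x by simp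
qed

lemma rigidity:
  assumes eq: "bending_energy a b \<gamma> = varpi_star / L"
  obtains \<omega>' where "norm \<omega>' = 1" "e \<bullet> \<omega>' = 0"
    "\<And>x. x \<in> {a..b} \<Longrightarrow> T x = M.zs (\<sigma> x) *\<^sub>R e + M.ys (\<sigma> x) *\<^sub>R \<omega>'"
proof -
  have "integral {c..b} g = 0" "integral {a..c} g = 0"
    using integral_g integral_g_split integral_g_nonneg eq by auto
  note lim = tendsto_N_right[unfolded this] tendsto_N_left[unfolded this]
  have r0: "integral {p..b} N = 0" if p: "p \<in> {c<..<b}" for p
  proof (rule antisym)
    have "\<forall>\<^sub>F q in at_right c. integral {p..b} N \<le> integral {q..b} N"
      unfolding eventually_at_right_field
    proof (intro exI[of _ p] conjI allI impI)
      show "c < p" using p by simp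
      fix q assume q: "c < q" "q < p"
      show "integral {p..b} N \<le> integral {q..b} N"
        by (rule integral_subset_le) (use p q c_in N_nonneg in \<open>auto intro!: N_integrable_right\<close>)
    qed
    then show "integral {p..b} N \<le> 0" by (rule tendsto_lowerbound[OF lim(1)]) simp
    show "0 \<le> integral {p..b} N"
      by (rule integral_nonneg[OF N_integrable_right[OF p]]) (use p c_in N_nonneg in auto)
  qed
  have l0: "integral {a..p} N = 0" if p: "p \<in> {a<..<c}" for p
  proof (rule antisym)
    have "\<forall>\<^sub>F q in at_left c. integral {a..p} N \<le> integral {a..q} N"
      unfolding eventually_at_left_field
    proof (intro exI[of _ p] conjI allI impI)
      show "p < c" using p by simp
      fix q assume q: "p < q" "q < c"
      show "integral {a..p} N \<le> integral {a..q} N"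
        by (rule integral_subset_le) (use p q c_in N_nonneg in \<open>auto intro!: N_integrable_left\<close>)
    qed
    then show "integral {a..p} N \<le> 0" by (rule tendsto_lowerbound[OF lim(2)]) simp
    show "0 \<le> integral {a..p} N"
      by (rule integral_nonneg[OF N_integrable_left[OF p]]) (use p c_in N_nonneg in auto)
  qed
  have right: "w x = 0 \<and> \<omega> x = \<omega> b" if x: "c < x" "x \<le> b" for x
  proof -
    obtain p where p: "c < p" "p < x" using dense x by blast
    have A: "a \<le> p" "p < b" "b \<le> b" "c \<notin> {p..b}" "integral {p..b} N = 0"
      using p x c_in by (auto intro: r0)
    show ?thesis
      using rigidity_half[OF A, of x] rigidity_half[OF A, of b] p x by simp
  qed
  have left: "\<omega> x = \<omega> a" if x: "a \<le> x" "x < c" for x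
  proof -
    obtain p where p: "x < p" "p < c" using dense x by blast
    have A: "a \<le> a" "a < p" "p \<le> b" "c \<notin> {a..p}" "integral {a..p} N = 0"
      using p x c_in by (auto intro: l0)
    show ?thesis using rigidity_half(2)[OF A, of x] p x by simp
  qed
  \<comment> \<open>At the midpoint \<open>ys\<close> vanishes, so the representation holds with any
    direction; hence the two halves are not linked at this stage.\<close>
  have Tc: "T c = M.zs (\<sigma> c) *\<^sub>R e + M.ys (\<sigma> c) *\<^sub>R v" for v
    by (simp add: c_eq M.zs_def M.ys_def M.K_values e_def)
  have TR: "T x = M.zs (\<sigma> x) *\<^sub>R e + M.ys (\<sigma> x) *\<^sub>R \<omega> b" if "x \<in> {c..b}" for x
    using that T_eq_\<omega>[of x] right[of x] c_in Tc[of "\<omega> b"] by (cases "x = c") auto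
  have TL: "T x = M.zs (\<sigma> x) *\<^sub>R e + M.ys (\<sigma> x) *\<^sub>R \<omega> a" if "x \<in> {a..c}" for x
    using that T_eq_\<omega>[of x] left[of x] c_in Tc[of "\<omega> a"] by (cases "x = c") auto
  have cz: "continuous_on {a..b} (\<lambda>x. r x * M.zs (\<sigma> x))" and cy: "continuous_on {a..b} (\<lambda>x. r x * M.ys (\<sigma> x))"
    by (intro continuous_intros cont_r cont_comp M.elliptic_continuous)+
  have iz: "(\<lambda>x. r x * M.zs (\<sigma> x)) integrable_on {u..v}" and iy: "(\<lambda>x. r x * M.ys (\<sigma> x)) integrable_on {u..v}"
    if "a \<le> u" "v \<le> b" for u v
    using that by (auto intro!: integrable_continuous_real continuous_on_subset[OF cz] continuous_on_subset[OF cy])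
  have Tint: "\<gamma> v - \<gamma> u = integral {u..v} (\<lambda>x. r x * M.zs (\<sigma> x)) *\<^sub>R e + integral {u..v} (\<lambda>x. r x * M.ys (\<sigma> x)) *\<^sub>R \<nu>"
    if uv: "a \<le> u" "u \<le> v" "v \<le> b" and T: "\<And>x. x \<in> {u..v} \<Longrightarrow> T x = M.zs (\<sigma> x) *\<^sub>R e + M.ys (\<sigma> x) *\<^sub>R \<nu>" for u v \<nu>
  proof -
    have "((\<lambda>x. (r x * M.zs (\<sigma> x)) *\<^sub>R e + (r x * M.ys (\<sigma> x)) *\<^sub>R \<nu>) has_integral
       (integral {u..v} (\<lambda>x. r x * M.zs (\<sigma> x)) *\<^sub>R e + integral {u..v} (\<lambda>x. r x * M.ys (\<sigma> x)) *\<^sub>R \<nu>)) {u..v}"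
      using has_integral_linear[OF integrable_integral[OF iz[OF uv(1,3)]] bounded_linear_scaleR_left[of e]]
        has_integral_linear[OF integrable_integral[OF iy[OF uv(1,3)]] bounded_linear_scaleR_left[of \<nu>]]
      by (intro has_integral_add) (simp_all add: o_def)
    moreover have "integral {u..v} (\<lambda>x. r x *\<^sub>R T x) = integral {u..v} (\<lambda>x. (r x * M.zs (\<sigma> x)) *\<^sub>R e + (r x * M.ys (\<sigma> x)) *\<^sub>R \<nu>)"
      by (rule integral_cong) (simp add: T scaleR_add_right)
    ultimately show ?thesis
      using AC_integral[OF frameD(5)[OF frame] uv] by (simp add: integral_unique)
  qed
  define Y where "Y = integral {c..b} (\<lambda>x. r x * M.ys (\<sigma> x))"
  have "integral {a..c} (\<lambda>x. r x * M.ys (\<sigma> x)) + Y = 0"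
    unfolding Y_def integral_ys[symmetric]
    using c_in by (intro Henstock_Kurzweil_Integration.integral_combine iy) auto
  then have Yl: "integral {a..c} (\<lambda>x. r x * M.ys (\<sigma> x)) = - Y" by simp
  have Zz: "integral {a..c} (\<lambda>x. r x * M.zs (\<sigma> x)) + integral {c..b} (\<lambda>x. r x * M.zs (\<sigma> x)) = 0"
    unfolding integral_zs[symmetric]
    using c_in by (intro Henstock_Kurzweil_Integration.integral_combine iz) auto
  \<comment> \<open>\<open>Y\<close> is the normal displacement of the right half of the leaf;
    \<open>ys\<close> is nonnegative there and not identically zero.\<close>
  have "Y \<noteq> 0"
  proof
    assume Y: "Y = 0"
    have cb: "continuous_on {c..b} (\<lambda>x. r x * M.ys (\<sigma> x))" "c < b"
      using c_in by (auto intro: continuous_on_subset[OF cy])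
    have "0 \<le> r x * M.ys (\<sigma> x)" if "x \<in> {c..b}" for x
    proof (cases "x = c")
      case True then show ?thesis by (simp add: c_eq M.ys_def M.K_values)
    next
      case False
      then have "0 < \<sigma> x" "\<sigma> x \<le> M.K" "0 < r x"
        using that \<sigma>_less[of c x] \<sigma>_range[of x] r_pos[of x] c_in c_eq by auto
      then show ?thesis
        using M.sn_pos[of "\<sigma> x"] M.dn_pos[of "\<sigma> x"] m_star by (simp add: M.ys_def)
    qed
    then have "\<forall>x\<in>{c..b}. r x * M.ys (\<sigma> x) = 0"
      using integral_eq_0_iff[OF cb] Y by (simp add: Y_def)
    then have "r b * M.ys (\<sigma> b) = 0" using c_in by auto
    then show False using ys_nonzero[of b] r_pos[of b] c_in by simp
  qed
  have "\<gamma> b - \<gamma> a = (\<gamma> c - \<gamma> a) + (\<gamma> b - \<gamma> c)" by simp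
  also have "\<dots> = (integral {a..c} (\<lambda>x. r x * M.zs (\<sigma> x)) *\<^sub>R e + (- Y) *\<^sub>R \<omega> a) +
      (integral {c..b} (\<lambda>x. r x * M.zs (\<sigma> x)) *\<^sub>R e + Y *\<^sub>R \<omega> b)"
    using Tint[of a c "\<omega> a"] Tint[of c b "\<omega> b"] TL TR c_in by (simp add: Yl Y_def)
  also have "\<dots> = (integral {a..c} (\<lambda>x. r x * M.zs (\<sigma> x)) + integral {c..b} (\<lambda>x. r x * M.zs (\<sigma> x))) *\<^sub>R e + Y *\<^sub>R (\<omega> b - \<omega> a)"
    by (simp add: algebra_simps)
  \<comment> \<open>The normal part of the closing condition: the two halves are displaced
    oppositely, so the curve closes only if both use the same direction, and the arc is
    planar.\<close>
  finally have "Y *\<^sub>R (\<omega> b - \<omega> a) = 0" unfolding Zz using closed by simp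
  then have \<omega>: "\<omega> a = \<omega> b" using \<open>Y \<noteq> 0\<close> by simp
  have T: "T x = M.zs (\<sigma> x) *\<^sub>R e + M.ys (\<sigma> x) *\<^sub>R \<omega> b" if "x \<in> {a..b}" for x
    using TL[of x] TR[of x] \<omega> that by (cases "x \<le> c") auto
  have b: "b \<in> {a..b}" "b \<noteq> c" "c < b" using c_in by auto
  have "z b = M.zs (\<sigma> b)" using right[of b] b by (simp add: w_def)
  moreover have "z b = M.zs (\<sigma> b) + M.ys (\<sigma> b) * (\<omega> b \<bullet> e)"
    using norm_e unfolding z_def T[OF b(1)] by (simp add: inner_add_left norm_eq_1)
  ultimately have orth: "\<omega> b \<bullet> e = 0" using ys_nonzero[OF b(1,2)] by simp
  have "1 = T b \<bullet> T b" using norm_T[OF b(1)] by (simp add: norm_eq_1)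
  also have "\<dots> = (M.zs (\<sigma> b))\<^sup>2 + (M.ys (\<sigma> b))\<^sup>2 * (\<omega> b \<bullet> \<omega> b)"
    using norm_e orth unfolding T[OF b(1)]
    by (simp add: inner_add_left inner_add_right inner_commute norm_eq_1 power2_eq_square)
  finally have "(M.ys (\<sigma> b))\<^sup>2 * (\<omega> b \<bullet> \<omega> b) = (M.ys (\<sigma> b))\<^sup>2 * 1" using M.zs_ys[of "\<sigma> b"] by linarith
  then have "\<omega> b \<bullet> \<omega> b = 1" using ys_nonzero[OF b(1,2)] by simp
  then have "norm (\<omega> b) = 1" by (simp add: norm_eq_1)
  then show thesis using orth T by (intro that[of "\<omega> b"]) (auto simp: inner_commute)
qed

lemma half_fold_if_energy_eq:
  assumes eq: "bending_energy a b \<gamma> = varpi_star / L" and im: "immersed_H2_curve a b \<gamma>"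
  shows "half_fold_figure_eight_elastica a b \<gamma>"
proof -
  obtain \<nu> where \<nu>: "norm \<nu> = 1" "e \<bullet> \<nu> = 0"
    and T: "\<And>x. x \<in> {a..b} \<Longrightarrow> T x = M.zs (\<sigma> x) *\<^sub>R e + M.ys (\<sigma> x) *\<^sub>R \<nu>"
    using rigidity[OF eq] by blast
  have ee: "e \<bullet> e = 1" "\<nu> \<bullet> \<nu> = 1" "\<nu> \<bullet> e = 0" using norm_e \<nu> by (simp_all add: norm_eq_1 inner_commute)
  have planar: "\<gamma> x - \<gamma> a \<in> span {e, \<nu>}" if x: "x \<in> {a..b}" for x
  proof -
    \<comment> \<open>Orthogonal projection onto the plane spanned by \<open>e\<close> and
      \<open>\<nu>\<close>. It fixes the velocity, hence the chord from
      \<open>\<gamma> a\<close>.\<close>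
    define P where "P y = (y \<bullet> e) *\<^sub>R e + (y \<bullet> \<nu>) *\<^sub>R \<nu>" for y
    have P: "bounded_linear P" unfolding P_def[abs_def]
      by (intro bounded_linear_add bounded_linear_compose[OF bounded_linear_scaleR_left] bounded_linear_inner_left)
    have "(\<lambda>x. r x *\<^sub>R T x) integrable_on {a..x}"
      using AC_integrable_on[OF frameD(5)[OF frame]] x by auto
    from integral_linear[OF this P]
    have "P (integral {a..x} (\<lambda>x. r x *\<^sub>R T x)) = integral {a..x} (\<lambda>y. P (r y *\<^sub>R T y))" by (simp add: o_def)
    also have "\<dots> = integral {a..x} (\<lambda>x. r x *\<^sub>R T x)"
      by (rule integral_cong) (use x in \<open>simp add: P_def T ee \<nu>(2) inner_add_left algebra_simps\<close>)
    finally have "P (\<gamma> x - \<gamma> a) = \<gamma> x - \<gamma> a"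
      using AC_integral[OF frameD(5)[OF frame], of a x] x by simp
    moreover have "P y \<in> span {e, \<nu>}" for y
      unfolding P_def by (intro span_add span_mul span_base) auto
    ultimately show ?thesis by metis
  qed
  have "AC a b (\<lambda>x. M.zs (\<sigma> x) *\<^sub>R e + M.ys (\<sigma> x) *\<^sub>R \<nu>)
     (\<lambda>x. (- (\<kappa> x * M.ys (\<sigma> x)) * (\<Lambda> * r x)) *\<^sub>R e + ((\<kappa> x * M.zs (\<sigma> x)) * (\<Lambda> * r x)) *\<^sub>R \<nu>)"
    by (intro AC_add AC_linear[OF AC_zs bounded_linear_scaleR_left] AC_linear[OF AC_ys bounded_linear_scaleR_left])
  then have "AC a b T (\<lambda>x. (- (\<kappa> x * M.ys (\<sigma> x)) * (\<Lambda> * r x)) *\<^sub>R e + ((\<kappa> x * M.zs (\<sigma> x)) * (\<Lambda> * r x)) *\<^sub>R \<nu>)"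
    by (rule AC_cong[OF _ _ negligible_empty]) (auto simp: T)
  from AC_unique[OF AC_T this]
  \<comment> \<open>The sign is +1, as \<open>\<nu>\<close> already carries the orientation.\<close>
  have "AE x in lebesgue. x \<in> {a<..<b} \<longrightarrow> signed_curvature a b e \<nu> \<gamma> x = 1 * (2 * sqrt m_star * \<Lambda> * M.cn (\<Lambda> * arclength_param a b \<gamma> x - M.K))"
    using frame_signed_curvature[OF frame, of e \<nu>]
  proof eventually_elim
    case (elim x)
    show ?case
    proof
      assume "x \<in> {a<..<b}"
      then have x: "x \<in> {a..b}" "x \<in> {a<..<b}" by auto
      define k Y Z where "k = \<kappa> x" and "Y = M.ys (\<sigma> x)" and "Z = M.zs (\<sigma> x)"
      have r: "r x > 0" by (rule r_pos[OF x(1)])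
      have \<tau>: "\<tau> x = (- (k * Y) * (\<Lambda> * r x)) *\<^sub>R e + ((k * Z) * (\<Lambda> * r x)) *\<^sub>R \<nu>"
        using elim x by (simp add: k_def Y_def Z_def)
      have Te: "T x \<bullet> e = Z" "T x \<bullet> \<nu> = Y"
        using T[OF x(1)] by (simp_all add: inner_add_left ee \<nu>(2) Y_def Z_def)
      have "signed_curvature a b e \<nu> \<gamma> x = (1 / r x) * (\<tau> x \<bullet> (Z *\<^sub>R \<nu> - Y *\<^sub>R e))"
        using elim x Te by simp
      also have "\<tau> x \<bullet> (Z *\<^sub>R \<nu> - Y *\<^sub>R e) = (\<Lambda> * r x * k) * (Z\<^sup>2 + Y\<^sup>2)"
        unfolding \<tau> by (simp add: inner_add_left inner_diff_right ee \<nu>(2) power2_eq_square algebra_simps)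
      also have "Z\<^sup>2 + Y\<^sup>2 = 1" unfolding Z_def Y_def by (rule M.zs_ys)
      also have "1 / r x * (\<Lambda> * r x * k * 1) = \<Lambda> * k" using r by simp
      also have "\<dots> = 1 * (2 * sqrt m_star * \<Lambda> * M.cn (\<sigma> x))" by (simp add: k_def)
      also have "\<sigma> x = \<Lambda> * arclength_param a b \<gamma> x - M.K"
        by (simp add: \<sigma>_def frame_arclength[OF frame x(1)])
      finally show "signed_curvature a b e \<nu> \<gamma> x = 1 * (2 * sqrt m_star * \<Lambda> * M.cn (\<Lambda> * arclength_param a b \<gamma> x - M.K))" .
    qed
  qed
  then have "AE x in lebesgue. x \<in> {a<..<b} \<longrightarrow>
    (let \<Lambda> = 2 * ellK m_star / curve_length a b \<gamma> in signed_curvature a b e \<nu> \<gamma> x =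
      1 * (2 * sqrt m_star * \<Lambda> * jacobi_cn (\<Lambda> * arclength_param a b \<gamma> x - ellK m_star) m_star))"
    by (simp add: Let_def M.cn_eq \<Lambda>_def frame_curve_length[OF frame] L_def M.K_def)
  then show ?thesis
    unfolding half_fold_figure_eight_elastica_def
    using im norm_e \<nu> planar by blast
qed

end

section \<open>Energy of a half-fold elastica\<close>

lemma span_pair_orthonormal:
  assumes "y \<in> span {u, v}" "norm u = 1" "norm v = 1" "u \<bullet> v = 0"
  shows "y = (y \<bullet> u) *\<^sub>R u + (y \<bullet> v) *\<^sub>R v"
proof -
  obtain p q where y: "y = p *\<^sub>R u + q *\<^sub>R v"
    using assms(1) by (auto simp: span_insert span_singleton algebra_simps)
  have "u \<bullet> u = 1" "v \<bullet> v = 1" "v \<bullet> u = 0"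
    using assms by (simp_all add: norm_eq_1 inner_commute)
  then show ?thesis
    unfolding y using assms(4) by (simp add: inner_add_left)
qed

text \<open>Planarity puts \<open>T\<close> and \<open>\<tau>\<close> into the plane, where
  \<open>\<tau>\<close> orthogonal to \<open>T\<close> makes its norm the absolute value of its
  normal component. So the signed curvature determines the energy density, which is
  \<open>k2\<close>.\<close>

lemma (in framed_curve) half_fold_energy:
  assumes "half_fold_figure_eight_elastica a b \<gamma>"
  shows "bending_energy a b \<gamma> = varpi_star / L"
proof -
  have \<Lambda>_eq: "2 * M.K / curve_length a b \<gamma> = \<Lambda>"
    by (simp add: \<Lambda>_def L_def frame_curve_length[OF frame])
  obtain p u v s where uv: "norm u = 1" "norm v = 1" "u \<bullet> v = 0"
    and pl: "\<And>x. x \<in> {a..b} \<Longrightarrow> \<gamma> x - p \<in> span {u, v}" and s: "s \<in> {1, - 1::real}"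
    and sc: "AE x in lebesgue. x \<in> {a<..<b} \<longrightarrow> signed_curvature a b u v \<gamma> x =
      s * (2 * sqrt m_star * \<Lambda> * M.cn (\<Lambda> * arclength_param a b \<gamma> x - M.K))"
    using assms unfolding half_fold_figure_eight_elastica_def Let_def M.K_def[symmetric] M.cn_eq \<Lambda>_eq
    by blast
  define P where "P y = (y \<bullet> u) *\<^sub>R u + (y \<bullet> v) *\<^sub>R v" for y
  have P: "bounded_linear P" unfolding P_def[abs_def]
    by (intro bounded_linear_add bounded_linear_compose[OF bounded_linear_scaleR_left] bounded_linear_inner_left)
  have "AC a b (\<lambda>x. \<gamma> x - p) (\<lambda>x. r x *\<^sub>R T x)"
    using AC_diff[OF frameD(5)[OF frame] AC_const[of a b p]] by simp
  moreover from AC_linear[OF this P] have "AC a b (\<lambda>x. \<gamma> x - p) (\<lambda>x. P (r x *\<^sub>R T x))"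
    by (rule AC_cong[OF _ _ negligible_empty]) (use span_pair_orthonormal[OF pl uv] in \<open>auto simp: P_def\<close>)
  ultimately have "AE x in lebesgue. x \<in> {a..b} \<longrightarrow> r x *\<^sub>R T x = P (r x *\<^sub>R T x)" by (rule AC_unique)
  then have "AE x in lebesgue. x \<in> {a<..<b} \<longrightarrow> T x = P (T x)"
  proof eventually_elim
    case (elim x)
    show ?case
    proof
      assume "x \<in> {a<..<b}"
      then have "r x > 0" "r x *\<^sub>R T x = r x *\<^sub>R P (T x)"
        using elim r_pos[of x] by (auto simp: linear_cmul[OF bounded_linear.linear[OF P]])
      then show "T x = P (T x)" by simp
    qed
  qed
  then have PT: "T x = P (T x)" if "x \<in> {a..b}" for x
    using that by (intro continuous_AE_eq[OF ab cont_T bounded_linear.continuous_on[OF P cont_T]])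
  have "AC a b T (\<lambda>x. P (\<tau> x))"
    by (rule AC_cong[OF AC_linear[OF AC_T P] PT negligible_empty]) auto
  from AC_unique[OF AC_T this]
  have ae: "AE x in lebesgue. x \<in> {a<..<b} \<longrightarrow> (norm (\<tau> x))\<^sup>2 / r x = k2 x"
    using frame_orthogonal[OF frame] sc frame_signed_curvature[OF frame, of u v]
  proof eventually_elim
    case (elim x)
    show ?case
    proof
      assume "x \<in> {a<..<b}"
      then have x: "x \<in> {a..b}" "x \<in> {a<..<b}" by auto
      define p q \<alpha> \<beta> where "p = T x \<bullet> u" and "q = T x \<bullet> v" and "\<alpha> = \<tau> x \<bullet> u" and "\<beta> = \<tau> x \<bullet> v"
      have T: "T x = p *\<^sub>R u + q *\<^sub>R v" using PT[OF x(1)] by (simp add: P_def p_def q_def)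
      have \<tau>: "\<tau> x = \<alpha> *\<^sub>R u + \<beta> *\<^sub>R v" using elim x by (simp add: P_def \<alpha>_def \<beta>_def)
      have uu: "u \<bullet> u = 1" "v \<bullet> v = 1" "v \<bullet> u = 0" using uv by (simp_all add: norm_eq_1 inner_commute)
      have 1: "p\<^sup>2 + q\<^sup>2 = 1"
        using norm_T[OF x(1)] unfolding norm_eq_1 T
        by (simp add: inner_add_left inner_add_right uu uv power2_eq_square)
      have 2: "p * \<alpha> + q * \<beta> = 0"
        using elim x unfolding T \<tau> by (simp add: inner_add_left inner_add_right uu uv mult.commute)
      have 3: "(norm (\<tau> x))\<^sup>2 = \<alpha>\<^sup>2 + \<beta>\<^sup>2"
        unfolding power2_norm_eq_inner unfolding \<tau> by (simp add: inner_add_left inner_add_right uu uv power2_eq_square)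
      have "s * (2 * sqrt m_star * \<Lambda> * M.cn (\<sigma> x)) = signed_curvature a b u v \<gamma> x"
        using elim(3) x(2) unfolding \<sigma>_def frame_arclength[OF frame x(1)] by simp
      also have "\<dots> = (1 / r x) * (\<tau> x \<bullet> (p *\<^sub>R v - q *\<^sub>R u))"
        using elim(4) x(2) unfolding p_def q_def by blast
      also have "\<tau> x \<bullet> (p *\<^sub>R v - q *\<^sub>R u) = p * \<beta> - q * \<alpha>"
        by (simp add: inner_diff_right \<alpha>_def \<beta>_def)
      finally have sc: "s * (2 * sqrt m_star * \<Lambda> * M.cn (\<sigma> x)) = (1 / r x) * (p * \<beta> - q * \<alpha>)" .
      have r: "r x > 0" by (rule r_pos[OF x(1)])
      have s2: "s\<^sup>2 = 1" using s by auto
      have "\<alpha>\<^sup>2 + \<beta>\<^sup>2 = (p\<^sup>2 + q\<^sup>2) * (\<alpha>\<^sup>2 + \<beta>\<^sup>2)" by (simp add: 1)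
      \<comment> \<open>The two-square identity: the tangential component
        \<open>p * \<alpha> + q * \<beta>\<close> vanishes and the normal one is the signed
        curvature times the speed.\<close>
      also have "\<dots> = (p * \<alpha> + q * \<beta>)\<^sup>2 + (p * \<beta> - q * \<alpha>)\<^sup>2" by (simp add: power2_eq_square algebra_simps)
      also have "p * \<beta> - q * \<alpha> = r x * (s * (2 * sqrt m_star * \<Lambda> * M.cn (\<sigma> x)))" unfolding sc using r by simp
      finally have "(norm (\<tau> x))\<^sup>2 = (r x)\<^sup>2 * (s\<^sup>2 * ((sqrt m_star)\<^sup>2 * 4 * \<Lambda>\<^sup>2 * (M.cn (\<sigma> x))\<^sup>2))"
        unfolding 2 3 by (simp add: power_mult_distrib mult_ac)
      then have "(norm (\<tau> x))\<^sup>2 = (r x)\<^sup>2 * (m_star * 4 * \<Lambda>\<^sup>2 * (M.cn (\<sigma> x))\<^sup>2)"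
        unfolding s2 M.sqrt_m(2) by simp
      then have "(norm (\<tau> x))\<^sup>2 / r x = r x * (m_star * 4 * \<Lambda>\<^sup>2 * (M.cn (\<sigma> x))\<^sup>2)"
        using r by (simp add: power2_eq_square)
      then show "(norm (\<tau> x))\<^sup>2 / r x = k2 x" by (simp add: k2_def mult_ac)
    qed
  qed
  obtain Z where Z: "negligible Z" "\<And>x. x \<in> {a..b} - Z \<Longrightarrow> (norm (\<tau> x))\<^sup>2 / r x = k2 x"
    using AE_interval_negligible[OF ae] by blast
  have "bending_energy a b \<gamma> = integral {a..b} k2"
    unfolding frame_bending_energy[OF frame] by (rule integral_spike[OF Z(1)]) (simp add: Z(2))
  then show ?thesis by (simp add: integral_k2)
qed

lemma half_fold_normalized_energy:
  assumes "half_fold_figure_eight_elastica a b \<gamma>"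
  shows "curve_length a b \<gamma> > 0" "bending_energy a b \<gamma> = varpi_star / curve_length a b \<gamma>"
proof -
  have "immersed_H2_curve a b \<gamma>" using assms by (simp add: half_fold_figure_eight_elastica_def)
  then obtain r T \<tau> where f: "frame a b \<gamma> r T \<tau>" by (rule immersed_H2_curve_frame)
  then interpret framed_curve a b \<gamma> r T \<tau> by unfold_locales
  show "curve_length a b \<gamma> > 0" "bending_energy a b \<gamma> = varpi_star / curve_length a b \<gamma>"
    using half_fold_energy[OF assms] L_pos by (simp_all add: frame_curve_length[OF f] L_def)
qed

lemma closed_leaf_energy:
  assumes im: "immersed_H2_curve a b \<gamma>" and cl: "\<gamma> a = \<gamma> b"
  shows "curve_length a b \<gamma> > 0" "varpi_star / curve_length a b \<gamma> \<le> bending_energy a b \<gamma>"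
    "bending_energy a b \<gamma> = varpi_star / curve_length a b \<gamma> \<Longrightarrow> half_fold_figure_eight_elastica a b \<gamma>"
proof -
  from im obtain r T \<tau> where f: "frame a b \<gamma> r T \<tau>" by (rule immersed_H2_curve_frame)
  then interpret leaf a b \<gamma> r T \<tau> using cl by unfold_locales
  show "curve_length a b \<gamma> > 0" "varpi_star / curve_length a b \<gamma> \<le> bending_energy a b \<gamma>"
    "bending_energy a b \<gamma> = varpi_star / curve_length a b \<gamma> \<Longrightarrow> half_fold_figure_eight_elastica a b \<gamma>"
    using energy_ge half_fold_if_energy_eq[OF _ im] L_pos by (simp_all add: frame_curve_length[OF f] L_def)
qed

section \<open>Decomposition into leaves\<close>

lemma length_energy_sum:
  assumes im: "immersed_H2_curve (q 0) (q k) \<gamma>" and q: "\<And>i. i < k \<Longrightarrow> q i < q (Suc i)" and k: "k > 0"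
  shows "curve_length (q 0) (q k) \<gamma> = (\<Sum>i<k. curve_length (q i) (q (Suc i)) \<gamma>)"
    "bending_energy (q 0) (q k) \<gamma> = (\<Sum>i<k. bending_energy (q i) (q (Suc i)) \<gamma>)"
proof -
  obtain r T \<tau> where f: "frame (q 0) (q k) \<gamma> r T \<tau>" using immersed_H2_curve_frame[OF im] by blast
  have mono: "i \<le> j \<Longrightarrow> j \<le> k \<Longrightarrow> q i \<le> q j" for i j
    by (induction rule: dec_induct) (auto intro: order_trans[OF _ less_imp_le[OF q]])
  \<comment> \<open>A frame lives on a nondegenerate interval, so the statement starts at one piece
    and the step from zero to one piece is trivial.\<close>
  have "n > 0 \<Longrightarrow> n \<le> k \<Longrightarrow> curve_length (q 0) (q n) \<gamma> = (\<Sum>i<n. curve_length (q i) (q (Suc i)) \<gamma>) \<and>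
    bending_energy (q 0) (q n) \<gamma> = (\<Sum>i<n. bending_energy (q i) (q (Suc i)) \<gamma>)" for n
  proof (induction n)
    case (Suc n)
    show ?case
    proof (cases "n = 0")
      case False
      have lt: "q 0 < q n" using mono[of 1 n] q[of 0] Suc.prems False by auto
      have lt': "q n < q (Suc n)" using q[of n] Suc.prems by simp
      have "frame (q 0) (q (Suc n)) \<gamma> r T \<tau>"
        by (rule frame_subinterval[OF f]) (use lt lt' mono[of "Suc n" k] Suc.prems in auto)
      from length_energy_combine[OF this lt lt'] Suc False show ?thesis by simp
    qed simp
  qed simp
  from this[OF k order_refl] show
    "curve_length (q 0) (q k) \<gamma> = (\<Sum>i<k. curve_length (q i) (q (Suc i)) \<gamma>)"
    "bending_energy (q 0) (q k) \<gamma> = (\<Sum>i<k. bending_energy (q i) (q (Suc i)) \<gamma>)" by auto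
qed

text \<open>The bound \<open>v / L i \<ge> v (2 / l - L i / l\<^sup>2)\<close> by the tangent line at the mean length \<open>l\<close>
  is an equality only for \<open>L i = l\<close>.\<close>

lemma equality_in_length_energy_product:
  fixes L B :: "nat \<Rightarrow> real"
  assumes k: "k > 0" and v: "v > 0" and L: "\<And>i. i < k \<Longrightarrow> L i > 0" and B: "\<And>i. i < k \<Longrightarrow> v / L i \<le> B i"
    and eq: "(\<Sum>i<k. L i) * (\<Sum>i<k. B i) = v * (real k)\<^sup>2" and i: "i < k"
  shows "L i = (\<Sum>i<k. L i) / real k" "B i = v / L i"
proof -
  define S where "S = (\<Sum>i<k. L i)"
  define l where "l = S / real k"
  have "S > 0" unfolding S_def using k L by (intro sum_pos) auto
  then have l: "l > 0" "S = real k * l" using k by (auto simp: l_def)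
  define d where "d i = B i - v * (2 / l - L i / l\<^sup>2)" for i
  have d: "d i = (B i - v / L i) + v * (L i - l)\<^sup>2 / (L i * l\<^sup>2)" if "i < k" for i
    using L[OF that] l by (simp add: d_def field_simps power2_eq_square)
  have nn: "0 \<le> B i - v / L i" "0 \<le> v * (L i - l)\<^sup>2 / (L i * l\<^sup>2)" if "i < k" for i
    using B[OF that] L[OF that] v l by auto
  have "(\<Sum>i<k. d i) = (\<Sum>i<k. B i) - v * (real k * (2 / l) - S / l\<^sup>2)"
    by (simp add: d_def sum_subtractf sum_distrib_left[symmetric] sum_divide_distrib[symmetric] S_def)
  also have "(\<Sum>i<k. B i) = v * real k / l"
    using eq l k unfolding S_def[symmetric] by (simp add: field_simps power2_eq_square)
  also have "v * real k / l - v * (real k * (2 / l) - S / l\<^sup>2) = 0"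
    using l by (simp add: field_simps power2_eq_square)
  finally have "(\<Sum>i<k. d i) = 0" .
  moreover have "0 \<le> d i" if "i < k" for i using d[OF that] nn[OF that] by linarith
  ultimately have "d i = 0"
    using i sum_nonneg_eq_0_iff[of "{..<k}" d] by simp
  then have 0: "B i - v / L i = 0" "v * (L i - l)\<^sup>2 / (L i * l\<^sup>2) = 0"
    using d[OF i] nn[OF i] by linarith+
  show "B i = v / L i" using 0(1) by simp
  have "L i = l" using 0(2) L[OF i] v l(1) by simp
  then show "L i = (\<Sum>i<k. L i) / real k" unfolding l_def S_def .
qed

section \<open>Cutting a closed curve at its multiple point\<close>

lemma periodic_add_int:
  fixes \<gamma> :: "real \<Rightarrow> 'a"
  assumes "\<And>t. \<gamma> (t + 1) = \<gamma> t"
  shows "\<gamma> (t + of_int n) = \<gamma> t"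
proof (induction n rule: int_induct[where k = 0])
  case (step1 i) then show ?case using assms[of "t + of_int i"] by (simp add: add.assoc)
next
  case (step2 i) then show ?case using assms[of "t + of_int (i - 1)"] by simp
qed simp

text \<open>By periodicity the shift may be taken as \<open>s\<close> in [0, 1). Cutting [0, 1] at
  \<open>s\<close> and [s, 1 + s] at 1 leaves a common piece and two pieces that are translates by
  one period.\<close>

lemma length_energy_rotate:
  assumes c: "immersed_closed_H2_curve \<gamma>"
  shows "curve_length 0 1 (\<lambda>t. \<gamma> (t + t0)) = curve_length 0 1 \<gamma>"
    "bending_energy 0 1 (\<lambda>t. \<gamma> (t + t0)) = bending_energy 0 1 \<gamma>"
proof -
  have per: "\<And>t. \<gamma> (t + 1) = \<gamma> t" and im: "\<And>a b. a < b \<Longrightarrow> immersed_H2_curve a b \<gamma>"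
    using c by (auto simp: immersed_closed_iff)
  define s where "s = frac t0"
  have s: "0 \<le> s" "s < 1" by (auto simp: s_def frac_lt_1)
  have "(\<lambda>t. \<gamma> (t + t0)) = (\<lambda>t. \<gamma> (t + s))"
  proof
    fix t show "\<gamma> (t + t0) = \<gamma> (t + s)"
      using periodic_add_int[of \<gamma> "t + s" "\<lfloor>t0\<rfloor>", OF per] by (simp add: s_def frac_def)
  qed
  moreover have "curve_length 0 1 (\<lambda>t. \<gamma> (t + s)) = curve_length 0 1 \<gamma> \<and>
    bending_energy 0 1 (\<lambda>t. \<gamma> (t + s)) = bending_energy 0 1 \<gamma>"
  proof (cases "s = 0")
    case False
    then have s: "0 < s" "s < 1" using s by auto
    obtain r T \<tau> where f: "frame 0 2 \<gamma> r T \<tau>" using immersed_H2_curve_frame[OF im[of 0 2]] by auto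
    have f1: "frame 0 1 \<gamma> r T \<tau>" and f2: "frame s (1 + s) \<gamma> r T \<tau>" and f3: "frame (0 + 1) (s + 1) \<gamma> r T \<tau>"
      by (rule frame_subinterval[OF f]; use s in simp)+
    have "frame (0 + s) (1 + s) \<gamma> r T \<tau>" using f2 by simp
    note sh = length_energy_shift[OF this]
    have per': "(\<lambda>x. \<gamma> (x + 1)) = \<gamma>" using per by auto
    show ?thesis
      using sh length_energy_combine[OF f1 s] length_energy_combine[OF f2, of 1] s
        length_energy_shift[OF f3, unfolded per']
      by (simp add: add.commute)
  qed simp
  ultimately show "curve_length 0 1 (\<lambda>t. \<gamma> (t + t0)) = curve_length 0 1 \<gamma>"
    "bending_energy 0 1 (\<lambda>t. \<gamma> (t + t0)) = bending_energy 0 1 \<gamma>" by auto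
qed

lemma closed_leafed_elastica_energy:
  assumes c: "immersed_closed_H2_curve \<gamma>" and k: "k > 0" and l: "closed_leafed_elastica k \<gamma>"
  shows "normalized_bending_energy \<gamma> = varpi_star * (real k)\<^sup>2"
proof -
  obtain t0 p where im: "immersed_H2_curve 0 1 (\<lambda>t. \<gamma> (t + t0))" and p: "p 0 = 0" "p k = 1" "\<And>i. i < k \<Longrightarrow> p i < p (Suc i)"
    and hf: "\<And>i. i < k \<Longrightarrow> half_fold_figure_eight_elastica (p i) (p (Suc i)) (\<lambda>t. \<gamma> (t + t0))"
    and len: "\<And>i j. i < k \<Longrightarrow> j < k \<Longrightarrow> curve_length (p i) (p (Suc i)) (\<lambda>t. \<gamma> (t + t0)) = curve_length (p j) (p (Suc j)) (\<lambda>t. \<gamma> (t + t0))"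
    using l unfolding closed_leafed_elastica_def leafed_elastica_def by blast
  let ?g = "\<lambda>t. \<gamma> (t + t0)"
  define l where "l = curve_length (p 0) (p (Suc 0)) ?g"
  have li: "curve_length (p i) (p (Suc i)) ?g = l" if "i < k" for i
    unfolding l_def using that k by (intro len) auto
  have l0: "l > 0" unfolding l_def by (rule half_fold_normalized_energy(1)[OF hf[OF k]])
  have bi: "bending_energy (p i) (p (Suc i)) ?g = varpi_star / l" if "i < k" for i
    using half_fold_normalized_energy(2)[OF hf[OF that]] li[OF that] by simp
  have im': "immersed_H2_curve (p 0) (p k) ?g" using im p by simp
  have "curve_length 0 1 ?g = real k * l" "bending_energy 0 1 ?g = real k * (varpi_star / l)"
    using length_energy_sum[OF im' p(3) k] li bi p by simp_all
  then show ?thesis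
    using l0 by (simp add: normalized_bending_energy_def length_energy_rotate[OF c] power2_eq_square)
qed

lemma closed_leafed_elastica_if_energy_eq:
  assumes c: "immersed_closed_H2_curve \<gamma>" and k: "k > 0" and mult: "has_multiplicity \<gamma> P k"
    and eq: "normalized_bending_energy \<gamma> = varpi_star * (real k)\<^sup>2"
  shows "closed_leafed_elastica k \<gamma>"
proof -
  have per: "\<And>t. \<gamma> (t + 1) = \<gamma> t" and im: "\<And>a b. a < b \<Longrightarrow> immersed_H2_curve a b \<gamma>"
    using c by (auto simp: immersed_closed_iff)
  obtain S where S: "S \<subseteq> {0..<1}" "finite S" "card S = k" "\<And>x. x \<in> S \<Longrightarrow> \<gamma> x = P"
    using mult by (auto simp: has_multiplicity_def)
  define xs where "xs = sorted_list_of_set S"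
  have xs: "length xs = k" "set xs = S" "sorted_wrt (<) xs"
    using S by (auto simp: xs_def strict_sorted_iff)
  define t0 where "t0 = xs ! 0"
  \<comment> \<open>The sorted preimages, shifted so that the first is 0. The last break point 1 is
    the periodic copy of the first, so all \<open>k\<close> arcs begin and end at the multiple
    point.\<close>
  define q where "q i = (if i < k then xs ! i - t0 else 1)" for i
  have xsS: "xs ! i \<in> S" if "i < k" for i using that xs by auto
  have t0: "0 \<le> t0" using xsS[OF k] S(1) by (auto simp: t0_def)
  have q0: "q 0 = 0" and qk: "q k = 1" using k by (auto simp: q_def t0_def)
  have qlt: "q i < q (Suc i)" if i: "i < k" for i
  proof (cases "Suc i < k")
    case True
    then show ?thesis using sorted_wrt_nth_less[OF xs(3), of i "Suc i"] xs(1) i by (simp add: q_def)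
  next
    case False
    then show ?thesis using xsS[OF i] S(1) t0 i by (auto simp: q_def)
  qed
  let ?g = "\<lambda>t. \<gamma> (t + t0)"
  have gP: "?g (q i) = P" if "i \<le> k" for i
    using that S(4)[OF xsS[of i]] S(4)[OF xsS[OF k]] per[of t0] by (auto simp: q_def t0_def add.commute)
  have img: "immersed_H2_curve a b ?g" if "a < b" for a b
  proof -
    have i: "immersed_H2_curve (a + t0) (b + t0) \<gamma>" by (rule im) (use that in simp)
    obtain r T \<tau> where f: "frame (a + t0) (b + t0) \<gamma> r T \<tau>"
      using immersed_H2_curve_frame[OF i] by blast
    have "H2_curve (a + t0) (b + t0) \<gamma>" using i by (simp add: immersed_H2_curve_def)
    then show ?thesis by (intro frame_immersed[OF frame_shift[OF f]] H2_curve_shift)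
  qed
  define L where "L i = curve_length (q i) (q (Suc i)) ?g" for i
  define B where "B i = bending_energy (q i) (q (Suc i)) ?g" for i
  have leaf: "L i > 0" "varpi_star / L i \<le> B i"
    "B i = varpi_star / L i \<Longrightarrow> half_fold_figure_eight_elastica (q i) (q (Suc i)) ?g" if i: "i < k" for i
    unfolding L_def B_def using closed_leaf_energy[OF img[OF qlt[OF i]]] gP[of i] gP[of "Suc i"] i by auto
  have "immersed_H2_curve (q 0) (q k) ?g" using q0 qk by (intro img) simp
  from length_energy_sum[OF this qlt k]
  have "curve_length 0 1 \<gamma> = (\<Sum>i<k. L i)" "bending_energy 0 1 \<gamma> = (\<Sum>i<k. B i)"
    unfolding q0 qk length_energy_rotate[OF c] by (simp_all add: L_def B_def)
  then have "(\<Sum>i<k. L i) * (\<Sum>i<k. B i) = varpi_star * (real k)\<^sup>2"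
    using eq by (simp add: normalized_bending_energy_def)
  note E = equality_in_length_energy_product[OF k varpi_star_pos leaf(1,2) this]
  have "leafed_elastica k 0 1 ?g"
    unfolding leafed_elastica_def
  proof (intro conjI exI[of _ q] allI impI)
    show "half_fold_figure_eight_elastica (q i) (q (Suc i)) ?g" if "i < k" for i
      using leaf(3)[OF that] E(2) that by blast
    show "curve_length (q i) (q (Suc i)) ?g = curve_length (q j) (q (Suc j)) ?g" if "i < k" "j < k" for i j
      using E(1)[of i] E(1)[of j] that unfolding L_def by simp
  qed (use img q0 qk qlt in auto)
  moreover have "closed_H2_curve \<gamma>" using c by (simp add: immersed_closed_H2_curve_def)
  ultimately show ?thesis unfolding closed_leafed_elastica_def by blast
qed

section \<open>Existence\<close>

text \<open>Pieces that are continuously differentiable and match at the integers give an indefinite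
  integral; the derivatives may jump. Applied to position, tangent and energy, it replaces any case
  analysis at the junctions.\<close>

lemma AC_glue:
  fixes F G :: "int \<Rightarrow> real \<Rightarrow> 'a::euclidean_space"
  assumes k: "k > 0" and F: "\<And>i s. (F i has_vector_derivative G i s) (at s)" and G: "\<And>i. continuous_on UNIV (G i)"
    and glue: "\<And>i. F i (of_int (i + 1)) = F (i + 1) (of_int (i + 1))"
  shows "AC a b (\<lambda>t. F \<lfloor>k * t\<rfloor> (k * t)) (\<lambda>t. k *\<^sub>R G \<lfloor>k * t\<rfloor> (k * t))"
proof -
  let ?f = "\<lambda>t. F \<lfloor>k * t\<rfloor> (k * t)" and ?g = "\<lambda>t. k *\<^sub>R G \<lfloor>k * t\<rfloor> (k * t)"
  have one: "AC (of_int i / k) (of_int (i + 1) / k) ?f ?g" for i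
  proof -
    have i: "AC (of_int i / k) (of_int (i + 1) / k) (\<lambda>t. F i (k * t)) (\<lambda>t. k *\<^sub>R G i (k * t))"
    proof (rule AC_of_deriv)
      show "continuous_on {of_int i / k..of_int (i + 1) / k} (\<lambda>t. k *\<^sub>R G i (k * t))"
        by (intro continuous_intros continuous_on_compose2[OF G]) auto
      fix t
      have "((\<lambda>t. k * t) has_vector_derivative k) (at t within X)" for X
        by (auto intro!: derivative_eq_intros simp: has_real_derivative_iff_has_vector_derivative[symmetric])
      from vector_diff_chain_within[OF this has_vector_derivative_at_within[OF F]]
      show "((\<lambda>t. F i (k * t)) has_vector_derivative k *\<^sub>R G i (k * t)) (at t within {of_int i / k..of_int (i + 1) / k})"
        by (simp add: o_def)
    qed
    have fl: "\<lfloor>k * t\<rfloor> = i" if "t \<in> {of_int i / k..of_int (i + 1) / k}" "t \<noteq> of_int (i + 1) / k" for t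
    proof -
      have "of_int i \<le> k * t" "k * t < of_int i + 1" using that k by (auto simp: field_simps order.strict_iff_order)
      then show ?thesis by (simp add: floor_eq_iff)
    qed
    show ?thesis
    proof (rule AC_cong[OF i, where N = "{of_int (i + 1) / k}"])
      show "?f t = F i (k * t)" if "t \<in> {of_int i / k..of_int (i + 1) / k}" for t
      proof (cases "t = of_int (i + 1) / k")
        case True
        \<comment> \<open>At the right end the floor already selects the next piece, and the
          matching condition makes the values agree.\<close>
        then have "k * t = of_int (i + 1)" using k by simp
        then show ?thesis using glue[of i] by (simp only: floor_of_int)
      next
        case False then show ?thesis using fl[OF that] by simp
      qed
    qed (use fl in auto)
  qed
  have many: "AC (of_int i / k) (of_int (i + int n) / k) ?f ?g" for i n
  proof (induction n)
    case 0
    show ?case by (rule AC_subinterval[OF one[of i]]) (use k in \<open>auto simp: divide_right_mono\<close>)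
  next
    case (Suc n)
    have "AC (of_int (i + int n) / k) (of_int (i + int (Suc n)) / k) ?f ?g"
      using one[of "i + int n"] by (simp add: add_ac)
    then show ?case by (rule AC_combine[OF Suc]) (use k in \<open>auto simp: divide_right_mono\<close>)
  qed
  define i where "i = \<lfloor>k * a\<rfloor>"
  define n where "n = nat (\<lceil>k * b\<rceil> - i)"
  have "of_int i \<le> k * a" by (simp add: i_def)
  moreover have "k * b \<le> of_int (i + int n)" unfolding n_def by linarith
  ultimately show ?thesis
    using k by (intro AC_subinterval[OF many[of i n]]) (auto simp: field_simps)
qed

text \<open>\<open>q i\<close> is the tangent at the junction where leaf \<open>i\<close> begins.
  Position and tangent match at every junction, and all leaves begin and end at the origin, which
  thereby gets multiplicity \<open>k\<close>.\<close>

lemma leaf_chain_exists: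
  fixes q :: "int \<Rightarrow> 'a::euclidean_space" and k :: nat
  assumes k: "k > 0" and norm_q: "\<And>i. norm (q i) = 1"
    and inner_q: "\<And>i. q i \<bullet> q (i + 1) = 1 - 8 * m_star + 8 * m_star\<^sup>2"
    and per: "\<And>i. q (i + int k) = q i"
  shows "\<exists>\<gamma> :: real \<Rightarrow> 'a. immersed_closed_H2_curve \<gamma> \<and> (\<exists>p. has_multiplicity \<gamma> p k) \<and>
            normalized_bending_energy \<gamma> = varpi_star * (real k)\<^sup>2"
proof -
  let ?m = m_star
  have m: "3/4 \<le> ?m" "?m < 1" using m_star by auto
  \<comment> \<open>\<open>A\<close> and \<open>C\<close> are twice the values of \<open>zs\<close>
    and \<open>ys\<close> at K. Solving q i = (A/2) e - (C/2) w and q (i+1) = (A/2) e + (C/2) w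
    gives the middle tangent \<open>e i\<close> and normal \<open>w i\<close> of leaf
    \<open>i\<close>; the prescribed inner product makes them orthonormal.\<close>
  define A where "A = 2 * (1 - 2 * ?m)"
  define C where "C = 4 * (sqrt ?m * sqrt (1 - ?m))"
  have A: "A \<noteq> 0" using m by (simp add: A_def)
  have C: "C > 0" "C\<^sup>2 = 16 * (?m * (1 - ?m))" using m by (simp_all add: C_def power_mult_distrib)
  define e where "e i = (1 / A) *\<^sub>R (q i + q (i + 1))" for i
  define w where "w i = (1 / C) *\<^sub>R (q (i + 1) - q i)" for i
  have qq: "q i \<bullet> q i = 1" for i using norm_q by (simp add: norm_eq_1)
  have qc: "q (i + 1) \<bullet> q i = 1 - 8 * ?m + 8 * ?m\<^sup>2" for i using inner_q by (simp add: inner_commute)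
  have ee: "e i \<bullet> e i = 1" for i
  proof -
    have "(q i + q (i + 1)) \<bullet> (q i + q (i + 1)) = 2 + 2 * (1 - 8 * ?m + 8 * ?m\<^sup>2)"
      by (simp add: inner_add_left inner_add_right qq qc inner_q)
    then have "e i \<bullet> e i = (1 / A)\<^sup>2 * (2 + 2 * (1 - 8 * ?m + 8 * ?m\<^sup>2))"
      unfolding e_def inner_scaleR_left inner_scaleR_right by (simp add: power2_eq_square)
    also have "2 + 2 * (1 - 8 * ?m + 8 * ?m\<^sup>2) = A\<^sup>2" by (simp add: A_def power2_eq_square algebra_simps)
    finally show ?thesis using A by (simp add: power_divide)
  qed
  have ww: "w i \<bullet> w i = 1" for i
  proof -
    have "(q (i + 1) - q i) \<bullet> (q (i + 1) - q i) = 2 - 2 * (1 - 8 * ?m + 8 * ?m\<^sup>2)"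
      by (simp add: inner_diff_left inner_diff_right qq qc inner_q)
    then have "w i \<bullet> w i = (1 / C)\<^sup>2 * (2 - 2 * (1 - 8 * ?m + 8 * ?m\<^sup>2))"
      unfolding w_def inner_scaleR_left inner_scaleR_right by (simp add: power2_eq_square)
    also have "2 - 2 * (1 - 8 * ?m + 8 * ?m\<^sup>2) = C\<^sup>2" unfolding C by (simp add: power2_eq_square algebra_simps)
    finally show ?thesis using C(1) by (simp add: power_divide)
  qed
  have ew: "e i \<bullet> w i = 0" "w i \<bullet> e i = 0" for i
  proof -
    have "(q i + q (i + 1)) \<bullet> (q (i + 1) - q i) = 0"
      by (simp add: inner_diff_right inner_add_left qq qc inner_q)
    then show "e i \<bullet> w i = 0" by (simp add: e_def w_def)
    then show "w i \<bullet> e i = 0" by (simp add: inner_commute)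
  qed
  define u where "u i s = M.K * (2 * (s - of_int i) - 1)" for i :: int and s :: real
  have u': "(u i has_real_derivative 2 * M.K) (at s)" for i s
    unfolding u_def[abs_def] by (auto intro!: derivative_eq_intros)
  have cu: "continuous_on UNIV (u i)" for i unfolding u_def by (intro continuous_intros)
  have cF: "continuous_on UNIV (\<lambda>s. F (u i s))" if "continuous_on UNIV F" for F :: "real \<Rightarrow> real" and i
    by (rule continuous_on_compose2[OF that cu]) auto
  have uends: "u i (of_int (i + 1)) = M.K" "u (i + 1) (of_int (i + 1)) = - M.K" for i by (simp_all add: u_def)
  \<comment> \<open>The primitives of \<open>zs\<close> and \<open>ys\<close> that vanish at both
    ends; for \<open>Z\<close> this is K = 2 E.\<close>
  define Z where "Z v = 2 * M.Einc (M.am v) - v" for v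
  define X where "X v = - (2 * sqrt ?m * M.cn v)" for v
  have Z': "(Z has_real_derivative M.zs v) (at v)" and X': "(X has_real_derivative M.ys v) (at v)" for v
    using M.zs_primitive M.ys_primitive by (simp_all add: Z_def[abs_def] X_def[abs_def])
  have ZK: "Z M.K = 0" "Z (- M.K) = 0" and XK: "X M.K = 0" "X (- M.K) = 0"
    unfolding Z_def X_def M.am_K M.am_mK M.Einc_odd M.Einc_pi_half M.E_def[symmetric] M.K_values
    by (simp_all add: K_eq_2E)
  have lift: "((\<lambda>s. f (u i s) *\<^sub>R p + g (u i s) *\<^sub>R p') has_vector_derivative
      ((f' (u i s)) * (2 * M.K)) *\<^sub>R p + ((g' (u i s)) * (2 * M.K)) *\<^sub>R p') (at s)"
    if "\<And>v. (f has_real_derivative f' v) (at v)" "\<And>v. (g has_real_derivative g' v) (at v)"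
    for f f' g g' :: "real \<Rightarrow> real" and i s and p p' :: 'a
  proof -
    have d: "((\<lambda>s. f (u i s)) has_vector_derivative f' (u i s) * (2 * M.K)) (at s)"
      "((\<lambda>s. g (u i s)) has_vector_derivative g' (u i s) * (2 * M.K)) (at s)"
      unfolding has_real_derivative_iff_has_vector_derivative[symmetric]
      by (rule DERIV_chain2[OF that(1) u'] DERIV_chain2[OF that(2) u'])+
    show ?thesis
      by (intro has_vector_derivative_add bounded_linear.has_vector_derivative[OF bounded_linear_scaleR_left] d)
  qed
  define \<kappa> where "\<kappa> v = 2 * sqrt ?m * M.cn v" for v
  \<comment> \<open>The factor 1 / (2 K) gives every leaf unit length and unit speed in
    \<open>s\<close>, hence speed \<open>k\<close> in \<open>t\<close>.\<close>
  define F0 where "F0 i s = (1 / (2 * M.K)) *\<^sub>R (Z (u i s) *\<^sub>R e i + X (u i s) *\<^sub>R w i)" for i s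
  define F1 where "F1 i s = M.zs (u i s) *\<^sub>R e i + M.ys (u i s) *\<^sub>R w i" for i s
  define F2 where "F2 i s = (- (\<kappa> (u i s) * M.ys (u i s)) * (2 * M.K)) *\<^sub>R e i + (\<kappa> (u i s) * M.zs (u i s) * (2 * M.K)) *\<^sub>R w i" for i s
  have F01: "(F0 i has_vector_derivative F1 i s) (at s)" for i s
  proof -
    have "(F0 i has_vector_derivative (1 / (2 * M.K)) *\<^sub>R ((M.zs (u i s) * (2 * M.K)) *\<^sub>R e i + (M.ys (u i s) * (2 * M.K)) *\<^sub>R w i)) (at s)"
      unfolding F0_def[abs_def] by (rule bounded_linear.has_vector_derivative[OF bounded_linear_scaleR_right lift[OF Z' X']])
    then show ?thesis using M.K_pos by (simp add: F1_def scaleR_add_right)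
  qed
  have F12: "(F1 i has_vector_derivative F2 i s) (at s)" for i s
    unfolding F1_def[abs_def] F2_def \<kappa>_def by (rule lift[OF M.zs_derivative M.ys_derivative])
  have c1: "continuous_on UNIV (F1 i)" for i
    unfolding F1_def[abs_def] by (intro continuous_intros cF M.elliptic_continuous)
  have c2: "continuous_on UNIV (F2 i)" for i
    unfolding F2_def[abs_def] \<kappa>_def[abs_def] by (intro continuous_intros cF M.elliptic_continuous)
  have g0: "F0 i (of_int (i + 1)) = F0 (i + 1) (of_int (i + 1))" for i
    unfolding F0_def uends ZK XK by simp
  have ends: "M.zs M.K = A / 2" "M.zs (- M.K) = A / 2" "M.ys M.K = C / 2" "M.ys (- M.K) = - (C / 2)"
    by (simp_all add: M.zs_def M.ys_def M.K_values A_def C_def M.dn_def M.am_K M.am_mK M.\<Delta>_def)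
  have g1: "F1 i (of_int (i + 1)) = F1 (i + 1) (of_int (i + 1))" for i
  proof -
    have "F1 i (of_int (i + 1)) = q (i + 1)"
      unfolding F1_def uends ends e_def w_def using A C
      by (simp add: algebra_simps scaleR_add_left[symmetric])
    moreover have "F1 (i + 1) (of_int (i + 1)) = q (i + 1)"
      unfolding F1_def uends ends e_def w_def using A C
      by (simp add: algebra_simps scaleR_add_left[symmetric])
    ultimately show ?thesis by simp
  qed
  let ?k = "real k"
  have k0: "?k > 0" using k by simp
  define \<gamma> where "\<gamma> t = F0 \<lfloor>?k * t\<rfloor> (?k * t)" for t
  define T where "T t = F1 \<lfloor>?k * t\<rfloor> (?k * t)" for t
  define h where "h t = F2 \<lfloor>?k * t\<rfloor> (?k * t)" for t
  have AC0: "AC a b \<gamma> (\<lambda>t. ?k *\<^sub>R T t)" for a b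
    unfolding \<gamma>_def T_def by (rule AC_glue[OF k0 F01 c1 g0])
  have AC1: "AC a b T (\<lambda>t. ?k *\<^sub>R h t)" for a b
    unfolding h_def T_def by (rule AC_glue[OF k0 F12 c2 g1])
  define U where "U t = u \<lfloor>?k * t\<rfloor> (?k * t)" for t
  have normT: "norm (T t) = 1" for t
    unfolding norm_eq_1 T_def F1_def
    using M.zs_ys[of "U t"] by (simp add: inner_add_left inner_add_right ee ww ew U_def power2_eq_square)
  have normh: "(norm (?k *\<^sub>R h t))\<^sup>2 = ?k\<^sup>2 * (4 * M.K\<^sup>2 * (4 * ?m * (M.cn (U t))\<^sup>2))" for t
  proof -
    have "(norm (h t))\<^sup>2 = (2 * M.K * \<kappa> (U t))\<^sup>2 * ((M.zs (U t))\<^sup>2 + (M.ys (U t))\<^sup>2)"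
      unfolding power2_norm_eq_inner h_def F2_def U_def
      by (simp add: inner_add_left inner_add_right ee ww ew power2_eq_square algebra_simps)
    also have "\<dots> = 4 * M.K\<^sup>2 * (4 * ?m * (M.cn (U t))\<^sup>2)"
      unfolding M.zs_ys \<kappa>_def by (simp add: power_mult_distrib M.sqrt_m)
    finally show ?thesis by (simp add: power_mult_distrib)
  qed
  define D where "D = 8 * (M.E - (1 - ?m) * M.K)"
  define V where "V v = 4 * (M.Einc (M.am v) - (1 - ?m) * v)" for v
  have V': "(V has_real_derivative 4 * ?m * (M.cn v)\<^sup>2) (at v)" for v
    using M.cn_sq_primitive by (simp add: V_def[abs_def])
  have VK: "V M.K = D / 2" "V (- M.K) = - (D / 2)"
    unfolding V_def D_def M.am_K M.am_mK M.Einc_odd M.Einc_pi_half M.E_def[symmetric]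
    by (simp_all add: field_simps)
  \<comment> \<open>A primitive of the energy density. The summand \<open>of_int i * D\<close>
    collects the energy of the earlier leaves, and \<open>D / 2\<close> makes it start at 0.\<close>
  define G where "G i s = of_int i * D + V (u i s) + D / 2" for i :: int and s
  have AC_G: "AC 0 1 (\<lambda>t. G \<lfloor>?k * t\<rfloor> (?k * t)) (\<lambda>t. ?k *\<^sub>R (4 * ?m * (M.cn (u \<lfloor>?k * t\<rfloor> (?k * t)))\<^sup>2 * (2 * M.K)))"
  proof (rule AC_glue[OF k0])
    fix i s
    have "(G i has_real_derivative 0 + 4 * ?m * (M.cn (u i s))\<^sup>2 * (2 * M.K) + 0) (at s)"
      unfolding G_def[abs_def] by (intro DERIV_add DERIV_const DERIV_chain2[OF V' u'])
    then show "(G i has_vector_derivative 4 * ?m * (M.cn (u i s))\<^sup>2 * (2 * M.K)) (at s)"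
      by (simp add: has_real_derivative_iff_has_vector_derivative)
  next
    show "continuous_on UNIV (\<lambda>s. 4 * ?m * (M.cn (u i s))\<^sup>2 * (2 * M.K))" for i
      by (intro continuous_intros cF M.elliptic_continuous)
    show "G i (of_int (i + 1)) = G (i + 1) (of_int (i + 1))" for i
      unfolding G_def uends VK by (simp add: algebra_simps)
  qed
  have IG: "integral {0..1} (\<lambda>t. ?k *\<^sub>R (4 * ?m * (M.cn (U t))\<^sup>2 * (2 * M.K))) = ?k * D"
  proof -
    have "u (int k) ?k = - M.K" "u 0 0 = - M.K" by (simp_all add: u_def)
    then have "G \<lfloor>?k * 1\<rfloor> (?k * 1) = ?k * D" "G \<lfloor>?k * 0\<rfloor> (?k * 0) = 0"
      by (simp_all add: G_def VK)
    with AC_integral[OF AC_G, of 0 1] show ?thesis unfolding U_def by simp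
  qed
  have h2: "(\<lambda>t. (norm (?k *\<^sub>R h t))\<^sup>2) absolutely_integrable_on {a..b}" for a b
  proof (rule measurable_bounded_by_integrable_imp_absolutely_integrable)
    have "(\<lambda>t. ?k *\<^sub>R h t) \<in> borel_measurable (lebesgue_on {a..b})"
      by (rule absolutely_integrable_imp_borel_measurable[OF AC_integrable[OF AC1]]) simp
    then show "(\<lambda>t. (norm (?k *\<^sub>R h t))\<^sup>2) \<in> borel_measurable (lebesgue_on {a..b})" by measurable
    show "(\<lambda>t. ?k\<^sup>2 * (4 * M.K\<^sup>2 * (4 * ?m * 1))) integrable_on {a..b}" by (rule integrable_const_ivl)
    show "norm ((norm (?k *\<^sub>R h t))\<^sup>2) \<le> ?k\<^sup>2 * (4 * M.K\<^sup>2 * (4 * ?m * 1))" for t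
    proof -
      have "(M.cn (U t))\<^sup>2 \<le> 1" using M.sn_cn[of "U t"] zero_le_power2[of "M.sn (U t)"] by linarith
      then have "?k\<^sup>2 * (4 * M.K\<^sup>2 * (4 * ?m * (M.cn (U t))\<^sup>2)) \<le> ?k\<^sup>2 * (4 * M.K\<^sup>2 * (4 * ?m * 1))"
        using m by (intro mult_left_mono) auto
      then show ?thesis unfolding normh[symmetric] by simp
    qed
  qed simp
  have frame: "frame a b \<gamma> (\<lambda>_. ?k) T (\<lambda>t. ?k *\<^sub>R h t)" if "a < b" for a b
    unfolding frame_def using that k0 normT AC0 AC1 h2 by (simp add: continuous_on_const)
  have H2: "H2_curve a b \<gamma>" if "a < b" for a b
    unfolding H2_curve_iff
  proof (intro conjI exI)
    show "AC a b \<gamma> (\<lambda>t. ?k *\<^sub>R T t)" by (rule AC0)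
    show "AC a b (\<lambda>t. ?k *\<^sub>R T t) (\<lambda>t. ?k *\<^sub>R (?k *\<^sub>R h t))"
      by (rule AC_linear[OF AC1 bounded_linear_scaleR_right])
    have "(\<lambda>t. (norm (?k *\<^sub>R (?k *\<^sub>R h t)))\<^sup>2) = (\<lambda>t. ?k\<^sup>2 * (norm (?k *\<^sub>R h t))\<^sup>2)"
      by (simp add: power_mult_distrib)
    then show "(\<lambda>t. (norm (?k *\<^sub>R (?k *\<^sub>R h t)))\<^sup>2) absolutely_integrable_on {a..b}"
      using set_integrable_mult_right[of "?k\<^sup>2" lebesgue "{a..b}", OF h2] by simp
  qed (rule that)
  have "\<gamma> (t + 1) = \<gamma> t" for t
  proof -
    have "?k * (t + 1) = ?k * t + of_int (int k)" by (simp add: algebra_simps)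
    then have fl: "\<lfloor>?k * (t + 1)\<rfloor> = \<lfloor>?k * t\<rfloor> + int k" by (simp only: floor_add_int)
    have "q (j + int k + 1) = q (j + 1)" for j using per[of "j + 1"] by (simp add: add_ac)
    then have ew: "e (j + int k) = e j" "w (j + int k) = w j" for j by (simp_all add: e_def w_def per)
    have "u (j + int k) (s + real k) = u j s" for j s by (simp add: u_def)
    then show ?thesis
      unfolding \<gamma>_def fl F0_def ew by (simp add: distrib_left)
  qed
  then have closed: "immersed_closed_H2_curve \<gamma>"
    unfolding immersed_closed_iff using frame_immersed[OF frame H2] by blast
  moreover have "has_multiplicity \<gamma> 0 k"
    unfolding has_multiplicity_def
  proof (intro exI conjI ballI)
    let ?S = "(\<lambda>i. real i / ?k) ` {..<k}"
    show "?S \<subseteq> {0..<1}" using k by auto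
    show "finite ?S" by simp
    have "inj_on (\<lambda>i. real i / ?k) {..<k}" using k by (auto simp: inj_on_def)
    then show "card ?S = k" by (simp add: card_image)
    fix t assume "t \<in> ?S"
    then obtain i where i: "?k * t = of_int (int i)" using k by auto
    have "u (int i) (of_int (int i)) = - M.K" by (simp add: u_def)
    then show "\<gamma> t = 0" unfolding \<gamma>_def i floor_of_int F0_def by (simp add: ZK XK)
  qed
  moreover have "normalized_bending_energy \<gamma> = varpi_star * ?k\<^sup>2"
  proof -
    have f: "frame 0 1 \<gamma> (\<lambda>_. ?k) T (\<lambda>t. ?k *\<^sub>R h t)" by (rule frame) simp
    have "(norm (?k *\<^sub>R h t))\<^sup>2 / ?k = (2 * M.K) * (?k *\<^sub>R (4 * ?m * (M.cn (U t))\<^sup>2 * (2 * M.K)))" for t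
      unfolding normh using k0 by (simp add: power2_eq_square)
    then have "bending_energy 0 1 \<gamma> = (2 * M.K) * (?k * D)"
      unfolding frame_bending_energy[OF f] by (simp only: integral_mult_right IG)
    moreover have "curve_length 0 1 \<gamma> = ?k"
      unfolding frame_curve_length[OF f] by simp
    ultimately show ?thesis
      by (simp add: normalized_bending_energy_def varpi_star_eq D_def power2_eq_square)
  qed
  ultimately show ?thesis by blast
qed

section \<open>Choice of the junction tangents\<close>

lemma int_succ_mod:
  assumes "k > 0"
  shows "(i + 1) mod int k = (if i mod int k + 1 = int k then 0 else i mod int k + 1)"
proof -
  have b: "0 \<le> i mod int k" "i mod int k < int k" using assms by auto
  have "(i + 1) mod int k = (i mod int k + 1) mod int k" by (simp add: mod_add_left_eq)
  then show ?thesis using b by auto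
qed

text \<open>The cycle is P, Q, R, Q, R, and so on. For odd \<open>k\<close> it ends at R, whose
  product with P is then needed; for even \<open>k\<close> it ends at Q, and R = P makes it an
  alternation of two vectors.\<close>

lemma unit_vector_cycle:
  fixes P Q R :: "'a::euclidean_space" and k :: nat
  assumes k: "k \<ge> 2" and n: "norm P = 1" "norm Q = 1" "norm R = 1"
    and PQ: "P \<bullet> Q = c" and QR: "Q \<bullet> R = c" and RP: "if even k then R = P else R \<bullet> P = c"
  shows "\<exists>q :: int \<Rightarrow> 'a. (\<forall>i. norm (q i) = 1) \<and> (\<forall>i. q i \<bullet> q (i + 1) = c) \<and> (\<forall>i. q (i + int k) = q i)"
proof -
  define f where "f j = (if j = 0 then P else if odd j then Q else R)" for j :: int
  have f: "f j \<bullet> f (if j + 1 = int k then 0 else j + 1) = c" if "0 \<le> j" "j < int k" for j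
  proof (cases "j + 1 = int k")
    case True
    then have ek: "even k \<longleftrightarrow> odd j" by presburger
    have "j \<noteq> 0" using True k by auto
    then show ?thesis using True RP PQ ek by (auto simp: f_def inner_commute)
  next
    case False
    then show ?thesis using that PQ QR by (auto simp: f_def inner_commute)
  qed
  show ?thesis
  proof (intro exI[of _ "\<lambda>i. f (i mod int k)"] conjI allI)
    show "norm (f (i mod int k)) = 1" for i using n by (simp add: f_def)
    show "f (i mod int k) \<bullet> f ((i + 1) mod int k) = c" for i
      using f[of "i mod int k"] k by (simp add: int_succ_mod)
  qed simp
qed

text \<open>Three unit vectors with mutual inner product c have Gram determinant (1 - c)^2 (1 + 2
  c), so c >= -1/2 is what the odd case requires, together with a third dimension.\<close>

lemma unit_vectors_exist:
  assumes n: "CARD('n::finite) \<ge> 2" "CARD('n) \<ge> 3 \<or> even (k::nat)" and c: "- 1/2 \<le> c" "c < 1"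
  shows "\<exists>P Q R :: real ^ 'n. norm P = 1 \<and> norm Q = 1 \<and> norm R = 1 \<and> P \<bullet> Q = c \<and> Q \<bullet> R = c \<and>
    (if even k then R = P else R \<bullet> P = c)"
proof -
  have c2: "c\<^sup>2 \<le> 1" using c by (simp add: abs_square_le_1)
  have c1: "1 + c > 0" "1 - c > 0" using c by auto
  obtain i j :: 'n where ij: "i \<noteq> j"
    using n(1) by (metis One_nat_def card_le_Suc0_iff_eq finite iso_tuple_UNIV_I not_less_eq_eq numeral_2_eq_2)
  define u v :: "real ^ 'n" where "u = axis i 1" and "v = axis j 1"
  have uv: "u \<bullet> u = 1" "v \<bullet> v = 1" "u \<bullet> v = 0" "v \<bullet> u = 0"
    using ij by (auto simp: u_def v_def inner_axis_axis)
  define y where "y = sqrt (1 - c\<^sup>2)"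
  have y2: "y\<^sup>2 = 1 - c\<^sup>2" using c2 by (simp add: y_def)
  define Q where "Q = c *\<^sub>R u + y *\<^sub>R v"
  have Q: "Q \<bullet> Q = 1" "u \<bullet> Q = c" "Q \<bullet> u = c"
    using y2 by (simp_all add: Q_def inner_add_left inner_add_right uv power2_eq_square)
  show ?thesis
  proof (cases "even k")
    case True
    then show ?thesis using Q uv by (intro exI[of _ u] exI[of _ Q] exI[of _ u]) (simp add: norm_eq_1)
  next
    case False
    then have "CARD('n) \<ge> 3" using n by auto
    then have "\<not> (UNIV :: 'n set) \<subseteq> {i, j}"
      using card_mono[of "{i, j}" "UNIV :: 'n set"] card_insert_le_m1[of 2 "{j}" i] by auto
    then obtain l where l: "l \<noteq> i" "l \<noteq> j" by auto
    define w :: "real ^ 'n" where "w = axis l 1"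
    have w: "w \<bullet> w = 1" "u \<bullet> w = 0" "w \<bullet> u = 0" "v \<bullet> w = 0" "w \<bullet> v = 0"
      using l by (auto simp: w_def u_def v_def inner_axis_axis)
    have y0: "y > 0"
    proof -
      have "0 < (1 + c) * (1 - c)" using c1 by simp
      then show ?thesis by (simp add: y_def power2_eq_square algebra_simps)
    qed
    \<comment> \<open>The component \<open>b\<close> is forced by \<open>Q \<bullet> R = c\<close>,
      and \<open>x\<close> by the unit length of \<open>R\<close>; the radicand of \<open>x\<close>
      is nonnegative exactly because 1 + 2 c is.\<close>
    define b where "b = c * (1 - c) / y"
    define x where "x = sqrt ((1 - c) * (1 + 2 * c) / (1 + c))"
    have x2: "x\<^sup>2 = (1 - c) * (1 + 2 * c) / (1 + c)" using c c1 by (simp add: x_def)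
    have by': "b * y = c * (1 - c)" using y0 by (simp add: b_def)
    have y2': "y\<^sup>2 = (1 + c) * (1 - c)" unfolding y2 by (simp add: power2_eq_square algebra_simps)
    have "b\<^sup>2 = (c\<^sup>2 * (1 - c)) * (1 - c) / ((1 + c) * (1 - c))"
      unfolding b_def power_divide y2' by (simp add: power2_eq_square mult_ac)
    also have "\<dots> = c\<^sup>2 * (1 - c) / (1 + c)" using c1 by simp
    finally have b2: "b\<^sup>2 = c\<^sup>2 * (1 - c) / (1 + c)" .
    have sum: "c\<^sup>2 + b\<^sup>2 + x\<^sup>2 = 1"
    proof -
      have "b\<^sup>2 + x\<^sup>2 = ((1 - c) * (1 + c)) * (1 + c) / (1 + c)"
        unfolding b2 x2 add_divide_distrib[symmetric] by (simp add: power2_eq_square algebra_simps)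
      also have "\<dots> = (1 - c) * (1 + c)" using c1 by simp
      finally show ?thesis by (simp add: power2_eq_square algebra_simps)
    qed
    define R where "R = c *\<^sub>R u + b *\<^sub>R v + x *\<^sub>R w"
    have R: "R \<bullet> R = 1" "R \<bullet> u = c" "Q \<bullet> R = c"
      using sum by' by (simp_all add: R_def Q_def inner_add_left inner_add_right uv w power2_eq_square algebra_simps)
    show ?thesis using Q uv R False by (intro exI[of _ u] exI[of _ Q] exI[of _ R]) (simp add: norm_eq_1)
  qed
qed

theorem theorem1p2:
  fixes k :: nat
  assumes "CARD('n::finite) \<ge> 2" and "k \<ge> 2" and "CARD('n) \<ge> 3 \<or> even k"
  shows "(\<exists>\<gamma> :: real \<Rightarrow> real ^ 'n.
            immersed_closed_H2_curve \<gamma> \<and> (\<exists>p. has_multiplicity \<gamma> p k) \<and>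
            normalized_bending_energy \<gamma> = varpi_star * (real k)\<^sup>2) \<and>
         (\<forall>\<gamma> :: real \<Rightarrow> real ^ 'n.
            immersed_closed_H2_curve \<gamma> \<and> (\<exists>p. has_multiplicity \<gamma> p k) \<longrightarrow>
            (normalized_bending_energy \<gamma> = varpi_star * (real k)\<^sup>2 \<longleftrightarrow>
               closed_leafed_elastica k \<gamma>))"
proof (intro conjI allI impI)
  let ?c = "1 - 8 * m_star + 8 * m_star\<^sup>2"
  \<comment> \<open>The factorization shows that the inner product of the end tangents reaches -1/2
    at the parameter 3/4, the lower bound known for \<open>m_star\<close>.\<close>
  have "?c = - 1/2 + 8 * ((m_star - 3/4) * (m_star - 1/4))" by (simp add: power2_eq_square field_simps)
  moreover have "0 \<le> (m_star - 3/4) * (m_star - 1/4)" using m_star by (intro mult_nonneg_nonneg) auto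
  ultimately have c: "- 1/2 \<le> ?c" by linarith
  have "?c = 1 - 8 * (m_star * (1 - m_star))" by (simp add: power2_eq_square algebra_simps)
  moreover have "0 < m_star * (1 - m_star)" using m_star by (intro mult_pos_pos) auto
  ultimately have c': "?c < 1" by linarith
  obtain P Q R :: "real ^ 'n" where "norm P = 1" "norm Q = 1" "norm R = 1" "P \<bullet> Q = ?c" "Q \<bullet> R = ?c"
    "if even k then R = P else R \<bullet> P = ?c"
    using unit_vectors_exist[OF assms(1,3) c c'] by blast
  from unit_vector_cycle[OF assms(2) this]
  obtain q :: "int \<Rightarrow> real ^ 'n" where "\<And>i. norm (q i) = 1" "\<And>i. q i \<bullet> q (i + 1) = ?c" "\<And>i. q (i + int k) = q i"
    by blast
  then show "\<exists>\<gamma> :: real \<Rightarrow> real ^ 'n. immersed_closed_H2_curve \<gamma> \<and> (\<exists>p. has_multiplicity \<gamma> p k) \<and>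
            normalized_bending_energy \<gamma> = varpi_star * (real k)\<^sup>2"
    using assms(2) by (intro leaf_chain_exists[of k q]) auto
  fix \<gamma> :: "real \<Rightarrow> real ^ 'n"
  assume "immersed_closed_H2_curve \<gamma> \<and> (\<exists>p. has_multiplicity \<gamma> p k)"
  then show "normalized_bending_energy \<gamma> = varpi_star * (real k)\<^sup>2 \<longleftrightarrow> closed_leafed_elastica k \<gamma>"
    using closed_leafed_elastica_energy[of \<gamma> k] closed_leafed_elastica_if_energy_eq[of \<gamma> k] assms(2) by fastforce
qed

end
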